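(* Let $\ell>1$ be an integer with prime factorization $\ell=q_{1}^{\beta_{1}}\cdots q_{m}^{\beta_{m}}$ ($q_i$ distinct primes, $\beta_i\geq1$). For each $n$ let $X_1,\ldots,X_n$ be independent and uniform on $\{1,\ldots,n\}$. Then the laws of $\frac{1}{n^{2}}\sum_{1\leq i,j\leq n}1_{\gcd(X_{i},X_{j})=\ell}$ satisfy a large deviation principle (speed $n$) with rate function \[ I_{\ell}(x)=\inf\left\{H(\mu\,|\,\nu_\ell):\ \mu\text{ a Borel probability measure on }[0,1],\ \iint_{[0,1]^{2}}f_\ell(u,v)\,\mu(du)\,\mu(dv)=x\right\}, \] with $\inf\emptyset=+\infty$.
   Context: Let $p_1<p_2<\cdots$ be the primes distinct from $q_1,\ldots,q_m$, in increasing order. Every $u\in[0,1]$ is written in the mixed-radix expansion $u=\sum_{i=1}^{m}\gamma_i(u)3^{-i}+3^{-m}\sum_{j\ge1}\alpha_j(u)2^{-j}$ with $\gamma_i(u)\in\{0,1,2\}$, $\alpha_j(u)\in\{0,1\}$ (finite expansion chosen when two exist). $\nu_\ell$ is the Borel probability measure on $[0,1]$ under which the digits $\gamma_1,\ldots,\gamma_m,\alpha_1,\alpha_2,\ldots$ are independent, with $\nu_\ell(\gamma_i=0)=1-q_i^{-\beta_i}$, $\nu_\ell(\gamma_i=1)=q_i^{-\beta_i}-q_i^{-\beta_i-1}$, $\nu_\ell(\gamma_i=2)=q_i^{-\beta_i-1}$, and $\nu_\ell(\alpha_j=1)=1/p_j$. (Interpretation: $\gamma_i=0,1,2$ according as an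 integer is not divisible by $q_i^{\beta_i}$, divisible by $q_i^{\beta_i}$ but not $q_i^{\beta_i+1}$, divisible by $q_i^{\beta_i+1}$; $\alpha_j=1$ iff divisible by $p_j$.) $f_\ell(u,v)=1$ if $\gamma_i(u)\neq0$ and $\gamma_i(v)\neq0$ for all $i\le m$, no $i\le m$ has $\gamma_i(u)=\gamma_i(v)=2$, and no $j$ has $\alpha_j(u)=\alpha_j(v)=1$; otherwise $f_\ell(u,v)=0$. $H(\mu|\nu)=\int\log\frac{d\mu}{d\nu}d\mu$ if $\mu\ll\nu$ and $\log\frac{d\mu}{d\nu}\in L^1(\mu)$, else $+\infty$. Large deviation principle: $I\ge0$ lower semicontinuous and for all measurable $A$, $-\inf_{A^o}I\le\liminf\frac1n\log P_n(A)\le\limsup\frac1n\log P_n(A)\le-\inf_{\overline A}I$. *)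

theory Defs
  imports "HOL-Probability.Probability" "HOL-Computational_Algebra.Primes"
begin

definition nq :: "nat \<Rightarrow> nat" where
  "nq l = card (prime_factors l)"

definition qf :: "nat \<Rightarrow> nat \<Rightarrow> nat" where
  "qf l i = sorted_list_of_set (prime_factors l) ! (i - 1)"

definition bexp :: "nat \<Rightarrow> nat \<Rightarrow> nat" where
  "bexp l i = multiplicity (qf l i) l"

definition pf :: "nat \<Rightarrow> nat \<Rightarrow> nat" where
  "pf l j = enumerate {p. prime p \<and> p \<notin> prime_factors l} (j - 1)"

section \<open>Mixed-radix digits (greedy = finite expansion when two exist)\<close>

fun tern_rem :: "real \<Rightarrow> nat \<Rightarrow> real" where
  "tern_rem u 0 = u"
| "tern_rem u (Suc i) = 3 * tern_rem u i - min 2 (of_int \<lfloor>3 * tern_rem u i\<rfloor>)"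

definition gdig :: "real \<Rightarrow> nat \<Rightarrow> nat" where
  "gdig u i = nat (min 2 \<lfloor>3 * tern_rem u (i - 1)\<rfloor>)"

fun bin_rem :: "nat \<Rightarrow> real \<Rightarrow> nat \<Rightarrow> real" where
  "bin_rem m u 0 = tern_rem u m"
| "bin_rem m u (Suc j) = 2 * bin_rem m u j - min 1 (of_int \<lfloor>2 * bin_rem m u j\<rfloor>)"

definition adig :: "nat \<Rightarrow> real \<Rightarrow> nat \<Rightarrow> nat" where
  "adig m u j = nat (min 1 \<lfloor>2 * bin_rem m u (j - 1)\<rfloor>)"

text \<open>Law of the digit with (0-based) position k: positions k < m are gamma_(k+1),
  positions k >= m are alpha_(k-m+1).\<close>
definition digit_pmf :: "nat \<Rightarrow> nat \<Rightarrow> nat pmf" where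
  "digit_pmf l k =
     (if k < nq l then
        (let q = real (qf l (k+1)); b = bexp l (k+1) in
         embed_pmf (\<lambda>d. if d = 0 then 1 - q powi (- int b)
                        else if d = 1 then q powi (- int b) - q powi (- int b - 1)
                        else if d = 2 then q powi (- int b - 1) else 0))
      else map_pmf (\<lambda>x. if x then 1 else 0)
             (bernoulli_pmf (1 / real (pf l (k - nq l + 1)))))"

definition digit_space :: "nat \<Rightarrow> (nat \<Rightarrow> nat) measure" where
  "digit_space l = (\<Pi>\<^sub>M k\<in>UNIV. measure_pmf (digit_pmf l k))"

definition digits_to_real :: "nat \<Rightarrow> (nat \<Rightarrow> nat) \<Rightarrow> real" where
  "digits_to_real m w = (\<Sum>i<m. real (w i) / 3 ^ (i+1))
       + (1 / 3 ^ m) * (\<Sum>j. real (w (m + j)) / 2 ^ (j+1))"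

definition nu :: "nat \<Rightarrow> real measure" where
  "nu l = distr (digit_space l) borel (digits_to_real (nq l))"

definition fker :: "nat \<Rightarrow> real \<Rightarrow> real \<Rightarrow> real" where
  "fker l u v =
     (if (\<forall>i\<in>{1..nq l}. gdig u i \<noteq> 0 \<and> gdig v i \<noteq> 0)
         \<and> \<not> (\<exists>i\<in>{1..nq l}. gdig u i = 2 \<and> gdig v i = 2)
         \<and> \<not> (\<exists>j\<ge>1. adig (nq l) u j = 1 \<and> adig (nq l) v j = 1)
      then 1 else 0)"

definition rel_entropy :: "real measure \<Rightarrow> real measure \<Rightarrow> ereal" where
  "rel_entropy \<mu> \<nu> =
     (if absolutely_continuous \<nu> \<mu> \<and> sets \<mu> = sets \<nu>
         \<and> integrable \<mu> (\<lambda>x. ln (enn2real (RN_deriv \<nu> \<mu> x)))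
      then ereal (\<integral>x. ln (enn2real (RN_deriv \<nu> \<mu> x)) \<partial>\<mu>)
      else \<infinity>)"

definition rate :: "nat \<Rightarrow> real \<Rightarrow> ereal" where
  "rate l x = (INF \<mu> \<in> {\<mu>. prob_space \<mu> \<and> sets \<mu> = sets borel \<and> emeasure \<mu> (- {0..1}) = 0
                          \<and> (\<integral>u. (\<integral>v. fker l u v \<partial>\<mu>) \<partial>\<mu>) = x}.
                 rel_entropy \<mu> (nu l))"

definition gcd_stat_law :: "nat \<Rightarrow> nat \<Rightarrow> real pmf" where
  "gcd_stat_law l n =
     map_pmf (\<lambda>X. (1 / real n ^ 2) *
                  (\<Sum>i<n. \<Sum>j<n. if gcd (X i) (X j) = l then 1 else 0))
             (pmf_of_set (PiE {..<n} (\<lambda>_. {1..n})))"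

definition eln :: "real \<Rightarrow> ereal" where
  "eln p = (if p = 0 then - \<infinity> else ereal (ln p))"

definition lower_semicont :: "(real \<Rightarrow> ereal) \<Rightarrow> bool" where
  "lower_semicont I \<longleftrightarrow> (\<forall>t. closed {x. I x \<le> t})"

definition LDP :: "(nat \<Rightarrow> real measure) \<Rightarrow> (real \<Rightarrow> ereal) \<Rightarrow> bool" where
  "LDP P I \<longleftrightarrow> (\<forall>x. I x \<ge> 0) \<and> lower_semicont I \<and>
     (\<forall>A \<in> sets borel.
        - (INF x \<in> interior A. I x) \<le> liminf (\<lambda>n. eln (measure (P n) A) / ereal (real n))
      \<and> limsup (\<lambda>n. eln (measure (P n) A) / ereal (real n)) \<le> - (INF x \<in> closure A. I x))"

end

(*
  Classify an integer by its residual divisibility by the q_i and by the first few p_j. The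
  classes have densities given by the law of the digits under nu, so Sanov's theorem on the
  finite set of classes (by exponential tilting, with the densities in place of exact
  probabilities) gives large deviations for the statistic in which only finitely many p_j are
  taken into account.

  Truncation is harmless at any prescribed exponential rate: "having a common prime factor p_j
  with j large" is a relation of small density sum 1/p_j^2 on pairs, and few pairs of a sample
  satisfy it. The same sparsity makes the truncated functionals converge to the integral of
  f_l uniformly over measures of bounded entropy, by uniform absolute continuity.

  The rate functions pass to the limit, and I_l is lower semicontinuous, because entropy
  sublevel sets are sequentially compact: weak limits exist by Helly's theorem, bounded entropy
  upgrades weak to setwise convergence, and the Donsker-Varadhan formula bounds the entropy of
  the limit.
*)
theory Submission
  imports Defs "HOL-Real_Asymp.Real_Asymp"
begin

section \<open>Relative entropy\<close>

text \<open>Truncation has to act on pairs, not on points. The sum of 1/p over the primes diverges,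
  so integers drawn from {1..n} typically have prime factors beyond any fixed p_L; discarding such
  points would discard nearly everything. Sharing a prime p, however, is an event of density 1/p^2,
  and these are summable. A few points may still be related to a large share of the others, so both
  the estimate for samples and its counterpart for measures treat points with large and with small
  sections separately.

  The digit law of a uniform point of {1..n} depends on n and only converges, on finitely many
  classes at a time; hence truncation precedes Sanov's theorem, whose proof carries an error e^{n
  \<eta>}. The link between classes and measures is exact: a law on the classes lifts to a density
  constant on each class with the same entropy, and passing from a measure to its class law does not
  increase entropy. The kernel f_l is discontinuous, so weak convergence alone would not suffice;
  setwise convergence handles all measurable sets.\<close>

lemma rel_entropy_densityE:
  fixes \<mu> \<nu> :: "real measure"
  assumes "prob_space \<nu>" "prob_space \<mu>" "rel_entropy \<mu> \<nu> \<le> ereal a"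
  obtains D where "D \<in> borel_measurable \<nu>" "\<And>x. 0 \<le> D x" "\<mu> = density \<nu> (\<lambda>x. ennreal (D x))"
    "AE x in \<mu>. 0 < D x" "integrable \<mu> (\<lambda>x. ln (D x))" "(\<integral>x. ln (D x) \<partial>\<mu>) \<le> a"
    "sets \<mu> = sets \<nu>" "absolutely_continuous \<nu> \<mu>"
proof -
  interpret n: prob_space \<nu> by fact
  interpret m: prob_space \<mu> by fact
  have ac: "absolutely_continuous \<nu> \<mu>" and s: "sets \<mu> = sets \<nu>"
    and i: "integrable \<mu> (\<lambda>x. ln (enn2real (RN_deriv \<nu> \<mu> x)))"
    and e: "(\<integral>x. ln (enn2real (RN_deriv \<nu> \<mu> x)) \<partial>\<mu>) \<le> a"
    using assms(3) unfolding rel_entropy_def by (auto split: if_splits)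
  \<comment> \<open>The finite bound excludes the value \<infinity>, so the derivative exists. Its
    real version \<open>D\<close> is positive \<mu>-almost everywhere, which makes
    \<open>ln (D x)\<close> a genuine logarithm as far as \<mu> is concerned.\<close>
  obtain D where D: "D \<in> borel_measurable \<nu>" "AE x in \<nu>. RN_deriv \<nu> \<mu> x = ennreal (D x)"
    "AE x in \<mu>. 0 < D x" "\<And>x. 0 \<le> D x"
    using n.real_RN_deriv[OF m.finite_measure_axioms ac s] by metis
  have aem: "AE x in \<mu>. RN_deriv \<nu> \<mu> x = ennreal (D x)"
    using absolutely_continuous_AE[OF s ac D(2)] by simp
  then have aeD: "AE x in \<mu>. ln (enn2real (RN_deriv \<nu> \<mu> x)) = ln (D x)"
    by eventually_elim (simp add: D(4))
  have Dm: "D \<in> borel_measurable \<mu>" using D(1) s by (simp cong: measurable_cong_sets)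
  have m1: "(\<lambda>x. ln (enn2real (RN_deriv \<nu> \<mu> x))) \<in> borel_measurable \<mu>"
    using i by (rule borel_measurable_integrable)
  have m2: "(\<lambda>x. ln (D x)) \<in> borel_measurable \<mu>" using Dm by measurable
  have i2: "integrable \<mu> (\<lambda>x. ln (D x))"
    using i integrable_cong_AE[OF m1 m2 aeD] by simp
  have e2: "(\<integral>x. ln (D x) \<partial>\<mu>) \<le> a"
    using e integral_cong_AE[OF m1 m2 aeD] by simp
  have "density \<nu> (RN_deriv \<nu> \<mu>) = density \<nu> (\<lambda>x. ennreal (D x))"
    using D(1,2) by (intro density_cong) auto
  then have d: "\<mu> = density \<nu> (\<lambda>x. ennreal (D x))"
    using n.density_RN_deriv[OF ac s] by metis
  show ?thesis by (rule that[OF D(1) D(4) d D(3) i2 e2 s ac])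
qed

text \<open>The easy half of the Donsker--Varadhan formula, from \<open>e\<^sup>t \<ge> 1 + t\<close> at
  \<open>t = g - ln (d\<mu>/d\<nu>) - ln Z\<close>, \<open>Z\<close> being the integral of \<open>e\<^sup>g\<close>.\<close>

lemma Donsker_Varadhan_le:
  fixes \<mu> \<nu> :: "real measure"
  assumes "prob_space \<nu>" "prob_space \<mu>" "rel_entropy \<mu> \<nu> \<le> ereal a"
    and g: "g \<in> borel_measurable \<nu>" "\<And>x. \<bar>g x\<bar> \<le> C"
  shows "(\<integral>x. g x \<partial>\<mu>) \<le> a + ln (\<integral>x. exp (g x) \<partial>\<nu>)"
proof -
  interpret n: prob_space \<nu> by fact
  interpret m: prob_space \<mu> by fact
  obtain D where D: "D \<in> borel_measurable \<nu>" "\<And>x. 0 \<le> D x" "\<mu> = density \<nu> (\<lambda>x. ennreal (D x))"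
    "AE x in \<mu>. 0 < D x" "integrable \<mu> (\<lambda>x. ln (D x))" "(\<integral>x. ln (D x) \<partial>\<mu>) \<le> a"
    "sets \<mu> = sets \<nu>"
    using rel_entropy_densityE[OF assms(1-3)] by metis
  note [measurable] = D(1) g(1)
  have gm[measurable]: "g \<in> borel_measurable \<mu>" "D \<in> borel_measurable \<mu>"
    using D(1,7) g(1) by (auto cong: measurable_cong_sets)
  define Z where "Z = (\<integral>x. exp (g x) \<partial>\<nu>)"
  have gi: "integrable \<mu> g" by (rule m.integrable_const_bound[where B=C]) (use g in auto)
  have ge: "exp (- C) \<le> exp (g x)" "exp (g x) \<le> exp C" for x using g(2)[of x] by (auto simp: abs_le_iff)
  have ei: "integrable \<nu> (\<lambda>x. exp (g x))" by (rule n.integrable_const_bound[where B="exp C"]) (use ge in auto)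
  have "exp (-C) \<le> Z" unfolding Z_def
    using integral_mono[OF n.integrable_const ei ge(1)] by (simp add: n.prob_space)
  then have Z: "Z > 0" by (meson exp_gt_zero less_le_trans)
  \<comment> \<open>\<open>h\<close> is e^t for the t of the remark above. Its \<mu>-integral is at
    most 1 rather than equal to 1, since \<nu> may charge the set where \<open>D\<close>
    vanishes.\<close>
  define h where "h x = (if D x > 0 then exp (g x) / (D x * Z) else 0)" for x
  have hm[measurable]: "h \<in> borel_measurable \<mu>" "h \<in> borel_measurable \<nu>" unfolding h_def by measurable
  have h0: "h x \<ge> 0" for x using D(2)[of x] Z by (auto simp: h_def)
  have nn: "(\<integral>\<^sup>+x. ennreal (h x) \<partial>\<mu>) \<le> 1"
  proof -
    have "(\<integral>\<^sup>+x. ennreal (h x) \<partial>\<mu>) = (\<integral>\<^sup>+x. ennreal (D x) * ennreal (h x) \<partial>\<nu>)"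
      by (subst D(3), subst nn_integral_density) auto
    also have "\<dots> \<le> (\<integral>\<^sup>+x. ennreal (exp (g x) / Z) \<partial>\<nu>)"
      using Z D(2) by (intro nn_integral_mono) (auto simp: h_def ennreal_mult[symmetric])
    also have "\<dots> = ennreal (\<integral>x. exp (g x) / Z \<partial>\<nu>)" using ei Z by (intro nn_integral_eq_integral) auto
    also have "(\<integral>x. exp (g x) / Z \<partial>\<nu>) = 1" using Z by (simp add: Z_def)
    finally show ?thesis by simp
  qed
  have hi: "integrable \<mu> h" using nn h0 by (intro integrableI_bounded) (auto intro: le_less_trans)
  have "ennreal (\<integral>x. h x \<partial>\<mu>) \<le> 1" using nn_integral_eq_integral[OF hi] h0 nn by simp
  then have h1: "(\<integral>x. h x \<partial>\<mu>) \<le> 1" by (simp add: ennreal_le_1)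
  have "(\<integral>x. 1 + (g x - ln (D x) - ln Z) \<partial>\<mu>) \<le> (\<integral>x. h x \<partial>\<mu>)"
  proof (rule integral_mono_AE)
    show "AE x in \<mu>. 1 + (g x - ln (D x) - ln Z) \<le> h x" using D(4)
    proof eventually_elim
      case (elim x)
      have "h x = exp (g x - ln (D x) - ln Z)" using elim Z by (simp add: h_def exp_diff)
      then show ?case using exp_ge_add_one_self[of "g x - ln (D x) - ln Z"] by simp
    qed
  qed (intro Bochner_Integration.integrable_add Bochner_Integration.integrable_diff gi D(5) m.integrable_const hi)+
  also have "(\<integral>x. 1 + (g x - ln (D x) - ln Z) \<partial>\<mu>) = 1 + ((\<integral>x. g x \<partial>\<mu>) - (\<integral>x. ln (D x) \<partial>\<mu>) - ln Z)"
    using gi D(5) by (simp add: m.prob_space)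
  finally show ?thesis using h1 D(6) Z_def by simp
qed

lemma rel_entropy_nonneg:
  fixes \<mu> \<nu> :: "real measure"
  assumes "prob_space \<nu>" "prob_space \<mu>"
  shows "0 \<le> rel_entropy \<mu> \<nu>"
proof (cases "rel_entropy \<mu> \<nu>")
  case (real r)
  interpret n: prob_space \<nu> by fact
  show ?thesis using Donsker_Varadhan_le[OF assms, of r "\<lambda>_. 0" 0] real by (simp add: n.prob_space)
qed (auto simp: rel_entropy_def split: if_splits)

text \<open>Donsker--Varadhan with the test function c 1_A, whose logarithmic moment ln (1 + (e^c -
  1) \<nu>(A)) is at most e^c \<nu>(A).\<close>

lemma entropy_measure_le:
  fixes \<mu> \<nu> :: "real measure"
  assumes "prob_space \<nu>" "prob_space \<mu>" "rel_entropy \<mu> \<nu> \<le> ereal a" "A \<in> sets \<nu>" "c > 0"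
  shows "measure \<mu> A \<le> (a + exp c * measure \<nu> A) / c"
proof -
  interpret n: prob_space \<nu> by fact
  interpret m: prob_space \<mu> by fact
  have s: "sets \<mu> = sets \<nu>" using rel_entropy_densityE[OF assms(1-3)] by metis
  have [measurable]: "A \<in> sets \<nu>" "A \<in> sets \<mu>" using assms s by auto
  have "(\<integral>x. c * indicator A x \<partial>\<mu>) \<le> a + ln (\<integral>x. exp (c * indicator A x) \<partial>\<nu>)"
    by (rule Donsker_Varadhan_le[OF assms(1-3), where C=c]) (use assms(5) in \<open>auto simp: indicator_def\<close>)
  also have "(\<integral>x. exp (c * indicator A x) \<partial>\<nu>) = (\<integral>x. 1 + (exp c - 1) * indicator A x \<partial>\<nu>)"
    by (intro Bochner_Integration.integral_cong) (auto simp: indicator_def)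
  also have "\<dots> = 1 + (exp c - 1) * measure \<nu> A"
    using n.emeasure_finite[of A]
    by (simp add: n.prob_space less_top[symmetric] del: integral_indicator)
  also have "ln \<dots> \<le> (exp c - 1) * measure \<nu> A" using assms(5) by (intro ln_add_one_self_le_self) auto
  also have "\<dots> \<le> exp c * measure \<nu> A" by (simp add: algebra_simps)
  finally show ?thesis using assms(5) by (simp add: field_simps)
qed

lemma entropy_uniformly_absolutely_continuous:
  fixes \<nu> :: "real measure"
  assumes "prob_space \<nu>" "e > 0"
  obtains d where "d > 0" "\<And>\<mu> A. prob_space \<mu> \<Longrightarrow> rel_entropy \<mu> \<nu> \<le> ereal a \<Longrightarrow> A \<in> sets \<nu> \<Longrightarrow>
     measure \<nu> A \<le> d \<Longrightarrow> measure \<mu> A \<le> e"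
proof -
  \<comment> \<open>With this c the quotient (\<bar>a\<bar> + 1) / c is e / 2, and d = e^{-c} makes
    e^c d equal to the 1 in the numerator.\<close>
  define c where "c = 2 * (\<bar>a\<bar> + 1) / e"
  define d where "d = exp (- c)"
  have c: "c > 0" using assms(2) by (simp add: c_def)
  show ?thesis
  proof (rule that[of d])
    fix \<mu> A assume *: "prob_space \<mu>" "rel_entropy \<mu> \<nu> \<le> ereal a" "A \<in> sets \<nu>" "measure \<nu> A \<le> d"
    have "measure \<mu> A \<le> (a + exp c * measure \<nu> A) / c"
      using entropy_measure_le[OF assms(1) *(1,2,3) c] .
    also have "\<dots> \<le> (\<bar>a\<bar> + exp c * d) / c"
      using *(4) c by (intro divide_right_mono add_mono mult_left_mono) auto
    also have "\<dots> = e / 2" using assms(2) by (simp add: d_def exp_minus c_def field_simps)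
    finally show "measure \<mu> A \<le> e" using assms(2) by simp
  qed (simp add: d_def)
qed

section \<open>Densities constant on finitely many cells\<close>

lemma finite_range_integral:
  fixes f :: "'s \<Rightarrow> real"
  assumes "finite_measure M" "finite S" "\<And>s. s \<in> S \<Longrightarrow> {x \<in> space M. c x = s} \<in> sets M" "\<And>x. c x \<in> S"
  shows "integrable M (\<lambda>x. f (c x))"
    "(\<integral>x. f (c x) \<partial>M) = (\<Sum>s\<in>S. f s * measure M {x \<in> space M. c x = s})"
proof -
  interpret finite_measure M by fact
  define B where "B s = {x \<in> space M. c x = s}" for s
  have Bm: "B s \<in> sets M" if "s \<in> S" for s using assms that by (simp add: B_def)
  have bi: "integrable M (indicator (B s) :: _ \<Rightarrow> real)" if "s \<in> S" for s
    by (rule integrable_real_indicator[OF Bm[OF that]]) (simp add: emeasure_eq_measure)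
  have exp: "f (c x) = (\<Sum>s\<in>S. f s * indicator (B s) x)" if "x \<in> space M" for x
  proof -
    have "(\<Sum>s\<in>S. f s * indicator (B s) x) = (\<Sum>s\<in>S. if s = c x then f s else 0)"
      using that by (intro sum.cong) (auto simp: B_def indicator_def)
    then show ?thesis using assms(2,4) by simp
  qed
  show "integrable M (\<lambda>x. f (c x))"
    by (subst Bochner_Integration.integrable_cong[OF refl exp])
      (auto intro!: Bochner_Integration.integrable_sum integrable_mult_right bi)
  have "(\<integral>x. f (c x) \<partial>M) = (\<integral>x. (\<Sum>s\<in>S. f s * indicator (B s) x) \<partial>M)"
    by (intro Bochner_Integration.integral_cong[OF refl exp])
  also have "\<dots> = (\<Sum>s\<in>S. f s * measure M (B s))"
    using sets.sets_into_space[OF Bm]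
    by (subst Bochner_Integration.integral_sum)
      (auto intro!: sum.cong integrable_mult_right bi simp: Int_absorb2)
  finally show "(\<integral>x. f (c x) \<partial>M) = (\<Sum>s\<in>S. f s * measure M {x \<in> space M. c x = s})"
    by (simp add: B_def)
qed

text \<open>Serves to lift a law on finitely many cells to a measure on the line without changing
  its entropy: the density is a function of the cell, so the entropy integral collapses to a finite
  sum.\<close>

lemma rel_entropy_density_finite_range:
  fixes \<nu> :: "real measure" and c :: "real \<Rightarrow> 's" and \<phi> :: "'s \<Rightarrow> real"
  assumes "prob_space \<nu>" "finite S" "\<And>s. s \<in> S \<Longrightarrow> {x \<in> space \<nu>. c x = s} \<in> sets \<nu>"
    "\<And>x. c x \<in> S" "\<And>s. s \<in> S \<Longrightarrow> 0 \<le> \<phi> s" "(\<Sum>s\<in>S. \<phi> s * measure \<nu> {x \<in> space \<nu>. c x = s}) = 1"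
  defines "\<mu> \<equiv> density \<nu> (\<lambda>x. ennreal (\<phi> (c x)))"
  shows "prob_space \<mu>"
    "\<And>s. s \<in> S \<Longrightarrow> measure \<mu> {x \<in> space \<nu>. c x = s} = \<phi> s * measure \<nu> {x \<in> space \<nu>. c x = s}"
    "rel_entropy \<mu> \<nu> = ereal (\<Sum>s\<in>S. \<phi> s * measure \<nu> {x \<in> space \<nu>. c x = s} * ln (\<phi> s))"
proof -
  interpret n: prob_space \<nu> by fact
  define B where "B s = {x \<in> space \<nu>. c x = s}" for s
  have Bm[measurable]: "s \<in> S \<Longrightarrow> B s \<in> sets \<nu>" for s using assms by (simp add: B_def)
  have int: "integrable \<nu> (\<lambda>x. f (c x))" "(\<integral>x. f (c x) \<partial>\<nu>) = (\<Sum>s\<in>S. f s * measure \<nu> (B s))"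
    for f :: "'s \<Rightarrow> real"
    using finite_range_integral[OF n.finite_measure_axioms assms(2-4), of f] by (simp_all add: B_def)
  have fm[measurable]: "(\<lambda>x. f (c x)) \<in> borel_measurable \<nu>" for f :: "'s \<Rightarrow> real"
    using int(1) by (rule borel_measurable_integrable)
  have p0: "0 \<le> \<phi> (c x)" for x using assms(4,5) by auto
  have em: "emeasure \<mu> A = ennreal (\<integral>x. \<phi> (c x) * indicator A x \<partial>\<nu>)" if [measurable]: "A \<in> sets \<nu>" for A
  proof -
    have "emeasure \<mu> A = (\<integral>\<^sup>+x. ennreal (\<phi> (c x) * indicator A x) \<partial>\<nu>)"
      unfolding \<mu>_def by (subst emeasure_density) (auto intro!: nn_integral_cong simp: indicator_def)
    also have "\<dots> = ennreal (\<integral>x. \<phi> (c x) * indicator A x \<partial>\<nu>)"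
      using p0 by (intro nn_integral_eq_integral integrable_real_mult_indicator int) (auto)
    finally show ?thesis .
  qed
  show "prob_space \<mu>"
  proof
    have "emeasure \<mu> (space \<nu>) = ennreal (\<integral>x. \<phi> (c x) \<partial>\<nu>)"
      by (subst em) (auto intro!: arg_cong[where f=ennreal] Bochner_Integration.integral_cong)
    also have "\<dots> = 1" using assms(6) by (simp add: int B_def)
    finally show "emeasure \<mu> (space \<mu>) = 1" by (simp add: \<mu>_def)
  qed
  then interpret m: prob_space \<mu> .
  show ms: "measure \<mu> {x \<in> space \<nu>. c x = s} = \<phi> s * measure \<nu> {x \<in> space \<nu>. c x = s}" if "s \<in> S" for s
  proof -
    have [measurable]: "B s \<in> sets \<nu>" using Bm that .
    have "emeasure \<mu> (B s) = ennreal (\<integral>x. \<phi> (c x) * indicator (B s) x \<partial>\<nu>)"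
      by (rule em) measurable
    also have "(\<integral>x. \<phi> (c x) * indicator (B s) x \<partial>\<nu>) = (\<integral>x. \<phi> s * indicator (B s) x \<partial>\<nu>)"
      by (rule Bochner_Integration.integral_cong) (auto simp: B_def indicator_def)
    also have "\<dots> = \<phi> s * measure \<nu> (B s)"
      using sets.sets_into_space[of "B s" \<nu>] by (simp add: Int_absorb2 n.emeasure_eq_measure)
    finally show ?thesis using assms(5)[OF that] by (simp add: measure_def B_def)
  qed
  have "(\<lambda>x. ennreal (\<phi> (c x))) \<in> borel_measurable \<nu>" by measurable
  from n.RN_deriv_unique[OF this, of \<mu>] have ae: "AE x in \<nu>. RN_deriv \<nu> \<mu> x = ennreal (\<phi> (c x))"
    unfolding \<mu>_def by auto
  have ac: "absolutely_continuous \<nu> \<mu>" unfolding \<mu>_def by (intro absolutely_continuousI_density) measurable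
  have s: "sets \<mu> = sets \<nu>" by (simp add: \<mu>_def)
  have aem: "AE x in \<mu>. ln (enn2real (RN_deriv \<nu> \<mu> x)) = ln (\<phi> (c x))"
    using absolutely_continuous_AE[OF s ac ae] by eventually_elim (simp add: p0)
  have m1: "(\<lambda>x. ln (enn2real (RN_deriv \<nu> \<mu> x))) \<in> borel_measurable \<mu>"
    using s by (simp cong: measurable_cong_sets)
  have m2: "(\<lambda>x. ln (\<phi> (c x))) \<in> borel_measurable \<mu>"
    using fm[of "\<lambda>s. ln (\<phi> s)"] s by (simp cong: measurable_cong_sets)
  have i: "integrable \<mu> (\<lambda>x. ln (\<phi> (c x)))"
    unfolding \<mu>_def using int[of "\<lambda>s. \<phi> s * ln (\<phi> s)"] fm[of "\<lambda>s. ln (\<phi> s)"] p0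
    by (subst integrable_real_density) (auto)
  have v: "(\<integral>x. ln (\<phi> (c x)) \<partial>\<mu>) = (\<Sum>s\<in>S. \<phi> s * measure \<nu> (B s) * ln (\<phi> s))"
    unfolding \<mu>_def using int[of "\<lambda>s. \<phi> s * ln (\<phi> s)"] fm[of "\<lambda>s. ln (\<phi> s)"] p0
    by (subst integral_real_density) (auto simp: mult_ac)
  show "rel_entropy \<mu> \<nu> = ereal (\<Sum>s\<in>S. \<phi> s * measure \<nu> {x \<in> space \<nu>. c x = s} * ln (\<phi> s))"
    unfolding rel_entropy_def using ac s
      integral_cong_AE[OF m1 m2 aem] integrable_cong_AE[OF m1 m2 aem] i v
    by (simp add: B_def)
qed

text \<open>The hard half of Donsker--Varadhan. The extremal test function ln (d\<mu>/d\<nu>) is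
  unbounded, so it is cut off at \<plusminus>n; Fatou gives its integrability and dominated
  convergence its integral. Since the hypothesis is stable under setwise limits of \<mu>, this
  yields the lower semicontinuity of entropy.\<close>

lemma rel_entropy_leI:
  fixes \<mu> \<nu> :: "real measure"
  assumes "prob_space \<nu>" "prob_space \<mu>" and s: "sets \<mu> = sets \<nu>"
    and DV: "\<And>g C. g \<in> borel_measurable \<nu> \<Longrightarrow> (\<And>x. \<bar>g x\<bar> \<le> C) \<Longrightarrow>
      (\<integral>x. g x \<partial>\<mu>) \<le> a + ln (\<integral>x. exp (g x) \<partial>\<nu>)"
  shows "rel_entropy \<mu> \<nu> \<le> ereal a"
proof -
  interpret n: prob_space \<nu> by fact
  interpret m: prob_space \<mu> by fact
  have sp: "space \<mu> = space \<nu>" using s by (rule sets_eq_imp_space_eq)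
  have ac: "absolutely_continuous \<nu> \<mu>"
    unfolding absolutely_continuous_def
  proof
    fix N assume "N \<in> null_sets \<nu>"
    then have [measurable]: "N \<in> sets \<nu>" "N \<in> sets \<mu>" and N0: "emeasure \<nu> N = 0" using s by auto
    \<comment> \<open>On a \<nu>-null set the exponential integral stays equal to 1 however large c
      is, so a bounds every multiple of the \<mu>-mass of \<open>N\<close>.\<close>
    have "measure \<mu> N * c \<le> a" if "c > 0" for c
    proof -
      have "(\<integral>x. c * indicator N x \<partial>\<mu>) \<le> a + ln (\<integral>x. exp (c * indicator N x) \<partial>\<nu>)"
        by (rule DV[of _ c]) (use that in \<open>auto simp: indicator_def\<close>)
      also have "(\<integral>x. exp (c * indicator N x) \<partial>\<nu>) = (\<integral>x. 1 \<partial>\<nu>)"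
        using \<open>N \<in> null_sets \<nu>\<close>
        by (intro integral_cong_AE) (auto intro!: eventually_mono[OF AE_not_in])
      also have "(\<integral>x. c * indicator N x \<partial>\<mu>) = c * measure \<mu> N"
        using sets.sets_into_space[of N \<mu>] by (simp add: Int_absorb2 m.emeasure_eq_measure)
      finally show ?thesis by (simp add: n.prob_space mult.commute)
    qed
    note le = this
    have "measure \<mu> N = 0"
    proof (rule ccontr)
      assume "measure \<mu> N \<noteq> 0"
      then have "measure \<mu> N > 0" by (simp add: zero_less_measure_iff)
      then show False using le[of "(\<bar>a\<bar> + 1) / measure \<mu> N"] by (simp add: abs_if split: if_splits)
    qed
    then show "N \<in> null_sets \<mu>" by (intro null_setsI) (auto simp: m.emeasure_eq_measure)
  qed
  obtain D where D: "D \<in> borel_measurable \<nu>" "AE x in \<nu>. RN_deriv \<nu> \<mu> x = ennreal (D x)"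
    "AE x in \<mu>. 0 < D x" "\<And>x. 0 \<le> D x"
    using n.real_RN_deriv[OF m.finite_measure_axioms ac s] by metis
  note [measurable] = D(1)
  have Dm[measurable]: "D \<in> borel_measurable \<mu>" using D(1) s by (simp cong: measurable_cong_sets)
  have "density \<nu> (RN_deriv \<nu> \<mu>) = density \<nu> (\<lambda>x. ennreal (D x))"
    using D(1,2) by (intro density_cong) auto
  then have d: "\<mu> = density \<nu> (\<lambda>x. ennreal (D x))"
    using n.density_RN_deriv[OF ac s] by metis
  have Dtot: "integrable \<nu> D" "(\<integral>x. D x \<partial>\<nu>) = 1"
  proof -
    have "(\<integral>\<^sup>+x. ennreal (D x) \<partial>\<nu>) = emeasure \<mu> (space \<mu>)"
      unfolding sp by (subst d, subst emeasure_density) (auto intro!: nn_integral_cong simp: indicator_def)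
    then have e: "(\<integral>\<^sup>+x. ennreal (D x) \<partial>\<nu>) = 1" using m.emeasure_space_1 by simp
    show "integrable \<nu> D" using e D(4) by (intro integrableI_bounded) auto
    then show "(\<integral>x. D x \<partial>\<nu>) = 1"
      using nn_integral_eq_integral[of \<nu> D] D(4) e by (auto simp: ennreal_eq_1)
  qed
  \<comment> \<open>ln D cut off to [-n, n]. Cutting inside the logarithm gives the value -n where D
    = 0 and the clean bound e^{g_n} \<le> D + e^{-n}.\<close>
  define g where "g n x = ln (max (exp (- real n)) (min (exp (real n)) (D x)))" for n :: nat and x
  have gm[measurable]: "g n \<in> borel_measurable \<nu>" "g n \<in> borel_measurable \<mu>" for n
    unfolding g_def by measurable
  have arg: "exp (- real n) \<le> max (exp (- real n)) (min (exp (real n)) (D x))"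
    "max (exp (- real n)) (min (exp (real n)) (D x)) \<le> exp (real n)" for n x by auto
  have gb: "\<bar>g n x\<bar> \<le> real n" for n x
  proof -
    have p: "0 < max (exp (- real n)) (min (exp (real n)) (D x))" by (simp add: less_max_iff_disj)
    have "ln (exp (- real n)) \<le> g n x" unfolding g_def using arg(1) p by (subst ln_le_cancel_iff) auto
    moreover have "g n x \<le> ln (exp (real n))" unfolding g_def using arg(2) p by (subst ln_le_cancel_iff) auto
    ultimately show ?thesis by (simp add: abs_le_iff)
  qed
  have ge: "exp (g n x) \<le> D x + exp (- real n)" for n x
  proof -
    have "exp (g n x) = max (exp (- real n)) (min (exp (real n)) (D x))"
      unfolding g_def by (rule exp_ln) (simp add: less_max_iff_disj)
    also have "\<dots> \<le> D x + exp (- real n)" using D(4)[of x] min.cobounded2[of "exp (real n)" "D x"] exp_ge_zero[of "- real n"] by linarith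
    finally show ?thesis .
  qed
  have gi: "integrable \<mu> (g n)" for n by (rule m.integrable_const_bound[where B="real n"]) (use gb in auto)
  have eg: "exp (g n x) \<le> exp (real n)" for n x using gb[of n x] by auto
  have ei: "integrable \<nu> (\<lambda>x. exp (g n x))" for n
    by (rule n.integrable_const_bound[where B="exp (real n)"]) (use eg in auto)
  have up: "(\<integral>x. g n x \<partial>\<mu>) \<le> a + exp (- real n)" for n
  proof -
    have "(\<integral>x. exp (g n x) \<partial>\<nu>) \<le> (\<integral>x. D x + exp (- real n) \<partial>\<nu>)"
      by (rule integral_mono) (use ei Dtot ge in auto)
    also have "\<dots> = 1 + exp (- real n)" using Dtot by (simp add: n.prob_space)
    finally have le: "(\<integral>x. exp (g n x) \<partial>\<nu>) \<le> 1 + exp (- real n)" .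
    have "exp (- real n) \<le> exp (g n x)" for x using gb[of n x] by auto
    then have "exp (- real n) \<le> (\<integral>x. exp (g n x) \<partial>\<nu>)"
      using integral_mono[OF n.integrable_const ei, of "exp (- real n)" n] by (simp add: n.prob_space)
    then have pos: "0 < (\<integral>x. exp (g n x) \<partial>\<nu>)" by (meson exp_gt_zero less_le_trans)
    have "ln (\<integral>x. exp (g n x) \<partial>\<nu>) \<le> ln (1 + exp (- real n))" using le pos by simp
    also have "\<dots> \<le> exp (- real n)" by (rule ln_add_one_self_le_self) simp
    finally show ?thesis using DV[OF gm(1) gb] by (meson add_left_mono order_trans)
  qed
  \<comment> \<open>The hypothesis bounds the integral of g_n only from above. The negative part is
    controlled separately, by rewriting its \<mu>-integral as a \<nu>-integral and using D ln (1/D)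
    \<le> 1 - D for D < 1.\<close>
  have neg: "(\<integral>x. max 0 (- g n x) \<partial>\<mu>) \<le> 1" for n
  proof -
    have "(\<integral>x. max 0 (- g n x) \<partial>\<mu>) = (\<integral>x. D x * max 0 (- g n x) \<partial>\<nu>)"
      by (subst d, subst integral_real_density) (use D in auto)
    also have "\<dots> \<le> (\<integral>x. 1 \<partial>\<nu>)"
    proof (rule integral_mono)
      have b: "D x * max 0 (- g n x) \<le> 1" for x
      proof (cases "D x \<ge> 1 \<or> D x = 0")
        case True
        have "g n x \<ge> 0" if "D x \<ge> 1"
          unfolding g_def using that by (intro ln_ge_zero) (auto simp: le_max_iff_disj)
        then show ?thesis using True by auto
      next
        case False
        then have Dx: "0 < D x" "D x < 1" using D(4)[of x] by auto
        have "min (exp (real n)) (D x) = D x" using Dx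
          by (metis exp_ge_zero min.absorb2 less_le one_le_exp_iff of_nat_0_le_iff order_trans)
        then have "ln (D x) \<le> g n x" unfolding g_def using Dx by (subst ln_le_cancel_iff) (auto simp: less_max_iff_disj)
        then have "max 0 (- g n x) \<le> - ln (D x)" using Dx by simp
        also have "- ln (D x) = ln (1 / D x)" using Dx by (simp add: ln_div)
        also have "\<dots> \<le> 1 / D x - 1" using Dx by (intro ln_le_minus_one) auto
        finally have "D x * max 0 (- g n x) \<le> D x * (1 / D x - 1)" using Dx by (intro mult_left_mono) auto
        also have "\<dots> \<le> 1" using Dx by (simp add: field_simps)
        finally show ?thesis .
      qed
      show "D x * max 0 (- g n x) \<le> 1" for x by (rule b)
      have "0 \<le> D x * max 0 (- g n x)" for x using D(4)[of x] by simp
      then have "\<bar>D x * max 0 (- g n x)\<bar> \<le> 1" for x using b[of x] by (simp add: abs_le_iff)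
      then show "integrable \<nu> (\<lambda>x. D x * max 0 (- g n x))"
        by (intro n.integrable_const_bound[where B=1]) auto
    qed auto
    finally show ?thesis by (simp add: n.prob_space)
  qed
  have absb: "(\<integral>x. \<bar>g n x\<bar> \<partial>\<mu>) \<le> \<bar>a\<bar> + 3" for n
  proof -
    have i2: "integrable \<mu> (\<lambda>x. max 0 (- g n x))" using gi[of n] by auto
    have "(\<integral>x. \<bar>g n x\<bar> \<partial>\<mu>) = (\<integral>x. g n x + 2 * max 0 (- g n x) \<partial>\<mu>)"
      by (rule Bochner_Integration.integral_cong) auto
    also have "\<dots> = (\<integral>x. g n x \<partial>\<mu>) + 2 * (\<integral>x. max 0 (- g n x) \<partial>\<mu>)"
      using gi[of n] i2 by simp
    also have "\<dots> \<le> (a + 1) + 2 * 1"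
      using up[of n] neg[of n] by (intro add_mono mult_left_mono) (auto intro: order_trans)
    finally show ?thesis by simp
  qed
  have lim: "AE x in \<mu>. (\<lambda>n. g n x) \<longlonglongrightarrow> ln (D x)" using D(3)
  proof eventually_elim
    case (elim x)
    obtain N :: nat where N: "\<bar>ln (D x)\<bar> \<le> real N" using real_arch_simple by blast
    have "g n x = ln (D x)" if "n \<ge> N" for n
    proof -
      have "- real n \<le> ln (D x)" "ln (D x) \<le> real n" using N that by auto
      then have "exp (- real n) \<le> D x" "D x \<le> exp (real n)"
        using elim by (metis exp_le_cancel_iff exp_ln)+
      then show ?thesis by (simp add: g_def)
    qed
    then show ?case by (intro tendsto_eventually) (auto simp: eventually_sequentially)
  qed
  have gabs: "AE x in \<mu>. \<bar>g n x\<bar> \<le> \<bar>ln (D x)\<bar>" for n using D(3)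
  proof eventually_elim
    case (elim x)
    have ln1: "exp t \<le> D x \<longleftrightarrow> t \<le> ln (D x)" "D x \<le> exp t \<longleftrightarrow> ln (D x) \<le> t" for t
      using elim by (metis exp_le_cancel_iff exp_ln)+
    have "g n x = max (- real n) (min (real n) (ln (D x)))"
      using elim by (auto simp: g_def max_def min_def ln1)
    then show ?case by auto
  qed
  \<comment> \<open>Integrability comes first, by Fatou: without it \<open>rel_entropy\<close> would
    be infinite, and \<bar>ln D\<bar> is the dominating function for the limit of the integrals
    below.\<close>
  have nn: "(\<integral>\<^sup>+x. ennreal \<bar>ln (D x)\<bar> \<partial>\<mu>) \<le> ennreal (\<bar>a\<bar> + 3)"
  proof -
    have "(\<integral>\<^sup>+x. ennreal \<bar>ln (D x)\<bar> \<partial>\<mu>) = (\<integral>\<^sup>+x. liminf (\<lambda>n. ennreal \<bar>g n x\<bar>) \<partial>\<mu>)"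
    proof (rule nn_integral_cong_AE, use lim in eventually_elim)
      case (elim x)
      have "(\<lambda>n. ennreal \<bar>g n x\<bar>) \<longlonglongrightarrow> ennreal \<bar>ln (D x)\<bar>"
        using elim by (intro tendsto_ennrealI tendsto_rabs)
      then show ?case by (rule lim_imp_Liminf[OF sequentially_bot, symmetric])
    qed
    also have "\<dots> \<le> liminf (\<lambda>n. \<integral>\<^sup>+x. ennreal \<bar>g n x\<bar> \<partial>\<mu>)" by (rule nn_integral_liminf) measurable
    also have "\<dots> = liminf (\<lambda>n. ennreal (\<integral>x. \<bar>g n x\<bar> \<partial>\<mu>))"
      using gi by (subst nn_integral_eq_integral) auto
    also have "\<dots> \<le> ennreal (\<bar>a\<bar> + 3)"
      by (intro Liminf_le always_eventually allI ennreal_leI absb) simp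
    finally show ?thesis .
  qed
  have li: "integrable \<mu> (\<lambda>x. ln (D x))"
    using order.strict_trans1[OF nn ennreal_less_top] by (intro integrableI_bounded) auto
  have "(\<lambda>n. \<integral>x. g n x \<partial>\<mu>) \<longlonglongrightarrow> (\<integral>x. ln (D x) \<partial>\<mu>)"
    by (rule integral_dominated_convergence[where w="\<lambda>x. \<bar>ln (D x)\<bar>"]) (use li lim gabs in auto)
  moreover have "(\<lambda>n. a + exp (- real n)) \<longlonglongrightarrow> a + 0"
    by (intro tendsto_intros filterlim_compose[OF exp_at_bot] filterlim_compose[OF filterlim_uminus_at_bot_at_top] filterlim_real_sequentially)
  ultimately have le: "(\<integral>x. ln (D x) \<partial>\<mu>) \<le> a"
    using up by (metis (no_types, lifting) LIMSEQ_le add_0_right)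
  have aeD: "AE x in \<mu>. ln (enn2real (RN_deriv \<nu> \<mu> x)) = ln (D x)"
    using absolutely_continuous_AE[OF s ac D(2)] by eventually_elim (simp add: D(4))
  have m1: "(\<lambda>x. ln (enn2real (RN_deriv \<nu> \<mu> x))) \<in> borel_measurable \<mu>"
    using s by (simp cong: measurable_cong_sets)
  have m2: "(\<lambda>x. ln (D x)) \<in> borel_measurable \<mu>" by measurable
  show ?thesis
    unfolding rel_entropy_def using ac s li le integral_cong_AE[OF m1 m2 aeD] integrable_cong_AE[OF m1 m2 aeD]
    by simp
qed

section \<open>Compactness of entropy sublevel sets\<close>

text \<open>Rounding g down to multiples of 1/N = e/4 leaves finitely many level sets, because g is
  bounded, and costs at most e/4 under every probability measure at once.\<close>

lemma setwise_convergence_integral: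
  fixes \<mu> :: "nat \<Rightarrow> real measure"
  fixes C :: real
  assumes "\<And>k. prob_space (\<mu> k)" "prob_space M" "\<And>k. sets (\<mu> k) = sets M"
    and conv: "\<And>A. A \<in> sets M \<Longrightarrow> (\<lambda>k. measure (\<mu> k) A) \<longlonglongrightarrow> measure M A"
    and g: "g \<in> borel_measurable M" "\<And>x. \<bar>g x\<bar> \<le> C"
  shows "(\<lambda>k. \<integral>x. g x \<partial>(\<mu> k)) \<longlonglongrightarrow> (\<integral>x. g x \<partial>M)"
proof (rule LIMSEQ_I)
  fix e :: real assume e: "e > 0"
  define N :: real where "N = 4 / e"
  have N: "N > 0" using e by (simp add: N_def)
  define J where "J = {\<lfloor>- N * C\<rfloor> .. \<lfloor>N * C\<rfloor>}"
  define h where "h x = of_int \<lfloor>N * g x\<rfloor> / N" for x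
  define B where "B j = {x \<in> space M. \<lfloor>N * g x\<rfloor> = j}" for j
  have Bm: "B j \<in> sets M" for j unfolding B_def using g(1) by measurable
  have inJ: "\<lfloor>N * g x\<rfloor> \<in> J" for x
  proof -
    have "- C \<le> g x" "g x \<le> C" using g(2)[of x] by (auto simp: abs_le_iff)
    then have "N * (- C) \<le> N * g x" "N * g x \<le> N * C" using N by (simp_all only: mult_le_cancel_left_pos)
    then show ?thesis by (auto simp: J_def intro!: floor_mono)
  qed
  have hB: "h x = (\<Sum>j\<in>J. of_int j / N * indicator (B j) x)" if "x \<in> space M" for x
  proof -
    have "(\<Sum>j\<in>J. of_int j / N * indicator (B j) x) = (\<Sum>j\<in>J. if j = \<lfloor>N * g x\<rfloor> then of_int j / N else 0)"
      using that by (intro sum.cong) (auto simp: B_def indicator_def)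
    then show ?thesis using inJ[of x] by (simp add: J_def h_def)
  qed
  have gh: "\<bar>g x - h x\<bar> \<le> e / 4" for x
  proof -
    have "\<bar>N * g x - of_int \<lfloor>N * g x\<rfloor>\<bar> \<le> 1" by linarith
    then have "\<bar>N * g x - of_int \<lfloor>N * g x\<rfloor>\<bar> / N \<le> 1 / N" using N by (intro divide_right_mono) auto
    moreover have "\<bar>N * g x - of_int \<lfloor>N * g x\<rfloor>\<bar> / N = \<bar>g x - h x\<bar>"
      using N by (simp add: h_def abs_if field_simps)
    ultimately show ?thesis by (simp add: N_def)
  qed
  have ih: "(\<integral>x. h x \<partial>P) = (\<Sum>j\<in>J. of_int j / N * measure P (B j))"
    and gP: "\<bar>(\<integral>x. g x \<partial>P) - (\<integral>x. h x \<partial>P)\<bar> \<le> e / 4"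
    if P: "prob_space P" "sets P = sets M" for P
  proof -
    interpret p: prob_space P by fact
    have sp: "space P = space M" using P(2) by (rule sets_eq_imp_space_eq)
    have Bm': "B j \<in> sets P" for j using Bm P(2) by simp
    have ii: "integrable P (\<lambda>x. of_int j / N * indicator (B j) x)" for j
      using Bm'[of j] by (intro integrable_mult_right) (auto simp: p.emeasure_eq_measure)
    have "(\<integral>x. h x \<partial>P) = (\<integral>x. (\<Sum>j\<in>J. of_int j / N * indicator (B j) x) \<partial>P)"
      by (intro Bochner_Integration.integral_cong refl hB) (simp add: sp)
    also have "\<dots> = (\<Sum>j\<in>J. of_int j / N * measure P (B j))"
      using ii Bm' sets.sets_into_space[OF Bm']
      by (subst Bochner_Integration.integral_sum) (auto intro!: sum.cong simp: Int_absorb2)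
    finally show "(\<integral>x. h x \<partial>P) = (\<Sum>j\<in>J. of_int j / N * measure P (B j))" .
    have hi: "integrable P h"
      by (subst Bochner_Integration.integrable_cong[OF refl hB]) (use ii sp in auto)
    have gi: "integrable P g"
      using g P(2) by (intro p.integrable_const_bound[where B=C]) (auto cong: measurable_cong_sets)
    have "\<bar>(\<integral>x. g x \<partial>P) - (\<integral>x. h x \<partial>P)\<bar> = \<bar>\<integral>x. g x - h x \<partial>P\<bar>" using hi gi by simp
    also have "\<dots> \<le> (\<integral>x. \<bar>g x - h x\<bar> \<partial>P)" by (rule integral_abs_bound)
    also have "\<dots> \<le> (\<integral>x. e / 4 \<partial>P)" by (rule integral_mono) (use hi gi gh in auto)
    finally show "\<bar>(\<integral>x. g x \<partial>P) - (\<integral>x. h x \<partial>P)\<bar> \<le> e / 4" by (simp add: p.prob_space)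
  qed
  have "(\<lambda>k. \<integral>x. h x \<partial>(\<mu> k)) \<longlonglongrightarrow> (\<integral>x. h x \<partial>M)"
    unfolding ih[OF assms(1) assms(3)] ih[OF assms(2) refl] by (intro tendsto_intros conv Bm)
  from LIMSEQ_D[OF this, of "e/4"] e obtain K where
    K: "\<And>k. k \<ge> K \<Longrightarrow> \<bar>(\<integral>x. h x \<partial>(\<mu> k)) - (\<integral>x. h x \<partial>M)\<bar> < e / 4" by auto
  have "\<bar>(\<integral>x. g x \<partial>(\<mu> k)) - (\<integral>x. g x \<partial>M)\<bar> < e" if "k \<ge> K" for k
    using K[OF that] gP[OF assms(1,3), of k] gP[OF assms(2) refl] e by linarith
  then show "\<exists>no. \<forall>n\<ge>no. norm ((\<integral>x. g x \<partial>(\<mu> n)) - (\<integral>x. g x \<partial>M)) < e" by auto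
qed

text \<open>Regularity of \<nu> puts A between a compact K and an open U with \<nu>(U - K) small.
  Bounded entropy makes all \<mu>_k(U - K) small together, so the indicator of A can be replaced by
  a continuous Urysohn function, for which weak convergence applies.\<close>

lemma entropy_weak_limit_setwise:
  fixes \<mu> :: "nat \<Rightarrow> real measure" and \<nu> M :: "real measure"
  assumes "prob_space \<nu>" "sets \<nu> = sets borel"
    and mu: "\<And>k. prob_space (\<mu> k)" "\<And>k. sets (\<mu> k) = sets borel"
    and ent: "\<And>k. rel_entropy (\<mu> k) \<nu> \<le> ereal a"
    and M: "real_distribution M" "weak_conv_m \<mu> M"
    and A: "A \<in> sets borel"
  shows "(\<lambda>k. measure (\<mu> k) A) \<longlonglongrightarrow> measure M A"
proof (rule LIMSEQ_I)
  interpret n: prob_space \<nu> by fact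
  interpret M: real_distribution M by fact
  have rd: "real_distribution (\<mu> k)" for k
    using mu by (simp add: real_distribution_def real_distribution_axioms_def)
  have wc: "(\<lambda>k. \<integral>x. f x \<partial>(\<mu> k)) \<longlonglongrightarrow> (\<integral>x. f x \<partial>M)"
    if "continuous_on UNIV f" "\<And>x. f x \<in> closed_segment 0 (1::real)" for f :: "real \<Rightarrow> real"
  proof (rule weak_conv_imp_integral_bdd_continuous_conv[OF rd M(1,2)])
    show "isCont f x" for x using that(1) by (simp add: continuous_on_eq_continuous_at)
    show "norm (f x) \<le> 1" for x using that(2)[of x] by (auto simp: closed_segment_eq_real_ivl)
  qed
  have intf: "integrable P f" if "continuous_on UNIV f" "\<And>x. f x \<in> closed_segment 0 (1::real)"
    "prob_space P" "sets P = sets borel" for f :: "real \<Rightarrow> real" and P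
  proof -
    interpret p: prob_space P by fact
    show ?thesis
      using that(2) borel_measurable_continuous_onI[OF that(1)] that(4)
      by (intro p.integrable_const_bound[where B=1]) (auto simp: closed_segment_eq_real_ivl cong: measurable_cong_sets)
  qed
  have int1: "integrable P (indicator B :: real \<Rightarrow> real)" "(\<integral>x. indicator B x \<partial>P) = measure P B"
    if "B \<in> sets borel" "prob_space P" "sets P = sets borel" for B and P :: "real measure"
  proof -
    interpret p: prob_space P by fact
    have "space P = UNIV" using sets_eq_imp_space_eq[OF that(3)] by simp
    then show "integrable P (indicator B :: real \<Rightarrow> real)" "(\<integral>x. indicator B x \<partial>P) = measure P B"
      using that by (auto simp: p.emeasure_eq_measure)
  qed
  \<comment> \<open>No entropy bound is known for the limit \<open>M\<close> at this stage, so its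
    mass on an open set is bounded from weak convergence alone, through compact subsets and Urysohn
    functions below the indicator.\<close>
  have openle: "measure M V \<le> e" if V: "open V" and le: "\<And>k. measure (\<mu> k) V \<le> e" and "e \<ge> 0" for V e
  proof -
    have "emeasure M V \<le> ennreal e"
    proof (subst inner_regular[of M V], goal_cases)
      case 4
      show ?case
      proof (rule SUP_least, safe)
        fix K assume K: "K \<subseteq> V" "compact K"
        obtain f :: "real \<Rightarrow> real" where f: "continuous_on UNIV f" "\<And>x. f x \<in> closed_segment 0 1"
          "\<And>x. x \<in> - V \<Longrightarrow> f x = 0" "\<And>x. x \<in> K \<Longrightarrow> f x = 1"
          using Urysohn[of "- V" K 0 "1::real"] K V compact_imp_closed[of K] by (auto simp: closed_Compl)
        have fi: "indicator K x \<le> f x" "f x \<le> indicator V x" for x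
          using f(2,3,4)[of x] by (auto simp: indicator_def closed_segment_eq_real_ivl)
        have Kb: "K \<in> sets borel" "V \<in> sets borel" using K V by (auto intro: borel_compact)
        have "measure M K = (\<integral>x. indicator K x \<partial>M)" using int1[OF Kb(1) M.prob_space_axioms] by simp
        also have "\<dots> \<le> (\<integral>x. f x \<partial>M)"
          by (rule integral_mono) (use int1[OF Kb(1) M.prob_space_axioms] intf[OF f(1,2) M.prob_space_axioms] fi in auto)
        also have "\<dots> \<le> e"
        proof (rule LIMSEQ_le_const2[OF wc[OF f(1,2)]], intro exI allI impI)
          fix k
          have "(\<integral>x. f x \<partial>(\<mu> k)) \<le> (\<integral>x. indicator V x \<partial>(\<mu> k))"
            by (rule integral_mono) (use int1[OF Kb(2) mu] intf[OF f(1,2) mu] fi in auto)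
          then show "(\<integral>x. f x \<partial>(\<mu> k)) \<le> e" using int1[OF Kb(2) mu] le[of k] by simp
        qed
        finally show "emeasure M K \<le> ennreal e" by (simp add: M.emeasure_eq_measure ennreal_leI)
      qed
    qed (use V M.emeasure_finite in auto)
    then show ?thesis using that(3) by (simp add: M.emeasure_eq_measure)
  qed
  fix e :: real assume e: "e > 0"
  obtain d where d: "d > 0" "\<And>\<mu> A. prob_space \<mu> \<Longrightarrow> rel_entropy \<mu> \<nu> \<le> ereal a \<Longrightarrow> A \<in> sets \<nu> \<Longrightarrow>
     measure \<nu> A \<le> d \<Longrightarrow> measure \<mu> A \<le> e / 4"
    using entropy_uniformly_absolutely_continuous[OF assms(1), of "e/4" a] e by auto
  have An: "A \<in> sets \<nu>" using A assms(2) by simp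
  have "\<exists>K. K \<subseteq> A \<and> compact K \<and> measure \<nu> A - d / 2 < measure \<nu> K"
  proof (rule ccontr)
    assume *: "\<not> ?thesis"
    have "emeasure \<nu> A \<le> ennreal (measure \<nu> A - d / 2)"
      by (subst inner_regular[OF assms(2) _ A])
        (use * in \<open>auto intro!: SUP_least ennreal_leI simp: n.emeasure_eq_measure not_less\<close>)
    then have "measure \<nu> A \<le> max 0 (measure \<nu> A - d / 2)"
      by (cases "measure \<nu> A - d / 2 \<ge> 0") (auto simp: n.emeasure_eq_measure ennreal_le_iff ennreal_neg)
    then have "measure \<nu> A \<le> 0" using d(1) by (auto simp: max_def split: if_splits)
    then have "measure \<nu> A - d / 2 < measure \<nu> {}" using d(1) by simp
    then show False using * by (metis compact_empty empty_subsetI)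
  qed
  then obtain K where K: "K \<subseteq> A" "compact K" "measure \<nu> A - d / 2 < measure \<nu> K" by blast
  have "\<exists>U. A \<subseteq> U \<and> open U \<and> measure \<nu> U < measure \<nu> A + d / 2"
  proof (rule ccontr)
    assume *: "\<not> ?thesis"
    have "ennreal (measure \<nu> A + d / 2) \<le> emeasure \<nu> A"
      by (subst outer_regular[OF assms(2) _ A])
        (use * in \<open>auto intro!: INF_greatest ennreal_leI simp: n.emeasure_eq_measure not_less\<close>)
    then show False using d(1) by (simp add: n.emeasure_eq_measure)
  qed
  then obtain U where U: "A \<subseteq> U" "open U" "measure \<nu> U < measure \<nu> A + d / 2" by blast
  \<comment> \<open>Outside \<open>V\<close> the Urysohn function chosen below agrees with the
    indicator of \<open>A\<close>; on \<open>V\<close> the two differ by at most 1.\<close>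
  define V where "V = U - K"
  have V: "open V" using U(2) K(2) by (simp add: V_def open_Diff compact_imp_closed)
  have Vb: "V \<in> sets borel" "V \<in> sets \<nu>" using V assms(2) by auto
  have "measure \<nu> V = measure \<nu> U - measure \<nu> K"
    unfolding V_def using U K assms(2) by (intro n.finite_measure_Diff) (auto intro: borel_compact)
  then have "measure \<nu> V \<le> d" using U(3) K(3) by simp
  then have Vk: "measure (\<mu> k) V \<le> e / 4" for k using d(2)[OF mu(1) ent Vb(2)] by simp
  have VM: "measure M V \<le> e / 4" using openle[OF V Vk] e by simp
  obtain f :: "real \<Rightarrow> real" where f: "continuous_on UNIV f" "\<And>x. f x \<in> closed_segment 0 1"
    "\<And>x. x \<in> - U \<Longrightarrow> f x = 0" "\<And>x. x \<in> K \<Longrightarrow> f x = 1"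
    using Urysohn[of "- U" K 0 "1::real"] K U compact_imp_closed[of K]
    by (auto simp: closed_Compl)
  have fA: "\<bar>f x - indicator A x\<bar> \<le> indicator V x" for x
    using f(2,3,4)[of x] K(1) U(1) by (auto simp: indicator_def closed_segment_eq_real_ivl V_def)
  have cmp: "\<bar>(\<integral>x. f x \<partial>P) - measure P A\<bar> \<le> measure P V"
    if P: "prob_space P" "sets P = sets borel" for P :: "real measure"
  proof -
    have "\<bar>(\<integral>x. f x \<partial>P) - measure P A\<bar> = \<bar>\<integral>x. f x - indicator A x \<partial>P\<bar>"
      using int1[OF A P] intf[OF f(1,2) P] by simp
    also have "\<dots> \<le> (\<integral>x. \<bar>f x - indicator A x\<bar> \<partial>P)" by (rule integral_abs_bound)
    also have "\<dots> \<le> (\<integral>x. indicator V x \<partial>P)"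
      by (rule integral_mono) (use int1[OF A P] int1[OF Vb(1) P] intf[OF f(1,2) P] fA in auto)
    finally show ?thesis using int1[OF Vb(1) P] by simp
  qed
  from LIMSEQ_D[OF wc[OF f(1,2)], of "e/4"] e obtain N where
    N: "\<And>k. k \<ge> N \<Longrightarrow> \<bar>(\<integral>x. f x \<partial>(\<mu> k)) - (\<integral>x. f x \<partial>M)\<bar> < e / 4" by auto
  have "\<bar>measure (\<mu> k) A - measure M A\<bar> < e" if "k \<ge> N" for k
    using cmp[OF mu, of k] cmp[OF M.prob_space_axioms M.events_eq_borel] N[OF that] Vk[of k] VM e by linarith
  then show "\<exists>no. \<forall>n\<ge>no. norm (measure (\<mu> n) A - measure M A) < e" by auto
qed

text \<open>The entropy bounds may vary with k. Setwise convergence uses only their supremum B,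
  while the limit inherits the sharp bound b by passing to the limit in each Donsker--Varadhan
  inequality.\<close>

lemma entropy_compactness:
  fixes \<mu> :: "nat \<Rightarrow> real measure" and \<nu> :: "real measure"
  assumes "prob_space \<nu>" "sets \<nu> = sets borel"
    and mu: "\<And>k. prob_space (\<mu> k)" "\<And>k. sets (\<mu> k) = sets borel"
      "\<And>k. emeasure (\<mu> k) (- {0..1}) = 0"
    and ent: "\<And>k. rel_entropy (\<mu> k) \<nu> \<le> ereal (a k)" "a \<longlonglongrightarrow> b"
  obtains r M where "strict_mono (r :: nat \<Rightarrow> nat)" "prob_space M" "sets M = sets borel"
    "emeasure M (- {0..1}) = 0" "rel_entropy M \<nu> \<le> ereal b"
    "\<And>A. A \<in> sets borel \<Longrightarrow> (\<lambda>k. measure (\<mu> (r k)) A) \<longlonglongrightarrow> measure M A"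
proof -
  have rd: "real_distribution (\<mu> k)" for k
    using mu by (simp add: real_distribution_def real_distribution_axioms_def)
  \<comment> \<open>\<open>tight\<close> speaks of half-open intervals, hence (-1, 1] in place of
    [0, 1].\<close>
  have one: "measure (\<mu> k) {-1<..1} = 1" for k
  proof -
    interpret real_distribution "\<mu> k" by (rule rd)
    have "measure (\<mu> k) (UNIV - {0..1}) = 0" using mu(3)[of k] by (simp add: measure_def Compl_eq_Diff_UNIV)
    then have "measure (\<mu> k) {0..1} = 1" using prob_compl[of "{0..1}"] by simp
    moreover have "measure (\<mu> k) {0..1} \<le> measure (\<mu> k) {-1<..1}" by (intro finite_measure_mono) auto
    ultimately show ?thesis using prob_le_1[of "{-1<..1}"] by linarith
  qed
  have "tight \<mu>" unfolding tight_def
  proof (intro conjI allI impI rd)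
    fix e :: real assume "e > 0"
    then show "\<exists>a b. a < b \<and> (\<forall>n. 1 - e < measure (\<mu> n) {a<..b})"
      by (intro exI[of _ "-1"] exI[of _ 1]) (simp add: one)
  qed
  from tight_imp_convergent_subsubsequence[OF this, of id] obtain r M
    where r: "strict_mono r" "real_distribution M" "weak_conv_m (\<mu> \<circ> r) M"
    by (auto simp: strict_mono_def)
  interpret M: real_distribution M by fact
  obtain B where B: "\<And>k. \<bar>a k\<bar> \<le> B" using convergent_imp_Bseq[of a] ent(2) by (auto simp: convergent_def Bseq_def)
  have entB: "rel_entropy (\<mu> k) \<nu> \<le> ereal B" for k
    using ent(1)[of k] B[of k] by (meson abs_le_D1 ereal_less_eq(3) order_trans)
  have conv: "(\<lambda>k. measure (\<mu> (r k)) A) \<longlonglongrightarrow> measure M A" if "A \<in> sets borel" for A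
    using entropy_weak_limit_setwise[OF assms(1,2), of "\<mu> \<circ> r" B M A] mu entB r that by (simp add: comp_def)
  have M0: "emeasure M (- {0..1}) = 0"
  proof -
    have "(\<lambda>k. measure (\<mu> (r k)) (- {0..1})) \<longlonglongrightarrow> measure M (- {0..1})" by (rule conv) auto
    moreover have "measure (\<mu> (r k)) (- {0..1}) = 0" for k using mu(3)[of "r k"] by (simp add: measure_def)
    ultimately have "measure M (- {0..1}) = 0" by (simp add: LIMSEQ_const_iff)
    then show ?thesis by (simp add: M.emeasure_eq_measure)
  qed
  have "rel_entropy M \<nu> \<le> ereal b"
  proof (rule rel_entropy_leI[OF assms(1) M.prob_space_axioms])
    show "sets M = sets \<nu>" using assms(2) by simp
    fix g :: "real \<Rightarrow> real" and C assume g: "g \<in> borel_measurable \<nu>" "\<And>x. \<bar>g x\<bar> \<le> C"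
    have gM: "g \<in> borel_measurable M" using g(1) assms(2) by (simp cong: measurable_cong_sets)
    have "(\<lambda>k. \<integral>x. g x \<partial>(\<mu> (r k))) \<longlonglongrightarrow> (\<integral>x. g x \<partial>M)"
      by (rule setwise_convergence_integral[OF mu(1) M.prob_space_axioms _ _ gM g(2)]) (use mu conv in auto)
    moreover have "(\<lambda>k. a (r k) + ln (\<integral>x. exp (g x) \<partial>\<nu>)) \<longlonglongrightarrow> b + ln (\<integral>x. exp (g x) \<partial>\<nu>)"
      using LIMSEQ_subseq_LIMSEQ[OF ent(2) r(1)] by (intro tendsto_intros) (simp add: comp_def)
    ultimately show "(\<integral>x. g x \<partial>M) \<le> b + ln (\<integral>x. exp (g x) \<partial>\<nu>)"
      by (rule LIMSEQ_le) (use Donsker_Varadhan_le[OF assms(1) mu(1) ent(1) g] in auto)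
  qed
  then show ?thesis using that[OF r(1) M.prob_space_axioms _ M0 _ conv] by simp
qed

section \<open>Uniform samples\<close>

definition samples :: "nat \<Rightarrow> (nat \<Rightarrow> nat) set" where
  "samples n = PiE {..<n} (\<lambda>_. {1..n})"

text \<open>Expectation under n independent uniform draws as a normalised finite sum; n ^ n is the
  number of samples.\<close>

definition sexp :: "nat \<Rightarrow> ((nat \<Rightarrow> nat) \<Rightarrow> real) \<Rightarrow> real" where
  "sexp n f = (\<Sum>X\<in>samples n. f X) / real n ^ n"

definition sprob :: "nat \<Rightarrow> ((nat \<Rightarrow> nat) \<Rightarrow> bool) \<Rightarrow> real" where
  "sprob n P = sexp n (\<lambda>X. of_bool (P X))"

lemma finite_samples [simp]: "finite (samples n)"
  by (simp add: samples_def finite_PiE)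

lemma samplesD: "X \<in> samples n \<Longrightarrow> i < n \<Longrightarrow> X i \<in> {1..n}"
  using PiE_mem[of X "{..<n}" "\<lambda>_. {1..n}" i] by (simp add: samples_def)

lemma sprob_conv_pmf:
  assumes "n \<ge> 1"
  shows "measure (measure_pmf (pmf_of_set (samples n))) {X. P X} = sprob n P"
proof -
  have c: "card (samples n) = n ^ n" unfolding samples_def by (subst card_PiE) auto
  have "samples n \<noteq> {}"
  proof
    assume "samples n = {}"
    then show False using c assms by simp
  qed
  then show ?thesis using c
    by (simp add: measure_pmf_of_set sprob_def sexp_def)
qed

lemma sexp_mono: "(\<And>X. X \<in> samples n \<Longrightarrow> f X \<le> g X) \<Longrightarrow> sexp n f \<le> sexp n g"
  unfolding sexp_def by (intro divide_right_mono sum_mono) auto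

lemma sexp_add: "sexp n (\<lambda>X. f X + g X) = sexp n f + sexp n g"
  by (simp add: sexp_def sum.distrib add_divide_distrib)

lemma sexp_cmult: "sexp n (\<lambda>X. a * f X) = a * sexp n f"
  by (simp add: sexp_def sum_distrib_left)

lemma sexp_sum: "sexp n (\<lambda>X. \<Sum>a\<in>A. f a X) = (\<Sum>a\<in>A. sexp n (f a))"
  unfolding sexp_def by (subst sum.swap) (simp add: sum_divide_distrib)

text \<open>Independence of the coordinates, in the form of the distributive law for a product of
  sums.\<close>

lemma sexp_prod: "sexp n (\<lambda>X. \<Prod>i<n. f i (X i)) = (\<Prod>i<n. (\<Sum>x\<in>{1..n}. f i x) / real n)"
proof -
  have "(\<Prod>i<n. (\<Sum>x\<in>{1..n}. f i x) / real n) = (\<Prod>i<n. \<Sum>x\<in>{1..n}. f i x) / real n ^ n"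
    by (simp add: prod_dividef)
  also have "(\<Prod>i<n. \<Sum>x\<in>{1..n}. f i x) = (\<Sum>X\<in>samples n. \<Prod>i<n. f i (X i))"
    unfolding samples_def by (rule prod_sum_PiE) auto
  finally show ?thesis by (simp add: sexp_def)
qed

lemma sprob_mono: "(\<And>X. X \<in> samples n \<Longrightarrow> P X \<Longrightarrow> Q X) \<Longrightarrow> sprob n P \<le> sprob n Q"
  unfolding sprob_def by (rule sexp_mono) auto

lemma sprob_disj: "sprob n (\<lambda>X. P X \<or> Q X) \<le> sprob n P + sprob n Q"
  unfolding sprob_def sexp_add[symmetric] by (rule sexp_mono) auto

lemma sprob_Bex:
  assumes "finite A"
  shows "sprob n (\<lambda>X. \<exists>a\<in>A. P a X) \<le> (\<Sum>a\<in>A. sprob n (P a))"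
  unfolding sprob_def sexp_sum[symmetric]
proof (rule sexp_mono)
  fix X
  show "of_bool (\<exists>a\<in>A. P a X) \<le> (\<Sum>a\<in>A. of_bool (P a X) :: real)"
  proof (cases "\<exists>a\<in>A. P a X")
    case True
    then obtain a where "a \<in> A" "P a X" by auto
    then have "1 \<le> (\<Sum>a\<in>A. of_bool (P a X) :: real)"
      using member_le_sum[of a A "\<lambda>a. of_bool (P a X) :: real"] assms by auto
    then show ?thesis using True by simp
  qed (auto intro: sum_nonneg)
qed

lemma sexp_Markov:
  assumes "\<And>X. X \<in> samples n \<Longrightarrow> 0 \<le> f X" "\<And>X. X \<in> samples n \<Longrightarrow> P X \<Longrightarrow> b \<le> f X" "b > 0"
  shows "sprob n P \<le> sexp n f / b"
proof -
  have "b * sprob n P \<le> sexp n f"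
    unfolding sprob_def sexp_cmult[symmetric] by (rule sexp_mono) (use assms in auto)
  then show ?thesis using assms(3) by (simp add: field_simps)
qed

section \<open>Pairs related by a sparse relation\<close>

text \<open>If \<open>g\<close> has small density then, at any prescribed exponential rate, few pairs of the sample
  are \<open>g\<close>-related: few sample points have a large section, and each point with a small
  section is unlikely to be related to many of the others.\<close>

lemma sparse_pairs_exponentially_unlikely:
  assumes "\<epsilon> > 0" "M > 0"
  obtains \<theta> :: real where "\<theta> > 0"
    "\<And>g. (\<And>n. (\<Sum>x\<in>{1..n}. \<Sum>y\<in>{1..n}. of_bool (g x y)) \<le> \<theta> * real n ^ 2) \<Longrightarrow>
      (\<forall>\<^sub>F n in sequentially.
        sprob n (\<lambda>X. \<epsilon> * real n ^ 2 \<le> (\<Sum>i<n. \<Sum>j<n. of_bool (g (X i) (X j)))) \<le> exp (- M * real n))"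
proof -
  \<comment> \<open>t is a Chernoff exponent: a count of at least \<epsilon> n / 3 then costs e^{-(M
    + 3) n}. The surplus 3 pays for the bound 2^n \<le> e^n on the moments and for the prefactor 1 +
    n e^t. The choice \<delta> = e^{-t} keeps the moment of a point with small section at most 2;
    \<theta> = \<delta> e^{-t} leaves a fraction at most \<theta> / \<delta> = e^{-t} of points with
    section above \<delta>.\<close>
  define t where "t = 3 * (M + 3) / \<epsilon>"
  define \<delta> where "\<delta> = exp (- t)"
  define \<theta> where "\<theta> = \<delta> * exp (- t)"
  have t: "t > 0" and t\<epsilon>: "t * (\<epsilon> / 3) = M + 3" using assms by (auto simp: t_def)
  have \<delta>: "\<delta> > 0" "exp t * \<delta> = 1" "exp t * (\<theta> / \<delta>) = 1"
    by (simp_all add: \<delta>_def \<theta>_def exp_minus)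
  show ?thesis
  proof (rule that[of \<theta>])
    show "\<theta> > 0" by (simp add: \<theta>_def \<delta>_def)
    fix g :: "nat \<Rightarrow> nat \<Rightarrow> bool"
    assume g: "\<And>n. (\<Sum>x\<in>{1..n}. \<Sum>y\<in>{1..n}. of_bool (g x y)) \<le> \<theta> * real n ^ 2"
    define b :: "nat \<Rightarrow> nat \<Rightarrow> real" where "b n x = (\<Sum>y\<in>{1..n}. of_bool (g x y)) / real n" for n x
    have b0: "0 \<le> b n x" for n x by (auto simp: b_def intro!: divide_nonneg_nonneg sum_nonneg)
    \<comment> \<open>\<open>B1\<close>: at least a share \<epsilon>/3 of the sample has large
      sections. \<open>B2\<close>: the i-th point has a small section and is nevertheless related to
      a share \<epsilon>/3 of the sample. If none of these occurs, at most 2 \<epsilon> n^2 / 3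
      pairs are related.\<close>
    define B1 where "B1 n X \<longleftrightarrow> \<epsilon> / 3 * real n \<le> (\<Sum>i<n. of_bool (b n (X i) > \<delta>))" for n :: nat and X
    define B2 where "B2 n i X \<longleftrightarrow> b n (X i) \<le> \<delta> \<and> \<epsilon> / 3 * real n \<le> (\<Sum>j<n. of_bool (g (X i) (X j)))" for n i :: nat and X
    have pw: "(1 + y) ^ n \<le> exp (real n * y)" if "y \<ge> 0" for y :: real and n
      using power_mono[of "1 + y" "exp y" n] that exp_ge_add_one_self[of y] by (simp add: exp_of_nat_mult)
    have et: "exp (t * of_bool P) = 1 + (exp t - 1) * of_bool P" for P by auto
    have p1: "sprob n (B1 n) \<le> exp (- (M + 2) * real n)" if n: "n \<ge> 1" for n
    proof -
      have avg: "(\<Sum>x\<in>{1..n}. exp (t * of_bool (b n x > \<delta>))) / real n \<le> 2"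
      proof -
        have "(\<Sum>x\<in>{1..n}. of_bool (b n x > \<delta>)) \<le> (\<Sum>x\<in>{1..n}. b n x / \<delta>)"
          using b0 \<delta>(1) by (intro sum_mono) (auto simp: field_simps)
        also have "\<dots> = (\<Sum>x\<in>{1..n}. \<Sum>y\<in>{1..n}. of_bool (g x y)) / real n / \<delta>"
          by (simp add: b_def sum_divide_distrib)
        also have "\<dots> \<le> (\<theta> * real n ^ 2) / real n / \<delta>"
          using g[of n] \<delta>(1) by (intro divide_right_mono) auto
        also have "\<dots> = \<theta> / \<delta> * real n" using n by (simp add: power2_eq_square)
        finally have le: "(\<Sum>x\<in>{1..n}. of_bool (b n x > \<delta>)) \<le> \<theta> / \<delta> * real n" .
        have "(\<Sum>x\<in>{1..n}. exp (t * of_bool (b n x > \<delta>)))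
            = real n + (exp t - 1) * (\<Sum>x\<in>{1..n}. of_bool (b n x > \<delta>))"
          unfolding et sum.distrib sum_distrib_left by simp
        also have "\<dots> \<le> real n + exp t * (\<theta> / \<delta> * real n)"
          using le t by (intro add_left_mono mult_mono) (auto intro: sum_nonneg)
        also have "exp t * (\<theta> / \<delta> * real n) = exp t * (\<theta> / \<delta>) * real n" by simp
        also have "real n + \<dots> = 2 * real n" unfolding \<delta>(3) by simp
        finally show ?thesis using n by (simp add: field_simps)
      qed
      have mk: "sprob n (B1 n) \<le> sexp n (\<lambda>X. \<Prod>i<n. exp (t * of_bool (b n (X i) > \<delta>))) / exp (t * (\<epsilon> / 3 * real n))"
      proof (rule sexp_Markov)
        fix X assume "B1 n X"
        then have "t * (\<epsilon> / 3 * real n) \<le> (\<Sum>i<n. t * of_bool (b n (X i) > \<delta>))"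
          unfolding B1_def sum_distrib_left[symmetric] using t by (intro mult_left_mono) auto
        then show "exp (t * (\<epsilon> / 3 * real n)) \<le> (\<Prod>i<n. exp (t * of_bool (b n (X i) > \<delta>)))"
          by (simp add: exp_sum[symmetric])
      qed (auto intro: prod_nonneg)
      have "sexp n (\<lambda>X. \<Prod>i<n. exp (t * of_bool (b n (X i) > \<delta>)))
          = ((\<Sum>x\<in>{1..n}. exp (t * of_bool (b n x > \<delta>))) / real n) ^ n"
        by (subst sexp_prod[where f="\<lambda>i x. exp (t * of_bool (b n x > \<delta>))"]) simp
      also have "\<dots> \<le> 2 ^ n" using avg by (intro power_mono divide_nonneg_nonneg sum_nonneg) auto
      also have "\<dots> \<le> exp (real n * 1)" using pw[of 1 n] by simp
      finally have le: "sexp n (\<lambda>X. \<Prod>i<n. exp (t * of_bool (b n (X i) > \<delta>))) \<le> exp (real n * 1)" .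
      note mk
      also have "sexp n (\<lambda>X. \<Prod>i<n. exp (t * of_bool (b n (X i) > \<delta>))) / exp (t * (\<epsilon> / 3 * real n))
          \<le> exp (real n * 1) / exp (t * (\<epsilon> / 3 * real n))"
        using le by (intro divide_right_mono) auto
      also have "t * (\<epsilon> / 3 * real n) = (M + 3) * real n" using t\<epsilon> by (simp add: mult.assoc[symmetric])
      also have "exp (real n * 1) / exp ((M + 3) * real n) = exp (- (M + 2) * real n)"
        by (simp add: exp_diff[symmetric] algebra_simps)
      finally show ?thesis .
    qed
    have p2: "sprob n (B2 n i) \<le> exp t * exp (- (M + 2) * real n)" if n: "n \<ge> 1" and i: "i < n" for n i
    proof -
      \<comment> \<open>The factor at j = i carries the indicator of X i = x, which freezes the i-th
        point so that the expectation factorises over the others. Its exponential part is bounded by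
        e^t, since \<open>g x x\<close> may hold; this is the extra \<open>exp t\<close> in the
        claim.\<close>
      define G where "G x j y = (if j = i then of_bool (y = x) * exp (t * of_bool (g x y)) else exp (t * of_bool (g x y)))"
        for x j y :: nat
      have G0: "0 \<le> G x j y" for x j y by (simp add: G_def)
      define A where "A = {x\<in>{1..n}. b n x \<le> \<delta>}"
      have mk: "sprob n (B2 n i) \<le> sexp n (\<lambda>X. \<Sum>x\<in>A. \<Prod>j<n. G x j (X j)) / exp (t * (\<epsilon> / 3 * real n))"
      proof (rule sexp_Markov)
        fix X assume X: "X \<in> samples n" and B: "B2 n i X"
        have xA: "X i \<in> A" using samplesD[OF X i] B by (auto simp: A_def B2_def)
        have "t * (\<epsilon> / 3 * real n) \<le> (\<Sum>j<n. t * of_bool (g (X i) (X j)))"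
          using B unfolding B2_def sum_distrib_left[symmetric] using t by (intro mult_left_mono) auto
        then have "exp (t * (\<epsilon> / 3 * real n)) \<le> (\<Prod>j<n. exp (t * of_bool (g (X i) (X j))))"
          by (simp add: exp_sum[symmetric])
        also have "\<dots> = (\<Prod>j<n. G (X i) j (X j))" by (intro prod.cong) (auto simp: G_def)
        also have "\<dots> \<le> (\<Sum>x\<in>A. \<Prod>j<n. G x j (X j))"
          using xA G0 by (intro member_le_sum[where f="\<lambda>x. \<Prod>j<n. G x j (X j)"]) (auto simp: A_def intro: prod_nonneg)
        finally show "exp (t * (\<epsilon> / 3 * real n)) \<le> (\<Sum>x\<in>A. \<Prod>j<n. G x j (X j))" .
      qed (auto intro: sum_nonneg prod_nonneg G0)
      have le: "sexp n (\<lambda>X. \<Sum>x\<in>A. \<Prod>j<n. G x j (X j)) \<le> exp t * exp (real n)"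
      proof -
        have each: "sexp n (\<lambda>X. \<Prod>j<n. G x j (X j)) \<le> exp t * exp (real n) / real n" if x: "x \<in> A" for x
        proof -
          have x': "x \<in> {1..n}" "b n x \<le> \<delta>" using x by (auto simp: A_def)
          have "sexp n (\<lambda>X. \<Prod>j<n. G x j (X j)) = (\<Prod>j<n. (\<Sum>y\<in>{1..n}. G x j y) / real n)" by (rule sexp_prod)
          also have "\<dots> = (\<Sum>y\<in>{1..n}. G x i y) / real n * (\<Prod>j\<in>{..<n}-{i}. (\<Sum>y\<in>{1..n}. G x j y) / real n)"
            using i by (subst prod.remove[of _ i]) auto
          also have "(\<Sum>y\<in>{1..n}. G x i y) = (\<Sum>y\<in>{1..n}. if y = x then exp (t * of_bool (g x x)) else 0)"
            by (intro sum.cong) (auto simp: G_def)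
          also have "\<dots> = exp (t * of_bool (g x x))" using x' by simp
          also have "(\<Prod>j\<in>{..<n}-{i}. (\<Sum>y\<in>{1..n}. G x j y) / real n) = (1 + (exp t - 1) * b n x) ^ (n - 1)"
          proof -
            have "(\<Sum>y\<in>{1..n}. G x j y) / real n = 1 + (exp t - 1) * b n x" if "j \<noteq> i" for j
            proof -
              have "(\<Sum>y\<in>{1..n}. G x j y) = real n + (exp t - 1) * (\<Sum>y\<in>{1..n}. of_bool (g x y))"
                unfolding G_def using that by (simp only: if_False et sum.distrib sum_distrib_left) simp
              then show ?thesis using n by (simp add: b_def field_simps)
            qed
            then show ?thesis using i by simp
          qed
          also have "exp (t * of_bool (g x x)) / real n * (1 + (exp t - 1) * b n x) ^ (n - 1)
              \<le> exp t / real n * exp (real n)"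
          proof (intro mult_mono divide_right_mono)
            have "(exp t - 1) * b n x \<le> exp t * \<delta>" using x' b0 t by (intro mult_mono) auto
            then have le: "(exp t - 1) * b n x \<le> 1" using \<delta> by simp
            have "(1 + (exp t - 1) * b n x) ^ (n - 1) \<le> (1 + 1) ^ (n - 1)"
              using le b0 t by (intro power_mono) auto
            also have "\<dots> \<le> (1 + 1) ^ n" by (intro power_increasing) auto
            also have "\<dots> \<le> exp (real n * 1)" by (rule pw) simp
            finally show "(1 + (exp t - 1) * b n x) ^ (n - 1) \<le> exp (real n)" by simp
          qed (use t b0[of n x] in auto)
          finally show ?thesis by simp
        qed
        have "sexp n (\<lambda>X. \<Sum>x\<in>A. \<Prod>j<n. G x j (X j)) \<le> (\<Sum>x\<in>A. exp t * exp (real n) / real n)"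
          unfolding sexp_sum by (intro sum_mono each)
        also have "\<dots> \<le> (\<Sum>x\<in>{1..n}. exp t * exp (real n) / real n)"
          by (intro sum_mono2) (auto simp: A_def)
        finally show ?thesis using n by simp
      qed
      note mk
      also have "sexp n (\<lambda>X. \<Sum>x\<in>A. \<Prod>j<n. G x j (X j)) / exp (t * (\<epsilon> / 3 * real n))
          \<le> exp t * exp (real n) / exp (t * (\<epsilon> / 3 * real n))"
        using le by (intro divide_right_mono) auto
      also have "t * (\<epsilon> / 3 * real n) = (M + 3) * real n" using t\<epsilon> by (simp add: mult.assoc[symmetric])
      also have "exp t * exp (real n) / exp ((M + 3) * real n) = exp t * exp (- (M + 2) * real n)"
        by (simp add: exp_diff[symmetric] exp_add[symmetric] algebra_simps)
      finally show ?thesis .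
    qed
    have tot: "sprob n (\<lambda>X. \<epsilon> * real n ^ 2 \<le> (\<Sum>i<n. \<Sum>j<n. of_bool (g (X i) (X j))))
        \<le> (1 + real n * exp t) * exp (- (M + 2) * real n)" if n: "n \<ge> 1" for n
    proof -
      have "sprob n (\<lambda>X. \<epsilon> * real n ^ 2 \<le> (\<Sum>i<n. \<Sum>j<n. of_bool (g (X i) (X j))))
        \<le> sprob n (\<lambda>X. B1 n X \<or> (\<exists>i\<in>{..<n}. B2 n i X))"
      proof (rule sprob_mono, rule ccontr)
        fix X assume le: "\<epsilon> * real n ^ 2 \<le> (\<Sum>i<n. \<Sum>j<n. of_bool (g (X i) (X j)))"
          and no: "\<not> (B1 n X \<or> (\<exists>i\<in>{..<n}. B2 n i X))"
        have row: "(\<Sum>j<n. of_bool (g (X i) (X j))) \<le> real n * of_bool (b n (X i) > \<delta>) + \<epsilon> / 3 * real n"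
          if i: "i < n" for i
        proof (cases "b n (X i) > \<delta>")
          case True
          have "(\<Sum>j<n. of_bool (g (X i) (X j))) \<le> (\<Sum>j<n. 1 :: real)" by (intro sum_mono) auto
          then show ?thesis using True assms by (simp add: add_increasing2)
        next
          case False
          then have "\<not> \<epsilon> / 3 * real n \<le> (\<Sum>j<n. of_bool (g (X i) (X j)))"
            using no i unfolding B2_def by (metis lessThan_iff not_le)
          then show ?thesis using False by simp
        qed
        have "(\<Sum>i<n. \<Sum>j<n. of_bool (g (X i) (X j))) \<le> (\<Sum>i<n. real n * of_bool (b n (X i) > \<delta>) + \<epsilon> / 3 * real n)"
          using row by (intro sum_mono) auto
        also have "\<dots> = real n * (\<Sum>i<n. of_bool (b n (X i) > \<delta>)) + real n * (\<epsilon> / 3 * real n)"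
          by (simp add: sum.distrib sum_distrib_left)
        also have "\<dots> \<le> real n * (\<epsilon> / 3 * real n) + real n * (\<epsilon> / 3 * real n)"
          using no unfolding B1_def by (intro add_right_mono mult_left_mono) auto
        also have "\<dots> < \<epsilon> * real n ^ 2" using n assms by (simp add: power2_eq_square)
        finally show False using le by simp
      qed
      also have "\<dots> \<le> sprob n (B1 n) + (\<Sum>i<n. sprob n (B2 n i))"
        by (rule order_trans[OF sprob_disj add_left_mono[OF sprob_Bex]]) simp
      also have "\<dots> \<le> exp (- (M + 2) * real n) + (\<Sum>i<n. exp t * exp (- (M + 2) * real n))"
        using p1[OF n] p2[OF n] by (intro add_mono sum_mono) auto
      finally show ?thesis by (simp add: algebra_simps)
    qed
    \<comment> \<open>The spare factor e^{-2n} absorbs the prefactor.\<close>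
    have "(\<lambda>n. (1 + real n * exp t) * exp (- 2 * real n)) \<longlonglongrightarrow> 0" by real_asymp
    then have "\<forall>\<^sub>F n in sequentially. (1 + real n * exp t) * exp (- 2 * real n) < 1"
      by (rule order_tendstoD) simp
    then show "\<forall>\<^sub>F n in sequentially.
        sprob n (\<lambda>X. \<epsilon> * real n ^ 2 \<le> (\<Sum>i<n. \<Sum>j<n. of_bool (g (X i) (X j)))) \<le> exp (- M * real n)"
      using eventually_ge_at_top[of 1]
    proof eventually_elim
      case (elim n)
      have "(1 + real n * exp t) * exp (- (M + 2) * real n)
          = ((1 + real n * exp t) * exp (- 2 * real n)) * exp (- M * real n)"
        by (simp add: exp_add[symmetric] algebra_simps)
      also have "\<dots> \<le> 1 * exp (- M * real n)" using elim by (intro mult_right_mono) auto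
      finally show ?case using tot[OF elim(2)] by simp
    qed
  qed
qed

section \<open>Sanov's theorem for classes of positive density\<close>

text \<open>A triangular array in disguise: the class of a uniform point of {1..n} has a law
  depending on n, assumed only to converge to \<nu>. Strict positivity of \<nu> turns convergence
  into a bound on ratios and makes p / \<nu> meaningful for every p.\<close>

locale cell_density =
  fixes S :: "'s set" and c :: "nat \<Rightarrow> 's" and \<nu> :: "'s \<Rightarrow> real"
  assumes finite_S: "finite S" and c_in: "\<And>x. x \<ge> 1 \<Longrightarrow> c x \<in> S"
    and \<nu>_pos: "\<And>s. s \<in> S \<Longrightarrow> 0 < \<nu> s" and \<nu>_sum: "(\<Sum>s\<in>S. \<nu> s) = 1"
    and density: "\<And>s. s \<in> S \<Longrightarrow> (\<lambda>n. (\<Sum>x\<in>{1..n}. of_bool (c x = s)) / real n) \<longlonglongrightarrow> \<nu> s"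
begin

definition dens :: "nat \<Rightarrow> 's \<Rightarrow> real" where
  "dens n s = (\<Sum>x\<in>{1..n}. of_bool (c x = s)) / real n"

definition emp :: "nat \<Rightarrow> (nat \<Rightarrow> nat) \<Rightarrow> 's \<Rightarrow> real" where
  "emp n X s = (\<Sum>i<n. of_bool (c (X i) = s)) / real n"

text \<open>The Kullback--Leibler divergence of p from \<nu>; classes with p s = 0 contribute 0
  through the first factor.\<close>

definition Ent :: "('s \<Rightarrow> real) \<Rightarrow> real" where
  "Ent p = (\<Sum>s\<in>S. p s * ln (p s / \<nu> s))"

definition distribution :: "('s \<Rightarrow> real) \<Rightarrow> bool" where
  "distribution p \<longleftrightarrow> (\<forall>s\<in>S. 0 \<le> p s) \<and> (\<Sum>s\<in>S. p s) = 1"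

lemma sum_cells:
  assumes "x \<ge> 1"
  shows "(\<Sum>s\<in>S. f s * of_bool (c x = s)) = (f (c x) :: real)"
proof -
  have "(\<Sum>s\<in>S. f s * of_bool (c x = s)) = (\<Sum>s\<in>S. if c x = s then f s else 0)"
    by (intro sum.cong) auto
  then show ?thesis using finite_S c_in[OF assms] by simp
qed

lemma mean_cells: "(\<Sum>x\<in>{1..n}. f (c x)) / real n = (\<Sum>s\<in>S. f s * dens n s)"
proof -
  have "(\<Sum>x\<in>{1..n}. f (c x)) = (\<Sum>x\<in>{1..n}. \<Sum>s\<in>S. f s * of_bool (c x = s))"
    by (intro sum.cong refl sum_cells[symmetric]) auto
  also have "\<dots> = (\<Sum>s\<in>S. f s * (\<Sum>x\<in>{1..n}. of_bool (c x = s)))"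
    by (subst sum.swap) (simp only: sum_distrib_left)
  finally have "(\<Sum>x\<in>{1..n}. f (c x)) = (\<Sum>s\<in>S. f s * (\<Sum>x\<in>{1..n}. of_bool (c x = s)))" .
  then show ?thesis unfolding dens_def times_divide_eq_right sum_divide_distrib[symmetric] by (rule arg_cong)
qed

lemma sum_emp:
  assumes "X \<in> samples n"
  shows "(\<Sum>i<n. f (c (X i))) = real n * (\<Sum>s\<in>S. f s * emp n X s)"
proof -
  have "(\<Sum>i<n. f (c (X i))) = (\<Sum>i<n. \<Sum>s\<in>S. f s * of_bool (c (X i) = s))"
    using samplesD[OF assms] by (intro sum.cong refl sum_cells[symmetric]) auto
  also have "\<dots> = (\<Sum>s\<in>S. f s * (\<Sum>i<n. of_bool (c (X i) = s)))"
    by (subst sum.swap) (simp only: sum_distrib_left)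
  also have "\<dots> = (\<Sum>s\<in>S. real n * (f s * emp n X s))"
    by (intro sum.cong) (auto simp: emp_def)
  finally show ?thesis by (simp only: sum_distrib_left)
qed

lemma emp_nonneg: "0 \<le> emp n X s"
  unfolding emp_def by (intro divide_nonneg_nonneg sum_nonneg) auto

lemma distribution_emp:
  assumes "X \<in> samples n" "n \<ge> 1"
  shows "distribution (emp n X)"
  using sum_emp[OF assms(1), of "\<lambda>_. 1"] assms(2) by (simp add: distribution_def emp_nonneg)

lemma sexp_cell_prod: "sexp n (\<lambda>X. \<Prod>i<n. f (c (X i))) = (\<Sum>s\<in>S. f s * dens n s) ^ n"
  by (subst sexp_prod[where f="\<lambda>i x. f (c x)"]) (simp only: mean_cells prod_constant card_lessThan)

text \<open>With the convention \<open>ln 0 = 0\<close> the bound remains true when \<open>f\<close> vanishes somewhere.\<close>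

lemma prod_cells_le:
  assumes "X \<in> samples n" "\<And>s. s \<in> S \<Longrightarrow> 0 \<le> f s"
  shows "(\<Prod>i<n. f (c (X i))) \<le> exp (real n * (\<Sum>s\<in>S. ln (f s) * emp n X s))"
proof (cases "\<exists>i<n. f (c (X i)) = 0")
  case True
  then have "(\<Prod>i<n. f (c (X i))) = 0" by (intro prod_zero) auto
  then show ?thesis using exp_ge_zero by metis
next
  case False
  have "f (c (X i)) = exp (ln (f (c (X i))))" if "i < n" for i
  proof -
    have "0 \<le> f (c (X i))" using samplesD[OF assms(1) that] by (intro assms(2) c_in) auto
    then have "0 < f (c (X i))" using False that by (metis less_le)
    then show ?thesis by simp
  qed
  then have "(\<Prod>i<n. f (c (X i))) = (\<Prod>i<n. exp (ln (f (c (X i)))))" by (intro prod.cong) auto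
  also have "\<dots> = exp (\<Sum>i<n. ln (f (c (X i))))" by (simp add: exp_sum)
  also have "\<dots> = exp (real n * (\<Sum>s\<in>S. ln (f s) * emp n X s))"
    by (subst sum_emp[OF assms(1)]) simp
  finally show ?thesis by simp
qed

text \<open>Under \<open>ln 0 = 0\<close> the two sides agree as soon as f is positive on the
  classes that the sample visits, which are those with nonzero \<open>emp\<close>. The method of
  types uses this equality, the change of measure the inequality above.\<close>

lemma prod_cells_eq:
  assumes "X \<in> samples n" "\<And>s. s \<in> S \<Longrightarrow> emp n X s \<noteq> 0 \<Longrightarrow> 0 < f s"
  shows "(\<Prod>i<n. f (c (X i))) = exp (real n * (\<Sum>s\<in>S. ln (f s) * emp n X s))"
proof -
  have "f (c (X i)) = exp (ln (f (c (X i))))" if i: "i < n" for i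
  proof -
    have "c (X i) \<in> S" using samplesD[OF assms(1) i] by (intro c_in) auto
    moreover have "emp n X (c (X i)) > 0"
    proof -
      have "(0::real) < of_bool (c (X i) = c (X i))" by simp
      also have "\<dots> \<le> (\<Sum>j<n. of_bool (c (X j) = c (X i)))"
        using i by (intro member_le_sum[where f="\<lambda>j. of_bool (c (X j) = c (X i))"]) auto
      finally show ?thesis using i unfolding emp_def by (intro divide_pos_pos) auto
    qed
    ultimately show ?thesis using assms(2) by simp
  qed
  then have "(\<Prod>i<n. f (c (X i))) = (\<Prod>i<n. exp (ln (f (c (X i)))))" by (intro prod.cong) auto
  also have "\<dots> = exp (\<Sum>i<n. ln (f (c (X i))))" by (simp add: exp_sum)
  also have "\<dots> = exp (real n * (\<Sum>s\<in>S. ln (f s) * emp n X s))"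
    by (subst sum_emp[OF assms(1)]) simp
  finally show ?thesis .
qed

lemma tendsto_cell_mean: "(\<lambda>n. \<Sum>s\<in>S. f s * dens n s) \<longlonglongrightarrow> (\<Sum>s\<in>S. f s * \<nu> s)"
  using density unfolding dens_def by (intro tendsto_sum tendsto_mult tendsto_const) auto

text \<open>The error is multiplicative, so in an n-fold product it amounts to a factor e^{n
  \<eta>}, negligible on the exponential scale.\<close>

lemma eventually_dens_le:
  assumes "\<eta> > 0"
  shows "\<forall>\<^sub>F n in sequentially. \<forall>s\<in>S. dens n s \<le> \<nu> s * exp \<eta>"
proof (rule eventually_ball_finite[OF finite_S], rule ballI)
  fix s assume s: "s \<in> S"
  have "\<nu> s < \<nu> s * exp \<eta>" using \<nu>_pos[OF s] assms by simp
  from order_tendstoD(2)[OF density[OF s] this]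
  show "\<forall>\<^sub>F n in sequentially. dens n s \<le> \<nu> s * exp \<eta>"
    unfolding dens_def by eventually_elim simp
qed

text \<open>Markov's inequality for the product of the likelihood ratios p / \<nu>: it equals e^{n
  Ent p} on the event, while its expectation would be 1 for exact densities and is at most e^{n
  \<eta>} here.\<close>

lemma type_probability_le:
  assumes p: "distribution p" and n: "n \<ge> 1" and d: "\<And>s. s \<in> S \<Longrightarrow> dens n s \<le> \<nu> s * exp \<eta>"
  shows "sprob n (\<lambda>X. \<forall>s\<in>S. emp n X s = p s) \<le> exp (- real n * (Ent p - \<eta>))"
proof -
  define f where "f s = p s / \<nu> s" for s
  have f0: "0 \<le> f s" if "s \<in> S" for s using p \<nu>_pos[OF that] that by (auto simp: f_def distribution_def)
  have "sprob n (\<lambda>X. \<forall>s\<in>S. emp n X s = p s) \<le> sexp n (\<lambda>X. \<Prod>i<n. f (c (X i))) / exp (real n * Ent p)"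
  proof (rule sexp_Markov)
    fix X assume X: "X \<in> samples n"
    show "0 \<le> (\<Prod>i<n. f (c (X i)))" using samplesD[OF X] by (intro prod_nonneg) (auto intro!: f0 c_in)
    assume e: "\<forall>s\<in>S. emp n X s = p s"
    have "(\<Prod>i<n. f (c (X i))) = exp (real n * (\<Sum>s\<in>S. ln (f s) * emp n X s))"
    proof (rule prod_cells_eq[OF X])
      fix s assume s: "s \<in> S" "emp n X s \<noteq> 0"
      then show "0 < f s" using e \<nu>_pos[OF s(1)] emp_nonneg[of n X s] by (simp add: f_def less_le)
    qed
    also have "(\<Sum>s\<in>S. ln (f s) * emp n X s) = Ent p"
      unfolding Ent_def f_def using e by (intro sum.cong) auto
    finally show "exp (real n * Ent p) \<le> (\<Prod>i<n. f (c (X i)))" by simp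
  qed simp
  also have "\<dots> \<le> exp (real n * \<eta>) / exp (real n * Ent p)"
  proof (rule divide_right_mono)
    have "(\<Sum>s\<in>S. f s * dens n s) \<le> (\<Sum>s\<in>S. f s * (\<nu> s * exp \<eta>))"
      using d f0 by (intro sum_mono mult_left_mono) auto
    also have "\<dots> = (\<Sum>s\<in>S. p s * exp \<eta>)"
      using \<nu>_pos by (intro sum.cong) (auto simp: f_def less_le)
    also have "\<dots> = exp \<eta>" using p by (simp add: distribution_def sum_distrib_right[symmetric])
    finally have "(\<Sum>s\<in>S. f s * dens n s) ^ n \<le> exp \<eta> ^ n"
      using f0 by (intro power_mono sum_nonneg) (auto simp: dens_def intro!: mult_nonneg_nonneg divide_nonneg_nonneg sum_nonneg)
    then show "sexp n (\<lambda>X. \<Prod>i<n. f (c (X i))) \<le> exp (real n * \<eta>)"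
      by (simp add: sexp_cell_prod exp_of_nat_mult)
  qed simp
  finally show ?thesis by (simp add: exp_diff[symmetric] algebra_simps)
qed

text \<open>A union bound over the at most (n + 1)^{|S|} possible vectors of class counts, each
  estimated by the method of types. Half of \<eta> absorbs the deviation of the densities, the other
  half the polynomial factor.\<close>

lemma Sanov_upper:
  assumes R: "\<And>p. distribution p \<Longrightarrow> R p \<Longrightarrow> a \<le> Ent p" and \<eta>: "\<eta> > 0"
  shows "\<forall>\<^sub>F n in sequentially. sprob n (\<lambda>X. R (emp n X)) \<le> exp (- real n * (a - \<eta>))"
proof -
  define T where "T n = PiE S (\<lambda>_. {..n})" for n :: nat
  have fT: "finite (T n)" for n unfolding T_def by (intro finite_PiE finite_S) auto
  have cT: "real (card (T n)) = (real n + 1) ^ card S" for n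
    unfolding T_def by (subst card_PiE[OF finite_S]) (simp add: add.commute)
  have bd: "sprob n (\<lambda>X. R (emp n X)) \<le> (real n + 1) ^ card S * exp (- real n * (a - \<eta> / 2))"
    if n: "n \<ge> 1" and d: "\<forall>s\<in>S. dens n s \<le> \<nu> s * exp (\<eta> / 2)" for n
  proof -
    define Q where "Q N X \<longleftrightarrow> R (emp n X) \<and> (\<forall>s\<in>S. real (N s) = real n * emp n X s)" for N :: "'s \<Rightarrow> nat" and X
    have "sprob n (\<lambda>X. R (emp n X)) \<le> sprob n (\<lambda>X. \<exists>N\<in>T n. Q N X)"
    proof (rule sprob_mono)
      fix X assume X: "X \<in> samples n" and r: "R (emp n X)"
      define N where "N = restrict (\<lambda>s. card {i\<in>{..<n}. c (X i) = s}) S"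
      have "N \<in> T n"
        unfolding T_def N_def using card_mono[of "{..<n}" "{i\<in>{..<n}. c (X i) = s}" for s] by (auto intro!: restrict_PiE_iff[THEN iffD2])
      moreover have "Q N X"
      proof -
        have "(\<Sum>i<n. of_bool (c (X i) = s) :: real) = card {i\<in>{..<n}. c (X i) = s}" for s
          by (simp add: Int_def)
        then show ?thesis using r n by (simp add: Q_def N_def emp_def)
      qed
      ultimately show "\<exists>N\<in>T n. Q N X" by blast
    qed
    also have "\<dots> \<le> (\<Sum>N\<in>T n. sprob n (Q N))" by (rule sprob_Bex[OF fT])
    also have "\<dots> \<le> (\<Sum>N\<in>T n. exp (- real n * (a - \<eta> / 2)))"
    proof (rule sum_mono)
      fix N assume "N \<in> T n"
      show "sprob n (Q N) \<le> exp (- real n * (a - \<eta> / 2))"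
      \<comment> \<open>A count vector attained by no sample has probability 0. Otherwise a witness
        \<open>X0\<close> provides a genuine distribution satisfying \<open>R\<close>, and with it
        the entropy bound.\<close>
      proof (cases "\<exists>X\<in>samples n. Q N X")
        case False
        then have "sprob n (Q N) \<le> sprob n (\<lambda>_. False)" by (intro sprob_mono) auto
        also have "\<dots> = 0" by (simp add: sprob_def sexp_def)
        finally show ?thesis by (meson exp_ge_zero order_trans)
      next
        case True
        then obtain X0 where X0: "X0 \<in> samples n" "Q N X0" by auto
        have "sprob n (Q N) \<le> sprob n (\<lambda>X. \<forall>s\<in>S. emp n X s = emp n X0 s)"
        proof (rule sprob_mono, rule ballI)
          fix X s assume "Q N X" "s \<in> S"
          then have "real n * emp n X s = real n * emp n X0 s" using X0(2) by (auto simp: Q_def)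
          then show "emp n X s = emp n X0 s" using n by simp
        qed
        also have "\<dots> \<le> exp (- real n * (Ent (emp n X0) - \<eta> / 2))"
          using d by (intro type_probability_le distribution_emp X0 n) auto
        also have "\<dots> \<le> exp (- real n * (a - \<eta> / 2))"
          using R[OF distribution_emp[OF X0(1) n]] X0(2) by (auto simp: Q_def intro!: mult_left_mono)
        finally show ?thesis .
      qed
    qed
    finally show ?thesis by (simp add: cT)
  qed
  have "(\<lambda>n. (real n + 1) ^ card S * exp (- real n * (\<eta> / 2))) \<longlonglongrightarrow> 0"
    using \<eta> by real_asymp
  then have "\<forall>\<^sub>F n in sequentially. (real n + 1) ^ card S * exp (- real n * (\<eta> / 2)) < 1"
    by (rule order_tendstoD) simp
  moreover have "\<forall>\<^sub>F n in sequentially. \<forall>s\<in>S. dens n s \<le> \<nu> s * exp (\<eta> / 2)"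
    by (rule eventually_dens_le) (use \<eta> in simp)
  ultimately show ?thesis using eventually_ge_at_top[of 1]
  proof eventually_elim
    case (elim n)
    have "sprob n (\<lambda>X. R (emp n X)) \<le> (real n + 1) ^ card S * exp (- real n * (a - \<eta> / 2))"
      using bd elim by simp
    also have "exp (- real n * (a - \<eta> / 2)) = exp (- real n * (\<eta> / 2)) * exp (- real n * (a - \<eta>))"
      by (simp add: exp_add[symmetric] algebra_simps)
    also have "(real n + 1) ^ card S * \<dots> \<le> 1 * exp (- real n * (a - \<eta>))"
      unfolding mult.assoc[symmetric] using elim by (intro mult_right_mono) auto
    finally show ?case by simp
  qed
qed

section \<open>Lower bound by exponential tilting\<close>

lemma exp_le_quadratic:
  assumes "\<bar>\<theta>\<bar> \<le> (1::real)"
  shows "exp \<theta> \<le> 1 + \<theta> + \<theta>\<^sup>2"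
proof (cases "\<theta> \<ge> 0")
  case True
  then show ?thesis using exp_bound[of \<theta>] assms by simp
next
  case False
  define t where "t = - \<theta>"
  have t: "0 < t" "t \<le> 1" using False assms by (auto simp: t_def)
  \<comment> \<open>The product equals 1 + t^3.\<close>
  have "1 \<le> (1 + t) * (1 - t + t\<^sup>2)"
    using t by (simp add: algebra_simps power2_eq_square)
  also have "\<dots> \<le> exp t * (1 - t + t\<^sup>2)"
    using t by (intro mult_right_mono exp_ge_add_one_self) auto
  finally have "exp (- t) \<le> 1 - t + t\<^sup>2" by (simp add: exp_minus field_simps)
  then show ?thesis by (simp add: t_def)
qed

text \<open>The product of the ratios \<open>p / \<nu>\<close> is the density of the tilted law, for which this is a Chernoff bound.\<close>

lemma tilted_tail:
  assumes p: "distribution p" and s: "s \<in> S" and \<delta>: "0 < \<delta>" "\<delta> \<le> 1" and \<sigma>: "\<bar>\<sigma>\<bar> = 1"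
  shows "\<forall>\<^sub>F n in sequentially.
    sexp n (\<lambda>X. (\<Prod>i<n. p (c (X i)) / \<nu> (c (X i))) * of_bool (\<delta> \<le> \<sigma> * (emp n X s - p s)))
      \<le> exp (- real n * (\<delta>\<^sup>2 / 8))"
proof -
  \<comment> \<open>This t minimises t^2 - t \<delta>, with value -\<delta>^2 / 4. Half of that
    exponent is given up to pass from \<nu> to the densities at finite n. \<open>h\<close> is the
    factor contributed by one sample point: likelihood ratio times the exponential of its signed
    deviation, less the threshold.\<close>
  define t where "t = \<delta> / 2"
  define h where "h u = p u / \<nu> u * exp (\<sigma> * t * (of_bool (u = s) - p s) - t * \<delta>)" for u
  have ps: "0 \<le> p s" "p s \<le> 1"
    using p s member_le_sum[of s S p] finite_S by (auto simp: distribution_def)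
  have h0: "0 \<le> h u" if "u \<in> S" for u using p \<nu>_pos[OF that] that by (auto simp: h_def distribution_def)
  have "(\<Sum>u\<in>S. h u * \<nu> u) = exp (- \<sigma> * t * p s - t * \<delta>) * (\<Sum>u\<in>S. p u * (1 + (exp (\<sigma> * t) - 1) * of_bool (u = s)))"
    unfolding sum_distrib_left
  proof (intro sum.cong refl)
    fix u assume "u \<in> S"
    then have "\<nu> u \<noteq> 0" using \<nu>_pos by force
    then show "h u * \<nu> u = exp (- \<sigma> * t * p s - t * \<delta>) * (p u * (1 + (exp (\<sigma> * t) - 1) * of_bool (u = s)))"
      by (cases "u = s") (simp_all add: h_def exp_add[symmetric] algebra_simps)
  qed
  also have "(\<Sum>u\<in>S. p u * (1 + (exp (\<sigma> * t) - 1) * of_bool (u = s))) = 1 + (exp (\<sigma> * t) - 1) * p s"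
  proof -
    have "(\<Sum>u\<in>S. p u * (1 + (exp (\<sigma> * t) - 1) * of_bool (u = s)))
        = (\<Sum>u\<in>S. p u) + (\<Sum>u\<in>S. if u = s then (exp (\<sigma> * t) - 1) * p u else 0)"
      unfolding sum.distrib[symmetric] by (intro sum.cong) (auto simp: algebra_simps)
    then show ?thesis using p s finite_S by (simp add: distribution_def)
  qed
  also have "exp (- \<sigma> * t * p s - t * \<delta>) * \<dots> \<le> exp (- \<sigma> * t * p s - t * \<delta>) * exp ((exp (\<sigma> * t) - 1) * p s)"
    by (intro mult_left_mono) auto
  also have "\<dots> = exp ((exp (\<sigma> * t) - 1 - \<sigma> * t) * p s - t * \<delta>)"
    by (simp add: exp_add[symmetric] algebra_simps)
  also have "\<dots> \<le> exp (t\<^sup>2 - t * \<delta>)"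
  proof -
    have \<sigma>t: "\<bar>\<sigma> * t\<bar> \<le> 1" "(\<sigma> * t)\<^sup>2 = t\<^sup>2"
      using \<sigma> \<delta> by (auto simp: t_def abs_mult power_mult_distrib power2_eq_1_iff abs_if split: if_splits)
    have "(exp (\<sigma> * t) - 1 - \<sigma> * t) * p s \<le> t\<^sup>2 * p s"
      using exp_le_quadratic[OF \<sigma>t(1)] \<sigma>t(2) ps by (intro mult_right_mono) auto
    also have "\<dots> \<le> t\<^sup>2" using ps by (simp add: mult_left_le)
    finally show ?thesis by simp
  qed
  also have "t\<^sup>2 - t * \<delta> = - (\<delta>\<^sup>2 / 4)" by (simp add: t_def power2_eq_square)
  also have "exp (- (\<delta>\<^sup>2 / 4)) < exp (- (\<delta>\<^sup>2 / 8))" using \<delta> by simp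
  finally have lt: "(\<Sum>u\<in>S. h u * \<nu> u) < exp (- (\<delta>\<^sup>2 / 8))" .
  have "\<forall>\<^sub>F n in sequentially. (\<Sum>u\<in>S. h u * dens n u) < exp (- (\<delta>\<^sup>2 / 8))"
    by (rule order_tendstoD(2)[OF tendsto_cell_mean lt])
  then show ?thesis using eventually_ge_at_top[of 1]
  proof eventually_elim
    case (elim n)
    have "sexp n (\<lambda>X. (\<Prod>i<n. p (c (X i)) / \<nu> (c (X i))) * of_bool (\<delta> \<le> \<sigma> * (emp n X s - p s)))
       \<le> sexp n (\<lambda>X. \<Prod>i<n. h (c (X i)))"
    proof (rule sexp_mono)
      fix X assume X: "X \<in> samples n"
      have cS: "i < n \<Longrightarrow> c (X i) \<in> S" for i using samplesD[OF X] by (intro c_in) auto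
      have f0: "0 \<le> (\<Prod>i<n. p (c (X i)) / \<nu> (c (X i)))"
        using p \<nu>_pos cS by (intro prod_nonneg divide_nonneg_nonneg ballI) (auto simp: distribution_def intro: less_imp_le)
      have "(\<Prod>i<n. h (c (X i))) = (\<Prod>i<n. p (c (X i)) / \<nu> (c (X i))) *
          exp (\<Sum>i<n. \<sigma> * t * (of_bool (c (X i) = s) - p s) - t * \<delta>)"
        unfolding h_def prod.distrib by (simp add: exp_sum)
      also have "(\<Sum>i<n. \<sigma> * t * (of_bool (c (X i) = s) - p s) - t * \<delta>)
          = \<sigma> * t * ((\<Sum>i<n. of_bool (c (X i) = s)) - real n * p s) - real n * (t * \<delta>)"
        unfolding sum_subtractf sum_distrib_left[symmetric] by simp
      also have "(\<Sum>i<n. of_bool (c (X i) = s)) = real n * emp n X s"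
        using elim unfolding emp_def by simp
      also have "\<sigma> * t * (real n * emp n X s - real n * p s) - real n * (t * \<delta>)
          = real n * t * (\<sigma> * (emp n X s - p s) - \<delta>)" by (simp add: algebra_simps)
      finally have eq: "(\<Prod>i<n. h (c (X i))) = (\<Prod>i<n. p (c (X i)) / \<nu> (c (X i))) *
          exp (real n * t * (\<sigma> * (emp n X s - p s) - \<delta>))" .
      show "(\<Prod>i<n. p (c (X i)) / \<nu> (c (X i))) * of_bool (\<delta> \<le> \<sigma> * (emp n X s - p s)) \<le> (\<Prod>i<n. h (c (X i)))"
        unfolding eq using \<delta> by (intro mult_left_mono f0) (auto simp: t_def)
    qed
    also have "\<dots> = (\<Sum>u\<in>S. h u * dens n u) ^ n" by (rule sexp_cell_prod)
    also have "\<dots> \<le> exp (- (\<delta>\<^sup>2 / 8)) ^ n"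
      using elim h0 by (intro power_mono sum_nonneg) (auto simp: dens_def intro!: mult_nonneg_nonneg divide_nonneg_nonneg sum_nonneg)
    finally show ?case by (simp add: exp_of_nat_mult[symmetric])
  qed
qed

text \<open>Change of measure. Under the law with density W, the product of the ratios p / \<nu>,
  the empirical law concentrates near p; there W is at most e^{n (Ent p + \<eta>/4)}, so the
  original probability is at least the tilted mass divided by this.\<close>

lemma Sanov_lower:
  assumes p: "distribution p" and "\<delta> > 0" and \<eta>: "\<eta> > 0"
  shows "\<forall>\<^sub>F n in sequentially.
    exp (- real n * (Ent p + \<eta>)) \<le> sprob n (\<lambda>X. \<forall>s\<in>S. \<bar>emp n X s - p s\<bar> < \<delta>)"
proof -
  define f where "f s = p s / \<nu> s" for s
  define C where "C = (\<Sum>s\<in>S. \<bar>ln (f s)\<bar>)"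
  have C: "C \<ge> 0" by (simp add: C_def sum_nonneg)
  \<comment> \<open>Within distance d of p the exponent of W changes by at most d C \<le> \<eta>/4
    per sample point; the bound d \<le> 1 is required by the Chernoff estimate.\<close>
  define d where "d = min 1 (min \<delta> (\<eta> / (4 * (C + 1))))"
  have d: "0 < d" "d \<le> 1" "d \<le> \<delta>" using assms C by (auto simp: d_def)
  have "d * C \<le> \<eta> / (4 * (C + 1)) * (C + 1)"
    using C d \<eta> by (intro mult_mono) (auto simp: d_def)
  also have "\<dots> = \<eta> / 4" using C by (simp add: field_simps)
  finally have dC: "d * C \<le> \<eta> / 4" .
  have f0: "0 \<le> f s" if "s \<in> S" for s using p \<nu>_pos[OF that] that by (auto simp: f_def distribution_def)
  define G where "G n X \<longleftrightarrow> (\<forall>s\<in>S. \<bar>emp n X s - p s\<bar> < d)" for n X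
  define \<kappa> where "\<kappa> = d\<^sup>2 / 8"
  have \<kappa>: "\<kappa> > 0" using d by (simp add: \<kappa>_def)
  \<comment> \<open>The total tilted mass is not 1, only eventually at least e^{-n \<eta>'}, because
    the densities are merely convergent. With \<eta>' \<le> \<kappa>/2 the tails of order e^{-n
    \<kappa>} are eventually at most half of it.\<close>
  define \<eta>' where "\<eta>' = min (\<eta> / 4) (\<kappa> / 2)"
  have \<eta>': "\<eta>' > 0" "\<eta>' \<le> \<eta> / 4" "\<eta>' \<le> \<kappa> / 2" using \<eta> \<kappa> by (auto simp: \<eta>'_def)
  define W where "W n X = (\<Prod>i<n. f (c (X i)))" for n :: nat and X :: "nat \<Rightarrow> nat"
  have W0: "0 \<le> W n X" if X: "X \<in> samples n" for n X
    unfolding W_def using samplesD[OF X] by (intro prod_nonneg) (auto intro!: f0 c_in)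
  have up: "\<forall>\<^sub>F n in sequentially. \<forall>s\<in>S. sexp n (\<lambda>X. W n X * of_bool (d \<le> 1 * (emp n X s - p s))) \<le> exp (- real n * \<kappa>)"
    using tilted_tail[OF p _ d(1,2), of _ 1] unfolding W_def f_def \<kappa>_def
    by (intro eventually_ball_finite[OF finite_S]) auto
  have dn: "\<forall>\<^sub>F n in sequentially. \<forall>s\<in>S. sexp n (\<lambda>X. W n X * of_bool (d \<le> (-1) * (emp n X s - p s))) \<le> exp (- real n * \<kappa>)"
    unfolding W_def f_def \<kappa>_def
    by (intro eventually_ball_finite[OF finite_S] ballI tilted_tail[OF p _ d(1,2)]) auto
  have "(\<lambda>n. \<Sum>s\<in>S. f s * dens n s) \<longlonglongrightarrow> (\<Sum>s\<in>S. f s * \<nu> s)" by (rule tendsto_cell_mean)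
  also have "(\<Sum>s\<in>S. f s * \<nu> s) = (\<Sum>s\<in>S. p s)"
    using \<nu>_pos by (intro sum.cong) (auto simp: f_def less_le)
  also have "\<dots> = 1" using p by (simp add: distribution_def)
  finally have "\<forall>\<^sub>F n in sequentially. exp (- \<eta>') < (\<Sum>s\<in>S. f s * dens n s)"
    by (rule order_tendstoD(1)) (use \<eta>' in simp)
  moreover have "\<forall>\<^sub>F n in sequentially. 4 * real (card S) * exp (- real n * (\<kappa> / 2)) \<le> 1"
  proof -
    have "(\<lambda>n. 4 * real (card S) * exp (- real n * (\<kappa> / 2))) \<longlonglongrightarrow> 0" using \<kappa> by real_asymp
    then have "\<forall>\<^sub>F n in sequentially. 4 * real (card S) * exp (- real n * (\<kappa> / 2)) < 1"
      by (rule order_tendstoD) simp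
    then show ?thesis by eventually_elim simp
  qed
  moreover have "\<forall>\<^sub>F n in sequentially. exp (- real n * (\<eta> / 2)) \<le> 1 / 2"
  proof -
    have "(\<lambda>n. exp (- real n * (\<eta> / 2))) \<longlonglongrightarrow> 0" using \<eta> by real_asymp
    then have "\<forall>\<^sub>F n in sequentially. exp (- real n * (\<eta> / 2)) < 1 / 2" by (rule order_tendstoD) simp
    then show ?thesis by eventually_elim simp
  qed
  ultimately show ?thesis using up dn
  proof eventually_elim
    case (elim n)
    have "exp (- real n * \<eta>') = exp (- \<eta>') ^ n" by (simp add: exp_of_nat_mult[symmetric])
    also have "\<dots> \<le> (\<Sum>s\<in>S. f s * dens n s) ^ n" using elim(1) by (intro power_mono) auto
    also have "\<dots> = sexp n (W n)" unfolding W_def by (rule sexp_cell_prod[symmetric])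
    also have "\<dots> \<le> sexp n (\<lambda>X. W n X * of_bool (G n X) +
        (\<Sum>s\<in>S. W n X * of_bool (d \<le> 1 * (emp n X s - p s)) + W n X * of_bool (d \<le> (-1) * (emp n X s - p s))))"
    proof (rule sexp_mono)
      fix X assume X: "X \<in> samples n"
      let ?r = "\<lambda>s. W n X * of_bool (d \<le> 1 * (emp n X s - p s)) + W n X * of_bool (d \<le> (-1) * (emp n X s - p s))"
      have r0: "0 \<le> ?r s" for s using W0[OF X] by simp
      show "W n X \<le> W n X * of_bool (G n X) + (\<Sum>s\<in>S. ?r s)"
      proof (cases "G n X")
        case True
        then show ?thesis using sum_nonneg[of S ?r] r0 by simp
      next
        case False
        then obtain s where s: "s \<in> S" "d \<le> \<bar>emp n X s - p s\<bar>" unfolding G_def by (meson not_le)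
        have "W n X \<le> ?r s" using s(2) W0[OF X] by (auto simp: abs_if split: if_splits)
        also have "\<dots> \<le> (\<Sum>s\<in>S. ?r s)" using s(1) r0 finite_S by (intro member_le_sum[of s S ?r]) auto
        finally show ?thesis using False by simp
      qed
    qed
    also have "\<dots> \<le> sexp n (\<lambda>X. W n X * of_bool (G n X)) + (\<Sum>s\<in>S. exp (- real n * \<kappa>) + exp (- real n * \<kappa>))"
      unfolding sexp_add sexp_sum using elim(4,5) by (intro add_mono sum_mono order_refl) auto
    also have "(\<Sum>s\<in>S. exp (- real n * \<kappa>) + exp (- real n * \<kappa>))
        = 1/2 * (4 * real (card S) * exp (- real n * (\<kappa> / 2))) * exp (- real n * (\<kappa> / 2))"
      by (simp add: exp_add[symmetric])
    also have "\<dots> \<le> 1/2 * 1 * exp (- real n * \<eta>')"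
      using elim(2) mult_left_mono[OF \<eta>'(3), of "real n"] by (intro mult_mono) auto
    finally have lowW: "1/2 * exp (- real n * \<eta>') \<le> sexp n (\<lambda>X. W n X * of_bool (G n X))" by simp
    have "sexp n (\<lambda>X. W n X * of_bool (G n X)) \<le> sexp n (\<lambda>X. exp (real n * (Ent p + \<eta> / 4)) * of_bool (G n X))"
    proof (rule sexp_mono)
      fix X assume X: "X \<in> samples n"
      show "W n X * of_bool (G n X) \<le> exp (real n * (Ent p + \<eta> / 4)) * of_bool (G n X)"
      proof (cases "G n X")
        case True
        have "(\<Sum>s\<in>S. ln (f s) * emp n X s) = (\<Sum>s\<in>S. p s * ln (p s / \<nu> s)) + (\<Sum>s\<in>S. ln (f s) * (emp n X s - p s))"
          unfolding sum.distrib[symmetric] by (intro sum.cong) (auto simp: f_def algebra_simps)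
        also have "(\<Sum>s\<in>S. ln (f s) * (emp n X s - p s)) \<le> (\<Sum>s\<in>S. \<bar>ln (f s)\<bar> * d)"
        proof (rule sum_mono)
          fix s assume "s \<in> S"
          have "ln (f s) * (emp n X s - p s) \<le> \<bar>ln (f s) * (emp n X s - p s)\<bar>" by (rule abs_ge_self)
          also have "\<dots> \<le> \<bar>ln (f s)\<bar> * d"
            unfolding abs_mult using True \<open>s \<in> S\<close> by (intro mult_left_mono) (auto simp: G_def)
          finally show "ln (f s) * (emp n X s - p s) \<le> \<bar>ln (f s)\<bar> * d" .
        qed
        also have "\<dots> = d * C" by (simp add: C_def sum_distrib_left mult.commute)
        finally have "(\<Sum>s\<in>S. ln (f s) * emp n X s) \<le> Ent p + \<eta> / 4" using dC by (simp add: Ent_def)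
        then have "exp (real n * (\<Sum>s\<in>S. ln (f s) * emp n X s)) \<le> exp (real n * (Ent p + \<eta> / 4))"
          by (simp add: mult_left_mono)
        moreover have "W n X \<le> exp (real n * (\<Sum>s\<in>S. ln (f s) * emp n X s))"
          unfolding W_def by (rule prod_cells_le[OF X f0])
        ultimately have "W n X \<le> exp (real n * (Ent p + \<eta> / 4))" by (rule order_trans[rotated])
        then show ?thesis using True by simp
      qed simp
    qed
    also have "\<dots> = exp (real n * (Ent p + \<eta> / 4)) * sprob n (G n)" by (simp add: sexp_cmult sprob_def)
    finally have "1/2 * exp (- real n * \<eta>') \<le> exp (real n * (Ent p + \<eta> / 4)) * sprob n (G n)" using lowW by linarith
    then have "exp (- (real n * (Ent p + \<eta> / 4))) * (1/2 * exp (- real n * \<eta>'))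
        \<le> exp (- (real n * (Ent p + \<eta> / 4))) * (exp (real n * (Ent p + \<eta> / 4)) * sprob n (G n))"
      by (intro mult_left_mono) auto
    also have "\<dots> = sprob n (G n)" unfolding mult.assoc[symmetric] exp_add[symmetric] by simp
    finally have "exp (- real n * (Ent p + \<eta> / 4)) * (1/2 * exp (- real n * \<eta>')) \<le> sprob n (G n)"
      by simp
    moreover have "exp (- real n * (Ent p + \<eta>)) \<le> exp (- real n * (Ent p + \<eta> / 4)) * (1/2 * exp (- real n * \<eta>'))"
    proof -
      have "exp (- real n * (Ent p + \<eta>)) = exp (- real n * (Ent p + \<eta> / 4)) * (exp (- real n * (\<eta> / 2)) * exp (- real n * (\<eta> / 4)))"
        unfolding exp_add[symmetric] by (simp add: algebra_simps)
      also have "\<dots> \<le> exp (- real n * (Ent p + \<eta> / 4)) * (1 / 2 * exp (- real n * \<eta>'))"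
        using elim(3) mult_left_mono[OF \<eta>'(2), of "real n"] by (intro mult_left_mono mult_mono) auto
      finally show ?thesis .
    qed
    moreover have "sprob n (G n) \<le> sprob n (\<lambda>X. \<forall>s\<in>S. \<bar>emp n X s - p s\<bar> < \<delta>)"
      using d(3) by (intro sprob_mono) (auto simp: G_def intro: less_le_trans)
    ultimately show ?case by linarith
  qed
qed

end

section \<open>Digits of integers\<close>

text \<open>One enumeration of all primes, the q_i before the p_j, aligned with the 0-based digit
  positions of \<open>digit_pmf\<close>.\<close>

definition prm :: "nat \<Rightarrow> nat \<Rightarrow> nat" where
  "prm l k = (if k < nq l then qf l (k + 1) else pf l (k - nq l + 1))"

definition digit_values :: "nat \<Rightarrow> nat \<Rightarrow> nat set" where
  "digit_values l k = (if k < nq l then {0, 1, 2} else {0, 1})"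

definition int_digit :: "nat \<Rightarrow> nat \<Rightarrow> nat \<Rightarrow> nat" where
  "int_digit l x k =
     (if k < nq l then
        if prm l k ^ (bexp l (k + 1) + 1) dvd x then 2
        else if prm l k ^ bexp l (k + 1) dvd x then 1 else 0
      else if prm l k dvd x then 1 else 0)"

text \<open>Phrased for arbitrary digit sequences, so that integers and points of [0, 1] share it:
  for the former it decides whether the gcd is l, for the latter it is the condition in
  \<open>fker\<close>.\<close>

definition compatible :: "nat \<Rightarrow> (nat \<Rightarrow> nat) \<Rightarrow> (nat \<Rightarrow> nat) \<Rightarrow> bool" where
  "compatible l w w' \<longleftrightarrow> (\<forall>k<nq l. w k \<noteq> 0 \<and> w' k \<noteq> 0 \<and> \<not> (w k = 2 \<and> w' k = 2))
     \<and> (\<forall>k\<ge>nq l. \<not> (w k = 1 \<and> w' k = 1))"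

lemma prm_gamma:
  assumes "k < nq l"
  shows "prm l k \<in> prime_factors l"
proof -
  have "sorted_list_of_set (prime_factors l) ! k \<in> set (sorted_list_of_set (prime_factors l))"
    using assms by (intro nth_mem) (simp add: nq_def)
  then show ?thesis using assms by (simp add: prm_def qf_def)
qed

lemma infinite_other_primes: "infinite {p::nat. prime p \<and> p \<notin> prime_factors l}"
proof -
  have "infinite ({p::nat. prime p} - prime_factors l)"
    by (intro Diff_infinite_finite primes_infinite) simp
  then show ?thesis by (simp add: set_diff_eq)
qed

lemma prm_alpha:
  assumes "k \<ge> nq l"
  shows "prime (prm l k)" "prm l k \<notin> prime_factors l"
  using enumerate_in_set[OF infinite_other_primes, of l "k - nq l"] assms
  by (auto simp: prm_def pf_def)

lemma prime_prm: "prime (prm l k)"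
  using prm_gamma[of k l] prm_alpha(1)[of l k] by (cases "k < nq l") auto

lemma inj_prm: "inj (prm l)"
proof (rule injI)
  fix j k assume eq: "prm l j = prm l k"
  consider "j < nq l" "k < nq l" | "j \<ge> nq l" "k \<ge> nq l" | "j < nq l" "k \<ge> nq l" | "j \<ge> nq l" "k < nq l"
    by linarith
  then show "j = k"
  proof cases
    case 1
    then have "sorted_list_of_set (prime_factors l) ! j = sorted_list_of_set (prime_factors l) ! k"
      using eq by (simp add: prm_def qf_def)
    then show ?thesis using 1 by (subst (asm) nth_eq_iff_index_eq) (simp_all add: nq_def)
  next
    case 2
    define E where "E = enumerate {p::nat. prime p \<and> p \<notin> prime_factors l}"
    have mono: "a < b \<Longrightarrow> E a < E b" for a b
      unfolding E_def by (rule enumerate_mono[OF _ infinite_other_primes])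
    have "E (j - nq l) = E (k - nq l)"
      using eq 2 by (simp add: prm_def pf_def E_def)
    then have "j - nq l = k - nq l"
      using mono[of "j - nq l" "k - nq l"] mono[of "k - nq l" "j - nq l"]
      by (metis less_irrefl linorder_neqE_nat)
    then show ?thesis using 2 by simp
  next
    case 3 then show ?thesis using prm_gamma[of j l] prm_alpha(2)[of l k] eq by simp
  next
    case 4 then show ?thesis using prm_gamma[of k l] prm_alpha(2)[of l j] eq by simp
  qed
qed

lemma prm_surj_gamma:
  assumes "p \<in> prime_factors l"
  obtains k where "k < nq l" "p = prm l k"
proof -
  have "p \<in> set (sorted_list_of_set (prime_factors l))" using assms by simp
  then obtain k where "k < length (sorted_list_of_set (prime_factors l))"
    "sorted_list_of_set (prime_factors l) ! k = p" unfolding in_set_conv_nth by blast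
  then have "k < nq l" "p = prm l k" by (simp_all add: nq_def prm_def qf_def)
  then show ?thesis by (rule that)
qed

lemma prm_surj_alpha:
  assumes "prime p" "p \<notin> prime_factors l"
  obtains k where "k \<ge> nq l" "p = prm l k"
proof -
  have "p \<in> range (enumerate {p::nat. prime p \<and> p \<notin> prime_factors l})"
    using range_enumerate[OF infinite_other_primes, of l] assms by simp
  then obtain j where "p = enumerate {p. prime p \<and> p \<notin> prime_factors l} j" by auto
  then show ?thesis by (intro that[of "j + nq l"]) (auto simp: prm_def pf_def)
qed

lemma bexp_prm: "k < nq l \<Longrightarrow> bexp l (k + 1) = multiplicity (prm l k) l"
  by (simp add: bexp_def prm_def)

lemma int_digit_values: "int_digit l x k \<in> digit_values l k"
  by (simp add: int_digit_def digit_values_def)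

text \<open>Multiplicities are compared prime by prime. At q_i the gcd has the right multiplicity
  iff q_i^{\<beta>_i} divides both numbers and the next power does not divide both; at p_j the
  multiplicity must be 0.\<close>

lemma gcd_eq_iff_compatible:
  assumes "l > 1" "x \<ge> 1" "y \<ge> 1"
  shows "gcd x y = l \<longleftrightarrow> compatible l (int_digit l x) (int_digit l y)"
proof -
  define g where "g = gcd x y"
  have g: "g > 0" using assms by (simp add: g_def)
  have gd: "d dvd g \<longleftrightarrow> d dvd x \<and> d dvd y" for d by (simp add: g_def)
  have mg: "multiplicity (prm l k) g = b \<longleftrightarrow> prm l k ^ b dvd g \<and> \<not> prm l k ^ (b + 1) dvd g" for k b
  proof -
    have "\<not> is_unit (prm l k)" using prime_prm[of l k] by (meson not_prime_unit)
    then have "prm l k ^ b dvd g \<and> \<not> prm l k ^ (b + 1) dvd g \<longleftrightarrow>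
        b \<le> multiplicity (prm l k) g \<and> \<not> b + 1 \<le> multiplicity (prm l k) g"
      using power_dvd_iff_le_multiplicity[of g "prm l k"] g by (simp del: power_Suc)
    then show ?thesis by auto
  qed
  have gam: "multiplicity (prm l k) g = multiplicity (prm l k) l \<longleftrightarrow>
      int_digit l x k \<noteq> 0 \<and> int_digit l y k \<noteq> 0 \<and> \<not> (int_digit l x k = 2 \<and> int_digit l y k = 2)"
    if k: "k < nq l" for k
  proof -
    have up: "prm l k ^ (bexp l (k + 1) + 1) dvd z \<Longrightarrow> prm l k ^ bexp l (k + 1) dvd z" for z
      by (meson dvd_trans le_add1 le_imp_power_dvd)
    show ?thesis
      unfolding bexp_prm[OF k, symmetric] mg gd int_digit_def using k up[of x] up[of y] by auto
  qed
  have alp: "multiplicity (prm l k) g = multiplicity (prm l k) l \<longleftrightarrow> \<not> (int_digit l x k = 1 \<and> int_digit l y k = 1)"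
    if k: "k \<ge> nq l" for k
  proof -
    have "multiplicity (prm l k) l = 0"
      using prm_alpha[OF k] assms(1) by (intro not_dvd_imp_multiplicity_0) (auto simp: in_prime_factors_iff)
    then show ?thesis using mg[of k 0] k by (simp add: int_digit_def gd)
  qed
  have "g = l \<longleftrightarrow> (\<forall>k. multiplicity (prm l k) g = multiplicity (prm l k) l)"
  proof
    assume *: "\<forall>k. multiplicity (prm l k) g = multiplicity (prm l k) l"
    show "g = l"
    proof (rule multiplicity_eq_nat[OF g])
      fix p :: nat assume "prime p"
      then obtain k where "p = prm l k" using prm_surj_gamma prm_surj_alpha by metis
      then show "multiplicity p g = multiplicity p l" using * by simp
    qed (use assms in simp)
  qed simp
  also have "\<dots> \<longleftrightarrow> compatible l (int_digit l x) (int_digit l y)"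
    unfolding compatible_def using gam alp by (metis not_le)
  finally show ?thesis by (simp add: g_def)
qed

section \<open>Densities of digit patterns\<close>

text \<open>The case d = 0 is included: 0 divides no element of {1..n}, and
  \<open>n div 0 = 0\<close>.\<close>

lemma count_multiples: "(\<Sum>x\<in>{1..n}. of_bool (d dvd x)) = (real (n div d))"
proof -
  have "card {x \<in> {1..n}. d dvd x} = n div d"
  proof (cases "d = 0")
    case False
    have "{x \<in> {1..n}. d dvd x} = (\<lambda>i. d * i) ` {1..n div d}"
    proof (intro equalityI subsetI)
      fix x assume "x \<in> {x \<in> {1..n}. d dvd x}"
      then obtain i where "x = d * i" "1 \<le> x" "x \<le> n" by (auto elim: dvdE)
      then show "x \<in> (\<lambda>i. d * i) ` {1..n div d}"
        using False by (intro image_eqI[of _ _ i]) (auto simp: less_eq_div_iff_mult_less_eq mult.commute Suc_le_eq)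
    next
      fix x assume "x \<in> (\<lambda>i. d * i) ` {1..n div d}"
      then show "x \<in> {x \<in> {1..n}. d dvd x}"
        using False by (auto simp: less_eq_div_iff_mult_less_eq mult.commute Suc_le_eq)
    qed
    moreover have "inj_on (\<lambda>i. d * i) {1..n div d}" using False by (auto simp: inj_on_def)
    ultimately show ?thesis by (simp add: card_image)
  qed (auto simp: Suc_le_eq)
  then show ?thesis by (simp add: Int_def)
qed

lemma density_multiples: "(\<lambda>n. (\<Sum>x\<in>{1..n}. of_bool (d dvd x)) / real n) \<longlonglongrightarrow> 1 / real d"
proof (cases "d = 0")
  case False
  show ?thesis unfolding count_multiples
  proof (rule tendsto_sandwich)
    show "\<forall>\<^sub>F n in sequentially. 1 / real d - 1 / real n \<le> real (n div d) / real n"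
      using eventually_ge_at_top[of 1]
    proof eventually_elim
      case (elim n)
      have "real n / real d - 1 \<le> real (n div d)"
      proof -
        have "n < d + n div d * d" using False by (intro dividend_less_div_times) simp
        then have "real n < real (d + n div d * d)" by (simp only: of_nat_less_iff)
        then show ?thesis using False by (simp add: field_simps)
      qed
      then have "(real n / real d - 1) / real n \<le> real (n div d) / real n" by (intro divide_right_mono) auto
      then show ?case using elim by (simp add: diff_divide_distrib)
    qed
    show "\<forall>\<^sub>F n in sequentially. real (n div d) / real n \<le> 1 / real d"
      using eventually_ge_at_top[of 1]
    proof eventually_elim
      case (elim n)
      have "real (n div d) / real n \<le> (real n / real d) / real n"
        using of_nat_div_le_of_nat[of n d, where 'a=real] by (intro divide_right_mono) auto
      then show ?case using elim by simp
    qed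
    show "(\<lambda>n. 1 / real d - 1 / real n) \<longlonglongrightarrow> 1 / real d" by real_asymp
  qed simp
qed (simp add: count_multiples)

text \<open>Each digit condition has the form ``\<open>e1\<close> divides \<open>x\<close> but \<open>e2\<close> does not''; expanding the
  product of the indicators reduces everything to densities of multiples. A missing upper
  condition is coded by \<open>e2 = 0\<close>, which divides no positive integer and has \<open>1 / e2 = 0\<close>.\<close>

lemma density_digit_pattern_aux:
  fixes P :: "nat \<Rightarrow> nat"
  assumes "finite I" and cop: "\<And>j k. j \<noteq> k \<Longrightarrow> coprime (P j) (P k)"
    and e1: "\<And>k. k \<in> I \<Longrightarrow> \<exists>i. e1 k = P k ^ i" and e2: "\<And>k. k \<in> I \<Longrightarrow> e2 k = 0 \<or> (\<exists>i. e2 k = P k ^ i)"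
    and "d = 0 \<or> (\<forall>k\<in>I. coprime d (P k))"
  shows "(\<lambda>n. (\<Sum>x\<in>{1..n}. of_bool (d dvd x) * (\<Prod>k\<in>I. of_bool (e1 k dvd x) - of_bool (e2 k dvd x))) / real n)
    \<longlonglongrightarrow> 1 / real d * (\<Prod>k\<in>I. 1 / real (e1 k) - 1 / real (e2 k))"
  using assms(1) e1 e2 assms(5)
\<comment> \<open>d collects the moduli already chosen. Multiplying out the factor at k replaces d
  by d * \<open>e1 k\<close> or d * \<open>e2 k\<close>, which is again 0 or coprime to the
  remaining P j.\<close>
proof (induction I arbitrary: d rule: finite_induct)
  case empty
  then show ?case using density_multiples[of d] by simp
next
  case (insert k I)
  let ?f = "\<lambda>x. \<Prod>k\<in>I. of_bool (e1 k dvd x) - of_bool (e2 k dvd x) :: real"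
  let ?p = "\<Prod>k\<in>I. 1 / real (e1 k) - 1 / real (e2 k)"
  have step: "(\<lambda>n. (\<Sum>x\<in>{1..n}. of_bool (d dvd x) * of_bool (e dvd x) * ?f x) / real n) \<longlonglongrightarrow> 1 / real (d * e) * ?p"
    if e: "e = 0 \<or> (\<exists>i. e = P k ^ i)" for e
  proof -
    have "d * e = 0 \<or> (\<forall>j\<in>I. coprime (d * e) (P j))"
    proof (cases "d = 0 \<or> e = 0")
      case False
      then obtain i where "e = P k ^ i" using e by auto
      moreover have "k \<noteq> j" if "j \<in> I" for j using that insert.hyps(2) by auto
      ultimately show ?thesis using insert.prems(3) False cop by auto
    qed auto
    then have "(\<lambda>n. (\<Sum>x\<in>{1..n}. of_bool (d * e dvd x) * ?f x) / real n) \<longlonglongrightarrow> 1 / real (d * e) * ?p"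
      by (intro insert.IH insert.prems(1,2)) auto
    moreover have ind: "of_bool (d * e dvd x) = (of_bool (d dvd x) * of_bool (e dvd x) :: real)" if "x \<in> {1..n}" for x n
    proof (cases "d = 0 \<or> e = 0")
      case False
      then obtain i where "e = P k ^ i" using e by auto
      then have "coprime d e" using insert.prems(3) False by auto
      then have "d * e dvd x \<longleftrightarrow> d dvd x \<and> e dvd x"
        using divides_mult[of d x e] by (auto dest: dvd_mult_left dvd_mult_right)
      then show ?thesis by auto
    qed (use that in auto)
    then have "(\<Sum>x\<in>{1..n}. of_bool (d * e dvd x) * ?f x) = (\<Sum>x\<in>{1..n}. of_bool (d dvd x) * of_bool (e dvd x) * ?f x)" for n
      by (intro sum.cong refl arg_cong2[where f=times] ind)
    ultimately show ?thesis by (simp only:)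
  qed
  have "(\<lambda>n. (\<Sum>x\<in>{1..n}. of_bool (d dvd x) * of_bool (e1 k dvd x) * ?f x) / real n
        - (\<Sum>x\<in>{1..n}. of_bool (d dvd x) * of_bool (e2 k dvd x) * ?f x) / real n)
      \<longlonglongrightarrow> 1 / real (d * e1 k) * ?p - 1 / real (d * e2 k) * ?p"
    using insert.prems(1,2) by (intro tendsto_diff step) auto
  moreover have "(\<Sum>x\<in>{1..n}. of_bool (d dvd x) * of_bool (e1 k dvd x) * ?f x) / real n
        - (\<Sum>x\<in>{1..n}. of_bool (d dvd x) * of_bool (e2 k dvd x) * ?f x) / real n
      = (\<Sum>x\<in>{1..n}. of_bool (d dvd x) * (\<Prod>k\<in>insert k I. of_bool (e1 k dvd x) - of_bool (e2 k dvd x))) / real n" for n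
    unfolding diff_divide_distrib[symmetric] sum_subtractf[symmetric] using insert.hyps
    by (intro arg_cong2[where f="(/)"] sum.cong refl) (simp add: algebra_simps)
  moreover have "1 / real (d * e1 k) * ?p - 1 / real (d * e2 k) * ?p
      = 1 / real d * (\<Prod>k\<in>insert k I. 1 / real (e1 k) - 1 / real (e2 k))"
    using insert.hyps by (simp add: algebra_simps)
  ultimately show ?case by simp
qed

text \<open>With \<open>digit_hi\<close>, the moduli that express "the digit at k is v" as
  divisibility by the first but not by the second; the largest digit has no upper condition, hence
  the value 0 there.\<close>

definition digit_lo :: "nat \<Rightarrow> nat \<Rightarrow> nat \<Rightarrow> nat" where
  "digit_lo l k v = (if k < nq l then
     if v = 0 then 1 else if v = 1 then prm l k ^ bexp l (k + 1) else prm l k ^ (bexp l (k + 1) + 1)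
     else if v = 0 then 1 else prm l k)"

definition digit_hi :: "nat \<Rightarrow> nat \<Rightarrow> nat \<Rightarrow> nat" where
  "digit_hi l k v = (if k < nq l then
     if v = 0 then prm l k ^ bexp l (k + 1) else if v = 1 then prm l k ^ (bexp l (k + 1) + 1) else 0
     else if v = 0 then prm l k else 0)"

lemma int_digit_eq:
  assumes "v \<in> digit_values l k" "x \<ge> 1"
  shows "(of_bool (int_digit l x k = v) :: real) = of_bool (digit_lo l k v dvd x) - of_bool (digit_hi l k v dvd x)"
proof -
  have up: "prm l k ^ (bexp l (k + 1) + 1) dvd x \<Longrightarrow> prm l k ^ bexp l (k + 1) dvd x"
    by (meson dvd_trans le_add1 le_imp_power_dvd)
  show ?thesis
    using assms up by (auto simp: int_digit_def digit_lo_def digit_hi_def digit_values_def split: if_splits)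
qed

text \<open>The right-hand side is the density of the integers whose digit at k is v: this is the
  sense in which \<nu> models divisibility.\<close>

lemma pmf_digit:
  assumes "v \<in> digit_values l k" "l > 1"
  shows "pmf (digit_pmf l k) v = 1 / real (digit_lo l k v) - 1 / real (digit_hi l k v)"
proof (cases "k < nq l")
  case True
  define q where "q = real (prm l k)"
  define b where "b = bexp l (k + 1)"
  have q: "q \<ge> 2" using prime_ge_2_nat[OF prime_prm[of l k]] by (simp add: q_def)
  define f where "f d = (if d = 0 then 1 - q powi (- int b)
                        else if d = 1 then q powi (- int b) - q powi (- int b - 1)
                        else if d = 2 then q powi (- int b - 1) else 0)" for d :: nat
  have pw: "q powi (- int b) = 1 / q ^ b" "q powi (- int b - 1) = 1 / q ^ (b + 1)"
  proof -
    show "q powi (- int b) = 1 / q ^ b" by (simp add: power_int_minus inverse_eq_divide)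
    have "- int b - 1 = - int (b + 1)" by simp
    then show "q powi (- int b - 1) = 1 / q ^ (b + 1)" by (metis power_int_minus inverse_eq_divide power_int_of_nat)
  qed
  have f0: "0 \<le> f d" for d
  proof -
    have "1 \<le> q ^ b" "q ^ b \<le> q ^ (b + 1)" using q by (auto intro: one_le_power power_increasing)
    moreover have "q ^ b > 0" using q by simp
    ultimately show ?thesis unfolding f_def pw by (auto simp: field_simps)
  qed
  have "(\<integral>\<^sup>+d. ennreal (f d) \<partial>count_space UNIV) = (\<Sum>d\<in>{0,1,2}. ennreal (f d))"
    by (rule nn_integral_count_space') (auto simp: f_def)
  also have "\<dots> = ennreal (\<Sum>d\<in>{0,1,2}. f d)" using f0 by (intro sum_ennreal) auto
  also have "(\<Sum>d\<in>{0,1,2}. f d) = 1" by (simp add: f_def)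
  finally have "pmf (embed_pmf f) v = f v" using f0 by (intro pmf_embed_pmf) auto
  moreover have "digit_pmf l k = embed_pmf f"
    using True unfolding digit_pmf_def f_def[abs_def] q_def b_def by (simp only: Let_def prm_def if_True)
  ultimately have "pmf (digit_pmf l k) v = f v" by simp
  then show ?thesis unfolding f_def pw
    using True assms(1) by (auto simp: digit_values_def digit_lo_def digit_hi_def q_def b_def)
next
  case False
  define q where "q = real (prm l k)"
  have q: "q \<ge> 2" using prime_ge_2_nat[OF prime_prm[of l k]] by (simp add: q_def)
  have d: "digit_pmf l k = map_pmf (\<lambda>x. if x then 1 else 0) (bernoulli_pmf (1 / q))"
    using False by (simp add: digit_pmf_def q_def prm_def)
  have i: "inj (\<lambda>x. if x then 1 else (0::nat))" by (auto simp: inj_def split: if_splits)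
  have "pmf (digit_pmf l k) 1 = 1 / q" "pmf (digit_pmf l k) 0 = 1 - 1 / q"
    using pmf_map_inj'[OF i, of "bernoulli_pmf (1 / q)" True] pmf_map_inj'[OF i, of "bernoulli_pmf (1 / q)" False] q
    unfolding d by (simp_all add: field_simps)
  then show ?thesis using False assms(1) by (auto simp: digit_values_def digit_lo_def digit_hi_def q_def)
qed

text \<open>At a prime factor q of l the digit 0 has probability 1 - q^{-b}, which is positive
  because the multiplicity b of q in l is at least 1.\<close>

lemma digit_pmf_pos:
  assumes "v \<in> digit_values l k" "l > 1"
  shows "0 < pmf (digit_pmf l k) v"
proof -
  have p: "prm l k \<ge> 2" using prime_ge_2_nat[OF prime_prm[of l k]] .
  show ?thesis
  proof (cases "k < nq l")
    case True
    have "bexp l (k + 1) > 0"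
      using prm_gamma[OF True] unfolding bexp_prm[OF True] by (simp add: prime_factors_multiplicity)
    then have "1 < prm l k ^ bexp l (k + 1)" using p by (intro one_less_power) auto
    moreover have "prm l k ^ bexp l (k + 1) < prm l k ^ (bexp l (k + 1) + 1)" using p by simp
    ultimately have "1 < real (prm l k ^ bexp l (k + 1))"
      "real (prm l k ^ bexp l (k + 1)) < real (prm l k ^ (bexp l (k + 1) + 1))"
      by (simp_all only: of_nat_less_iff of_nat_1[symmetric, where 'a=real])
    then show ?thesis unfolding pmf_digit[OF assms]
      using assms(1) True by (auto simp: digit_values_def digit_lo_def digit_hi_def field_simps simp del: of_nat_power power_add)
  next
    case False
    then show ?thesis unfolding pmf_digit[OF assms]
      using assms(1) p by (auto simp: digit_values_def digit_lo_def digit_hi_def field_simps)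
  qed
qed

lemma digit_pmf_sum:
  assumes "l > 1"
  shows "(\<Sum>v\<in>digit_values l k. pmf (digit_pmf l k) v) = 1"
proof -
  have "(\<Sum>v\<in>digit_values l k. pmf (digit_pmf l k) v)
      = (\<Sum>v\<in>digit_values l k. 1 / real (digit_lo l k v) - 1 / real (digit_hi l k v))"
    by (intro sum.cong pmf_digit assms) auto
  also have "\<dots> = 1" by (auto simp: digit_values_def digit_lo_def digit_hi_def)
  finally show ?thesis .
qed

text \<open>Conditions at distinct primes are asymptotically independent, so the limiting law of the
  first L digits is the product law.\<close>

lemma density_digit_pattern:
  assumes "l > 1" "\<And>k. k < L \<Longrightarrow> s k \<in> digit_values l k"
  shows "(\<lambda>n. (\<Sum>x\<in>{1..n}. of_bool (\<forall>k<L. int_digit l x k = s k)) / real n)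
    \<longlonglongrightarrow> (\<Prod>k<L. pmf (digit_pmf l k) (s k))"
proof -
  have "(\<lambda>n. (\<Sum>x\<in>{1..n}. of_bool (1 dvd x) *
      (\<Prod>k<L. of_bool (digit_lo l k (s k) dvd x) - of_bool (digit_hi l k (s k) dvd x))) / real n)
    \<longlonglongrightarrow> 1 / real 1 * (\<Prod>k<L. 1 / real (digit_lo l k (s k)) - 1 / real (digit_hi l k (s k)))"
  proof (rule density_digit_pattern_aux[where P="prm l"])
    show "coprime (prm l j) (prm l k)" if "j \<noteq> k" for j k
      using that inj_prm[of l] prime_prm by (intro primes_coprime) (auto simp: inj_def)
    have "\<exists>i. 1 = prm l k ^ i" "\<exists>i. prm l k = prm l k ^ i" for k
      by (metis power_0) (metis power_one_right)
    then show "\<exists>i. digit_lo l k (s k) = prm l k ^ i" "digit_hi l k (s k) = 0 \<or> (\<exists>i. digit_hi l k (s k) = prm l k ^ i)" for k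
      by (auto simp: digit_lo_def digit_hi_def simp del: power_Suc power_add)
  qed auto
  moreover have "(\<Sum>x\<in>{1..n}. of_bool (1 dvd x) *
      (\<Prod>k<L. of_bool (digit_lo l k (s k) dvd x) - of_bool (digit_hi l k (s k) dvd x)))
      = (\<Sum>x\<in>{1..n}. of_bool (\<forall>k<L. int_digit l x k = s k) :: real)" for n
  proof (intro sum.cong refl)
    fix x assume "x \<in> {1..n}"
    then have "(\<Prod>k<L. of_bool (digit_lo l k (s k) dvd x) - of_bool (digit_hi l k (s k) dvd x) :: real)
        = (\<Prod>k<L. of_bool (int_digit l x k = s k))"
      using assms(2) by (intro prod.cong refl int_digit_eq[symmetric]) auto
    also have "\<dots> = of_bool (\<forall>k<L. int_digit l x k = s k)"
      by (cases "\<forall>k<L. int_digit l x k = s k") (auto intro!: prod_zero)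
    finally show "of_bool (1 dvd x) * (\<Prod>k<L. of_bool (digit_lo l k (s k) dvd x) - of_bool (digit_hi l k (s k) dvd x))
        = (of_bool (\<forall>k<L. int_digit l x k = s k) :: real)" by simp
  qed
  moreover have "(\<Prod>k<L. 1 / real (digit_lo l k (s k)) - 1 / real (digit_hi l k (s k))) = (\<Prod>k<L. pmf (digit_pmf l k) (s k))"
    using assms by (intro prod.cong refl pmf_digit[symmetric]) auto
  ultimately show ?thesis by simp
qed

section \<open>Sparsity of common large primes\<close>

lemma prm_ge: "k \<ge> nq l \<Longrightarrow> k - nq l \<le> prm l k"
  using le_enumerate[OF infinite_other_primes, of "k - nq l" l] by (simp add: prm_def pf_def)

text \<open>Comparison with the sum of 1/j^2, the j-th element of an infinite set of naturals being
  at least j.\<close>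

lemma summable_prm: "summable (\<lambda>k. 1 / real (prm l k) ^ 2)"
proof -
  \<comment> \<open>The shift skips the prime factors of l and also the first p_j, for which the
    bound by the index is 0.\<close>
  have "summable (\<lambda>j. 1 / real (prm l (j + (nq l + 1))) ^ 2)"
  proof (rule summable_comparison_test_ev)
    show "\<forall>\<^sub>F j in sequentially. norm (1 / real (prm l (j + (nq l + 1))) ^ 2) \<le> 1 / real (Suc j) ^ 2"
    proof (rule always_eventually, rule allI)
      fix j
      have "Suc j \<le> prm l (j + (nq l + 1))" using prm_ge[of l "j + (nq l + 1)"] by simp
      then have "real (Suc j) \<le> real (prm l (j + (nq l + 1)))" by (simp only: of_nat_le_iff)
      then have "1 / real (prm l (j + (nq l + 1))) ^ 2 \<le> 1 / real (Suc j) ^ 2"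
        by (intro divide_left_mono power_mono mult_pos_pos zero_less_power) auto
      then show "norm (1 / real (prm l (j + (nq l + 1))) ^ 2) \<le> 1 / real (Suc j) ^ 2" by simp
    qed
    show "summable (\<lambda>j. 1 / real (Suc j) ^ 2)"
      using inverse_power_summable[of 2, where 'a=real] by (subst summable_Suc_iff) (simp add: inverse_eq_divide)
  qed
  then show ?thesis by (subst (asm) summable_iff_shift[where f="\<lambda>k. 1 / real (prm l k) ^ 2"])
qed

lemma prm_tail:
  assumes "\<theta> > 0"
  obtains L where "L \<ge> nq l" "\<And>L'. L' \<ge> L \<Longrightarrow> (\<Sum>k. 1 / real (prm l (k + L')) ^ 2) \<le> \<theta>"
proof -
  from suminf_exist_split[OF assms summable_prm[of l]] obtain N
    where N: "\<And>n. n \<ge> N \<Longrightarrow> norm (\<Sum>k. 1 / real (prm l (k + n)) ^ 2) < \<theta>" by blast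
  show ?thesis using N by (intro that[of "max N (nq l)"]) (auto intro: less_imp_le dest!: abs_ge_self[THEN order.strict_trans1])
qed

text \<open>A union bound: a prime p has at most n/p multiples up to n, hence at most (n/p)^2 pairs
  of them. The estimate holds for every n, as the sparse pairs bound demands.\<close>

lemma sum_common_digit_le:
  assumes "L \<ge> nq l"
  shows "(\<Sum>x\<in>{1..n}. \<Sum>y\<in>{1..n}. of_bool (\<exists>k\<ge>L. int_digit l x k = 1 \<and> int_digit l y k = 1))
    \<le> (\<Sum>k. 1 / real (prm l (k + L)) ^ 2) * real n ^ 2"
proof -
  \<comment> \<open>Only primes up to n divide an element of {1..n}, which makes the union
    finite.\<close>
  define F where "F = {k. prm l (k + L) \<le> n}"
  have fF: "finite F"
  proof -
    have "finite (prm l -` {..n})" by (rule finite_vimageI[OF _ inj_prm]) simp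
    then have "finite ((\<lambda>k. k + L) -` (prm l -` {..n}))" by (rule finite_vimageI) simp
    then show ?thesis by (simp add: F_def vimage_def)
  qed
  have one: "(\<Sum>x\<in>{1..n}. of_bool (int_digit l x (k + L) = 1)) \<le> real n / real (prm l (k + L))" for k
  proof -
    have "(\<Sum>x\<in>{1..n}. of_bool (int_digit l x (k + L) = 1)) = real (n div prm l (k + L))"
      using assms by (subst count_multiples[symmetric], intro sum.cong) (auto simp: int_digit_def)
    then show ?thesis using of_nat_div_le_of_nat[of n "prm l (k + L)", where 'a=real] by simp
  qed
  have "(\<Sum>x\<in>{1..n}. \<Sum>y\<in>{1..n}. of_bool (\<exists>k\<ge>L. int_digit l x k = 1 \<and> int_digit l y k = 1))
      \<le> (\<Sum>x\<in>{1..n}. \<Sum>y\<in>{1..n}. \<Sum>k\<in>F. of_bool (int_digit l x (k + L) = 1) * of_bool (int_digit l y (k + L) = 1) :: real)"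
  proof (intro sum_mono)
    fix x y assume x: "x \<in> {1..n}" "y \<in> {1..n}"
    let ?t = "\<lambda>k. of_bool (int_digit l x (k + L) = 1) * of_bool (int_digit l y (k + L) = 1) :: real"
    show "of_bool (\<exists>k\<ge>L. int_digit l x k = 1 \<and> int_digit l y k = 1) \<le> (\<Sum>k\<in>F. ?t k)"
    proof (cases "\<exists>k\<ge>L. int_digit l x k = 1 \<and> int_digit l y k = 1")
      case True
      then obtain k0 where k0: "k0 \<ge> L" "int_digit l x k0 = 1" "int_digit l y k0 = 1" by blast
      define k where "k = k0 - L"
      have k: "int_digit l x (k + L) = 1" "int_digit l y (k + L) = 1" using k0 by (simp_all add: k_def)
      have "int_digit l x (k + L) = (if prm l (k + L) dvd x then 1 else 0)"
        using assms by (simp add: int_digit_def)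
      then have "prm l (k + L) dvd x" using k(1) by (cases "prm l (k + L) dvd x") simp_all
      moreover have "0 < x" "x \<le> n" using x by simp_all
      ultimately have "prm l (k + L) \<le> n" using dvd_imp_le[of "prm l (k + L)" x] by linarith
      then have "k \<in> F" by (simp add: F_def)
      then have "?t k \<le> (\<Sum>k\<in>F. ?t k)" using fF by (intro member_le_sum[of k F ?t]) auto
      moreover have "?t k = 1" using k by simp
      ultimately show ?thesis using True by simp
    next
      case False
      then have "of_bool (\<exists>k\<ge>L. int_digit l x k = 1 \<and> int_digit l y k = 1) = (0 :: real)"
        by (rule of_bool_eq_0_iff[THEN iffD2])
      moreover have "0 \<le> (\<Sum>k\<in>F. ?t k)" by (rule sum_nonneg) simp
      ultimately show ?thesis by (simp only:)
    qed
  qed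
  also have "\<dots> = (\<Sum>x\<in>{1..n}. \<Sum>k\<in>F. \<Sum>y\<in>{1..n}. of_bool (int_digit l x (k + L) = 1) * of_bool (int_digit l y (k + L) = 1))"
    by (rule sum.cong[OF refl], rule sum.swap)
  also have "\<dots> = (\<Sum>k\<in>F. \<Sum>x\<in>{1..n}. \<Sum>y\<in>{1..n}. of_bool (int_digit l x (k + L) = 1) * of_bool (int_digit l y (k + L) = 1))"
    by (rule sum.swap)
  also have "\<dots> = (\<Sum>k\<in>F. (\<Sum>x\<in>{1..n}. of_bool (int_digit l x (k + L) = 1)) * (\<Sum>y\<in>{1..n}. of_bool (int_digit l y (k + L) = 1)))"
    by (simp only: sum_product)
  also have "\<dots> \<le> (\<Sum>k\<in>F. (real n / real (prm l (k + L))) * (real n / real (prm l (k + L))))"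
    by (intro sum_mono mult_mono one) (auto intro!: sum_nonneg)
  also have "\<dots> = (\<Sum>k\<in>F. 1 / real (prm l (k + L)) ^ 2) * real n ^ 2"
    unfolding sum_distrib_right by (intro sum.cong) (auto simp: power2_eq_square)
  also have "\<dots> \<le> (\<Sum>k. 1 / real (prm l (k + L)) ^ 2) * real n ^ 2"
    using summable_iff_shift[of "\<lambda>k. 1 / real (prm l k) ^ 2" L] summable_prm[of l] fF
    by (intro mult_right_mono sum_le_suminf) simp_all
  finally show ?thesis .
qed

section \<open>Digits of real numbers\<close>

definition dig :: "nat \<Rightarrow> real \<Rightarrow> nat \<Rightarrow> nat" where
  "dig l u k = (if k < nq l then gdig u (k + 1) else adig (nq l) u (k - nq l + 1))"

lemma dig_values: "dig l u k \<in> digit_values l k"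
proof -
  have "nat (min 2 i) = 0 \<or> nat (min 2 i) = 1 \<or> nat (min 2 i) = 2" "nat (min 1 i) = 0 \<or> nat (min 1 i) = 1" for i :: int
    by linarith+
  then show ?thesis by (simp add: dig_def gdig_def adig_def digit_values_def)
qed

text \<open>Purely a change of indexing: \<open>fker\<close> counts digits from 1 in two families,
  \<open>dig\<close> from 0 in one sequence.\<close>

lemma fker_compatible: "fker l u v = of_bool (compatible l (dig l u) (dig l v))"
proof -
  have g: "(\<forall>i\<in>{1..nq l}. P i) \<longleftrightarrow> (\<forall>k<nq l. P (k + 1))" for P
  proof (intro iffI ballI allI impI)
    fix i assume *: "\<forall>k<nq l. P (k + 1)" "i \<in> {1..nq l}"
    then have "i - 1 < nq l" "i - 1 + 1 = i" by auto
    then show "P i" using *(1) by metis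
  qed simp
  have a: "(\<exists>j\<ge>1. P j) \<longleftrightarrow> (\<exists>k\<ge>nq l. P (k - nq l + 1))" for P :: "nat \<Rightarrow> bool"
  proof
    assume "\<exists>j\<ge>1. P j"
    then obtain j where "j \<ge> 1" "P j" by blast
    then show "\<exists>k\<ge>nq l. P (k - nq l + 1)" by (intro exI[of _ "nq l + (j - 1)"]) simp
  next
    assume "\<exists>k\<ge>nq l. P (k - nq l + 1)"
    then obtain k where "P (k - nq l + 1)" by blast
    then show "\<exists>j\<ge>1. P j" by (intro exI[of _ "k - nq l + 1"]) simp
  qed
  have b: "(\<exists>i\<in>{1..nq l}. P i) \<longleftrightarrow> (\<exists>k<nq l. P (k + 1))" for P
    using g[of "\<lambda>i. \<not> P i"] by blast
  have d: "k < nq l \<Longrightarrow> dig l w k = gdig w (k + 1)" "k \<ge> nq l \<Longrightarrow> dig l w k = adig (nq l) w (k - nq l + 1)" for w k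
    by (simp_all add: dig_def)
  have "compatible l (dig l u) (dig l v) \<longleftrightarrow>
      (\<forall>k<nq l. gdig u (k + 1) \<noteq> 0 \<and> gdig v (k + 1) \<noteq> 0) \<and>
      \<not> (\<exists>k<nq l. gdig u (k + 1) = 2 \<and> gdig v (k + 1) = 2) \<and>
      \<not> (\<exists>k\<ge>nq l. adig (nq l) u (k - nq l + 1) = 1 \<and> adig (nq l) v (k - nq l + 1) = 1)"
    (is "_ \<longleftrightarrow> ?R")
  proof -
    have "compatible l (dig l u) (dig l v) \<longleftrightarrow>
        (\<forall>k<nq l. gdig u (k + 1) \<noteq> 0 \<and> gdig v (k + 1) \<noteq> 0 \<and> \<not> (gdig u (k + 1) = 2 \<and> gdig v (k + 1) = 2)) \<and>
        (\<forall>k\<ge>nq l. \<not> (adig (nq l) u (k - nq l + 1) = 1 \<and> adig (nq l) v (k - nq l + 1) = 1))"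
      unfolding compatible_def by (simp only: d cong: imp_cong)
    also have "\<dots> \<longleftrightarrow> ?R" by blast
    finally show ?thesis .
  qed
  then show ?thesis
    unfolding fker_def g a b of_bool_def by (simp only:)
qed

lemma tern_rem_measurable [measurable]: "(\<lambda>u. tern_rem u i) \<in> borel_measurable borel"
  by (induction i) simp_all

lemma bin_rem_measurable [measurable]: "(\<lambda>u. bin_rem m u i) \<in> borel_measurable borel"
  by (induction i) simp_all

lemma dig_measurable [measurable]: "(\<lambda>u. dig l u k) \<in> measurable borel (count_space UNIV)"
  unfolding dig_def gdig_def adig_def by measurable

section \<open>The product measure on digit sequences\<close>

lemma sets_digit_space: "sets (digit_space l) = sets (\<Pi>\<^sub>M k\<in>UNIV. count_space UNIV)"
  unfolding digit_space_def by (intro sets_PiM_cong) auto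

lemma space_digit_space [simp]: "space (digit_space l) = UNIV"
  by (simp add: digit_space_def space_PiM PiE_UNIV_domain)

lemma digit_component_measurable [measurable]: "(\<lambda>w. w k) \<in> measurable (digit_space l) (count_space UNIV)"
  unfolding measurable_cong_sets[OF sets_digit_space refl] by measurable

lemma digits_to_real_measurable [measurable]: "digits_to_real m \<in> borel_measurable (digit_space l)"
  unfolding digits_to_real_def[abs_def] by measurable

lemma prob_digit_space: "prob_space (digit_space l)"
  unfolding digit_space_def by (intro prob_space_PiM measure_pmf.prob_space_axioms)

lemma emeasure_digit_space:
  assumes "finite J"
  shows "emeasure (digit_space l) {w. \<forall>k\<in>J. w k \<in> X k} = (\<Prod>k\<in>J. emeasure (digit_pmf l k) (X k))"
proof -
  interpret product_prob_space "\<lambda>k. measure_pmf (digit_pmf l k)" UNIV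
    by (simp add: product_prob_space_def product_sigma_finite_def product_prob_space_axioms_def
        measure_pmf.sigma_finite_measure_axioms measure_pmf.prob_space_axioms)
  show ?thesis
    using emeasure_PiM_Collect[OF subset_UNIV assms, of X] by (simp add: digit_space_def space_PiM PiE_UNIV_domain)
qed

lemma digit_pmf_values:
  assumes "l > 1"
  shows "set_pmf (digit_pmf l k) \<subseteq> digit_values l k"
proof -
  have f: "finite (digit_values l k)" by (simp add: digit_values_def)
  have "measure (measure_pmf (digit_pmf l k)) (digit_values l k) = 1"
    unfolding measure_measure_pmf_finite[OF f] by (rule digit_pmf_sum[OF assms])
  then have "AE v in measure_pmf (digit_pmf l k). v \<in> digit_values l k"
    by (subst (asm) measure_pmf.prob_eq_1) auto
  then show ?thesis by (auto simp: AE_measure_pmf_iff)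
qed

text \<open>Excludes sequences whose binary digits are eventually all 1; from these the greedy
  algorithm in general returns the other expansion of the same number.\<close>

definition regular_digits :: "nat \<Rightarrow> (nat \<Rightarrow> nat) \<Rightarrow> bool" where
  "regular_digits l w \<longleftrightarrow> (\<forall>k. w k \<in> digit_values l k) \<and> (\<forall>k\<ge>nq l. \<exists>i\<ge>k. w i = 0)"

text \<open>A binary digit is 1 with probability 1/p \<le> 1/2, so N consecutive ones starting at k
  have probability at most 2^{-N}.\<close>

lemma AE_regular_digits:
  assumes "l > 1"
  shows "AE w in digit_space l. regular_digits l w"
proof -
  interpret prob_space "digit_space l" by (rule prob_digit_space)
  have "AE w in digit_space l. w k \<in> digit_values l k" for k
  proof (rule AE_I')
    have "emeasure (digit_space l) {w. \<forall>j\<in>{k}. w j \<in> - digit_values l k} = emeasure (digit_pmf l k) (- digit_values l k)"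
      by (subst emeasure_digit_space) auto
    also have "\<dots> = 0" using digit_pmf_values[OF assms, of k] by (auto simp: measure_pmf.emeasure_eq_measure measure_pmf_zero_iff)
    finally have "emeasure (digit_space l) {w \<in> space (digit_space l). \<not> w k \<in> digit_values l k} = 0" by simp
    moreover have "{w \<in> space (digit_space l). \<not> w k \<in> digit_values l k} \<in> sets (digit_space l)" by measurable
    ultimately show "{w \<in> space (digit_space l). \<not> w k \<in> digit_values l k} \<in> null_sets (digit_space l)"
      by (rule null_setsI)
  qed auto
  moreover have "AE w in digit_space l. \<exists>i\<ge>k. w i = 0" if k: "k \<ge> nq l" for k
  proof (rule AE_I')
    let ?B = "{w \<in> space (digit_space l). \<not> (\<exists>i\<ge>k. w i = 0)}"
    have le: "emeasure (digit_space l) ?B \<le> ennreal ((1 / 2) ^ N)" for N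
    proof -
      have "emeasure (digit_space l) ?B \<le> emeasure (digit_space l) {w. \<forall>i\<in>{k..<k+N}. w i \<in> - {0}}"
      proof (rule emeasure_mono)
        have "{w \<in> space (digit_space l). \<forall>i\<in>{k..<k+N}. w i \<noteq> 0} \<in> sets (digit_space l)" by measurable
        then show "{w. \<forall>i\<in>{k..<k+N}. w i \<in> - {0}} \<in> sets (digit_space l)" by simp
      qed auto
      also have "\<dots> = (\<Prod>i\<in>{k..<k+N}. emeasure (digit_pmf l i) (- {0}))"
        by (rule emeasure_digit_space) simp
      also have "\<dots> = ennreal (\<Prod>i\<in>{k..<k+N}. measure (digit_pmf l i) (- {0}))"
        unfolding measure_pmf.emeasure_eq_measure by (rule prod_ennreal) simp
      also have "\<dots> \<le> ennreal (\<Prod>i\<in>{k..<k+N}. 1 / 2)"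
      proof (rule ennreal_leI, rule prod_mono, rule conjI)
        fix i assume i: "i \<in> {k..<k+N}"
        have "measure (digit_pmf l i) (- {0}) = 1 - pmf (digit_pmf l i) 0"
          using measure_pmf.prob_compl[of "{0}" "digit_pmf l i"] by (simp add: measure_pmf_single Compl_eq_Diff_UNIV)
        also have "\<dots> = 1 / real (prm l i)"
          using pmf_digit[of 0 l i] assms i k
          by (simp add: digit_values_def digit_lo_def digit_hi_def)
        also have "\<dots> \<le> 1 / 2" using prime_ge_2_nat[OF prime_prm[of l i]] by (simp add: field_simps)
        finally show "measure (digit_pmf l i) (- {0}) \<le> 1 / 2" .
      qed simp
      also have "(\<Prod>i\<in>{k..<k+N}. 1 / 2) = ((1 / 2) ^ N :: real)"
        by (simp only: prod_constant card_atLeastLessThan diff_add_inverse)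
      finally show ?thesis .
    qed
    have "(\<lambda>N. ennreal ((1 / 2) ^ N)) \<longlonglongrightarrow> ennreal 0"
      by (intro tendsto_ennrealI LIMSEQ_power_zero) simp
    then have "emeasure (digit_space l) ?B \<le> ennreal 0"
      by (rule LIMSEQ_le_const) (use le in blast)
    then have "emeasure (digit_space l) ?B = 0" by simp
    moreover have "?B \<in> sets (digit_space l)" by measurable
    ultimately show "?B \<in> null_sets (digit_space l)" by (rule null_setsI)
  qed auto
  ultimately show ?thesis
    unfolding regular_digits_def by (simp add: AE_all_countable AE_conj_iff)
qed

text \<open>For regular \<open>w\<close> all the remainders of the greedy expansion stay in \<open>[0, 1)\<close>, so that
  the greedy algorithm reads off \<open>w\<close>.\<close>

lemma dig_digits_to_real:
  assumes "regular_digits l w"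
  shows "dig l (digits_to_real (nq l) w) = w" "digits_to_real (nq l) w \<in> {0..1}"
proof -
  define m where "m = nq l"
  define u where "u = digits_to_real m w"
  have w3: "w k \<le> 2" if "k < m" for k using assms that by (auto simp: regular_digits_def digit_values_def m_def dest!: spec[of _ k])
  have w2: "w k \<le> 1" if "k \<ge> m" for k
    using assms that by (auto simp: regular_digits_def digit_values_def m_def dest!: spec[of _ k])
  \<comment> \<open>\<open>a j\<close> is the value that \<open>bin_rem\<close> is shown to have
    after j binary digits; \<open>t i\<close> below plays the same role for
    \<open>tern_rem\<close>.\<close>
  define a where "a j = (\<Sum>i. real (w (m + j + i)) / 2 ^ (i + 1))" for j
  have le: "real (w (m + j + i)) / 2 ^ (i + 1) \<le> (1 / 2) ^ Suc i" for i j
    using w2[of "m + j + i"] by (simp add: power_divide divide_right_mono)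
  have gs: "(\<lambda>i. (1 / 2 :: real) ^ Suc i) sums 1" by (rule power_half_series)
  have sm: "summable (\<lambda>i. real (w (m + j + i)) / 2 ^ (i + 1))" for j
    by (rule summable_comparison_test'[OF sums_summable[OF gs], of 0]) (use le in simp)
  have a1: "a j \<le> 1" for j
    using suminf_le[OF le sm sums_summable[OF gs], of j] sums_unique[OF gs] by (simp only: a_def)
  have a0: "0 \<le> a j" for j unfolding a_def by (intro suminf_nonneg sm) simp
  have astep: "2 * a j = real (w (m + j)) + a (Suc j)" for j
  proof -
    have "a j = (\<Sum>i. real (w (m + j + Suc i)) / 2 ^ (Suc i + 1)) + real (w (m + j)) / 2"
      unfolding a_def using suminf_split_head[OF sm[of j]] by simp
    also have "(\<Sum>i. real (w (m + j + Suc i)) / 2 ^ (Suc i + 1)) = (\<Sum>i. (1/2) * (real (w (m + Suc j + i)) / 2 ^ (i + 1)))"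
      by (intro suminf_cong) simp
    also have "\<dots> = (1/2) * a (Suc j)" unfolding a_def by (rule suminf_mult[OF sm])
    finally show ?thesis by simp
  qed
  \<comment> \<open>A zero digit at i forces a (i - m) \<le> 1/2. Strictness then travels backwards:
    a digit at most 1 and a tail below 1 give 2 a < 2.\<close>
  have alt: "a j < 1" for j
  proof -
    obtain i where i: "i \<ge> m + j" "w i = 0"
      using assms by (auto simp: regular_digits_def m_def dest!: spec[of _ "m + j"])
    have "a (i - m) < 1" using astep[of "i - m"] a1[of "Suc (i - m)"] i by simp
    note last = this
    have "j \<le> i - m" using i by simp
    then show ?thesis
    proof (induction rule: inc_induct)
      case base show ?case by (rule last)
    next
      case (step n)
      have "real (w (m + n)) \<le> 1" using w2[of "m + n"] by simp
      then show ?case using astep[of n] step by linarith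
    qed
  qed
  define t where "t i = (\<Sum>r<m - i. real (w (i + r)) / 3 ^ (r + 1)) + a 0 / 3 ^ (m - i)" for i
  have t0: "t 0 = u" unfolding t_def u_def digits_to_real_def a_def by simp
  have tm: "t m = a 0" by (simp add: t_def)
  have tstep: "3 * t i = real (w i) + t (Suc i)" if "i < m" for i
  proof -
    have m: "m - i = Suc (m - Suc i)" using that by simp
    show ?thesis
      unfolding t_def m sum.lessThan_Suc_shift by (simp add: sum_distrib_left algebra_simps)
  qed
  have tpos: "0 \<le> t i" for i unfolding t_def using a0 by (intro add_nonneg_nonneg sum_nonneg) auto
  have tlt: "t i < 1" if "i \<le> m" for i
    using that
  proof (induction rule: inc_induct)
    case base show ?case using tm alt by simp
  next
    case (step n)
    have "real (w n) \<le> 2" using w3[of n] step by simp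
    then show ?case using tstep[of n] step by linarith
  qed
  have fl3: "\<lfloor>3 * t i\<rfloor> = int (w i)" if "i < m" for i
    using tstep[OF that] tpos[of "Suc i"] tlt[of "Suc i"] that by (simp add: floor_eq_iff)
  have tr: "tern_rem u i = t i" if "i \<le> m" for i
    using that
  proof (induction i)
    case (Suc i)
    have "tern_rem u (Suc i) = 3 * t i - min 2 (of_int \<lfloor>3 * t i\<rfloor>)" using Suc by simp
    also have "\<dots> = t (Suc i)" using fl3[of i] tstep[of i] w3[of i] Suc.prems by simp
    finally show ?case .
  qed (simp add: t0)
  have fl2: "\<lfloor>2 * a j\<rfloor> = int (w (m + j))" for j
    using astep[of j] a0[of "Suc j"] alt[of "Suc j"] by (simp add: floor_eq_iff)
  have br: "bin_rem m u j = a j" for j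
  proof (induction j)
    case (Suc j)
    have "bin_rem m u (Suc j) = 2 * a j - min 1 (of_int \<lfloor>2 * a j\<rfloor>)" using Suc by simp
    also have "\<dots> = a (Suc j)" using fl2[of j] astep[of j] w2[of "m + j"] by simp
    finally show ?case .
  qed (simp add: tr tm)
  show "dig l (digits_to_real (nq l) w) = w"
  proof
    fix k
    have "dig l u k = w k"
    proof (cases "k < m")
      case True
      then show ?thesis using fl3[OF True] w3[OF True] by (simp add: dig_def m_def[symmetric] gdig_def tr)
    next
      case False
      then show ?thesis using fl2[of "k - m"] w2[of k] by (simp add: dig_def m_def[symmetric] adig_def br)
    qed
    then show "dig l (digits_to_real (nq l) w) k = w k" by (simp add: u_def m_def)
  qed
  show "digits_to_real (nq l) w \<in> {0..1}" using tpos[of 0] tlt[of 0] t0 by (simp add: u_def m_def)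
qed

section \<open>The measure \<open>\<nu>\<close>\<close>

lemma sets_nu [simp]: "sets (nu l) = sets borel" and space_nu [simp]: "space (nu l) = UNIV"
  by (simp_all add: nu_def)

lemma prob_nu: "prob_space (nu l)"
  unfolding nu_def by (intro prob_space.prob_space_distr prob_digit_space digits_to_real_measurable)

text \<open>Almost surely the greedy digits invert \<open>digits_to_real\<close>, so a digit event
  has the same probability for u as for the underlying sequence.\<close>

lemma emeasure_nu_Collect:
  assumes "l > 1" and P: "{u. P (dig l u)} \<in> sets borel" "{w. P w} \<in> sets (digit_space l)"
  shows "emeasure (nu l) {u. P (dig l u)} = emeasure (digit_space l) {w. P w}"
proof -
  have m: "digits_to_real (nq l) -` {u. P (dig l u)} \<inter> space (digit_space l) \<in> sets (digit_space l)"
    by (rule measurable_sets[OF digits_to_real_measurable P(1)])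
  have "emeasure (nu l) {u. P (dig l u)} = emeasure (digit_space l) (digits_to_real (nq l) -` {u. P (dig l u)} \<inter> space (digit_space l))"
    unfolding nu_def by (rule emeasure_distr[OF digits_to_real_measurable P(1)])
  also have "\<dots> = emeasure (digit_space l) {w. P w}"
  proof (rule emeasure_eq_AE[OF _ m P(2)])
    show "AE w in digit_space l. (w \<in> digits_to_real (nq l) -` {u. P (dig l u)} \<inter> space (digit_space l)) = (w \<in> {w. P w})"
      using AE_regular_digits[OF assms(1)] by eventually_elim (simp add: dig_digits_to_real(1))
  qed
  finally show ?thesis .
qed

lemma nu_unit_interval:
  assumes "l > 1"
  shows "emeasure (nu l) (- {0..1}) = 0"
proof -
  have "AE w in digit_space l. digits_to_real (nq l) w \<in> {0..1}"
    using AE_regular_digits[OF assms] by eventually_elim (rule dig_digits_to_real(2))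
  then have "AE u in nu l. u \<in> {0..1}"
    unfolding nu_def by (subst AE_distr_iff[OF digits_to_real_measurable]) simp_all
  then have "emeasure (nu l) {u \<in> space (nu l). u \<notin> {0..1}} = 0"
    by (subst AE_iff_measurable[symmetric, OF _ refl]) simp_all
  moreover have "{u \<in> space (nu l). u \<notin> {0..1}} = - {0..1}" by auto
  ultimately show ?thesis by simp
qed

lemma digit_event_measurable:
  "{u. \<forall>k<L. dig l u k = s k} \<in> sets borel" "{w. \<forall>k<L. w k = s k} \<in> sets (digit_space l')"
  "{u. dig l u k = v} \<in> sets borel" "{w. w k = v} \<in> sets (digit_space l')"
proof -
  have "{u \<in> space borel. \<forall>k<L. dig l u k = s k} \<in> sets borel" by measurable
  then show "{u. \<forall>k<L. dig l u k = s k} \<in> sets borel" by simp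
  have "{u \<in> space borel. dig l u k = v} \<in> sets borel" by measurable
  then show "{u. dig l u k = v} \<in> sets borel" by simp
  have "{w \<in> space (digit_space l'). \<forall>k<L. w k = s k} \<in> sets (digit_space l')" by measurable
  then show "{w. \<forall>k<L. w k = s k} \<in> sets (digit_space l')" by simp
  have "{w \<in> space (digit_space l'). w k = v} \<in> sets (digit_space l')" by measurable
  then show "{w. w k = v} \<in> sets (digit_space l')" by simp
qed

lemma nu_pattern:
  assumes "l > 1"
  shows "measure (nu l) {u. \<forall>k<L. dig l u k = s k} = (\<Prod>k<L. pmf (digit_pmf l k) (s k))"
proof -
  have "emeasure (nu l) {u. \<forall>k<L. dig l u k = s k} = emeasure (digit_space l) {w. \<forall>k\<in>{..<L}. w k \<in> {s k}}"
    using emeasure_nu_Collect[OF assms digit_event_measurable(1,2)] by (simp add: Ball_def)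
  also have "\<dots> = (\<Prod>k<L. ennreal (pmf (digit_pmf l k) (s k)))"
    by (subst emeasure_digit_space) (auto simp: emeasure_pmf_single)
  also have "\<dots> = ennreal (\<Prod>k<L. pmf (digit_pmf l k) (s k))" by (intro prod_ennreal) auto
  finally show ?thesis by (simp add: measure_def prod_nonneg)
qed

lemma nu_alpha:
  assumes "l > 1" "k \<ge> nq l"
  shows "emeasure (nu l) {u. dig l u k = 1} = ennreal (1 / real (prm l k))"
proof -
  have "emeasure (nu l) {u. dig l u k = 1} = emeasure (digit_space l) {w. \<forall>j\<in>{k}. w j \<in> {1}}"
    using emeasure_nu_Collect[OF assms(1) digit_event_measurable(3,4)] by simp
  also have "\<dots> = ennreal (pmf (digit_pmf l k) 1)"
    by (subst emeasure_digit_space) (auto simp: emeasure_pmf_single)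
  also have "pmf (digit_pmf l k) 1 = 1 / real (prm l k)"
    using assms by (subst pmf_digit) (auto simp: digit_values_def digit_lo_def digit_hi_def)
  finally show ?thesis .
qed

definition common_alpha :: "nat \<Rightarrow> (nat \<Rightarrow> nat) \<Rightarrow> (nat \<Rightarrow> nat) \<Rightarrow> bool" where
  "common_alpha L w w' \<longleftrightarrow> (\<exists>k\<ge>L. w k = 1 \<and> w' k = 1)"

lemma common_alpha_measurable [measurable]:
  "Measurable.pred borel (\<lambda>v. common_alpha L w (dig l v))"
  "Measurable.pred (borel \<Otimes>\<^sub>M borel) (\<lambda>(u, v). common_alpha L (dig l u) (dig l v))"
  unfolding common_alpha_def by measurable

text \<open>The analogue, for measures of bounded entropy, of the sparse pairs bound for samples.\<close>

lemma entropy_common_alpha: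
  fixes e :: real
  assumes l: "l > 1" and e: "e > 0"
  obtains L0 where "L0 \<ge> nq l" "\<And>L \<mu>. L \<ge> L0 \<Longrightarrow> prob_space \<mu> \<Longrightarrow> sets \<mu> = sets borel \<Longrightarrow>
    rel_entropy \<mu> (nu l) \<le> ereal a \<Longrightarrow>
    (\<integral>u. (\<integral>v. of_bool (common_alpha L (dig l u) (dig l v)) \<partial>\<mu>) \<partial>\<mu>) \<le> e"
proof -
  interpret n: prob_space "nu l" by (rule prob_nu)
  obtain d where d: "d > 0" "\<And>\<mu> A. prob_space \<mu> \<Longrightarrow> rel_entropy \<mu> (nu l) \<le> ereal a \<Longrightarrow> A \<in> sets (nu l) \<Longrightarrow>
     measure (nu l) A \<le> d \<Longrightarrow> measure \<mu> A \<le> e / 2"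
    using entropy_uniformly_absolutely_continuous[OF prob_nu[of l], of "e/2" a] e by auto
  \<comment> \<open>The tail is made at most d * d so that Markov's inequality at height d leaves an
    exceptional set of \<nu>-measure at most d, to which the choice of d applies.\<close>
  obtain L0 where L0: "L0 \<ge> nq l" "\<And>L. L \<ge> L0 \<Longrightarrow> (\<Sum>k. 1 / real (prm l (k + L)) ^ 2) \<le> d * d"
    using prm_tail[of "d * d" l] d(1) by auto
  show ?thesis
  proof (rule that[OF L0(1)])
    fix L and \<mu> :: "real measure"
    assume L: "L \<ge> L0" and mu: "prob_space \<mu>" "sets \<mu> = sets borel" and ent: "rel_entropy \<mu> (nu l) \<le> ereal a"
    interpret m: prob_space \<mu> by fact
    have sp: "space \<mu> = UNIV" using sets_eq_imp_space_eq[OF mu(2)] by simp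
    have mc: "measurable \<mu> N = measurable borel N" for N :: "'z measure" by (rule measurable_cong_sets[OF mu(2) refl])
    have mn: "measurable (nu l) N = measurable borel N" for N :: "'z measure" by (rule measurable_cong_sets) auto
    define D where "D u = {v. common_alpha L (dig l u) (dig l v)}" for u
    have Dm: "D u \<in> sets borel" for u
      unfolding D_def using common_alpha_measurable(1)[of L "dig l u" l] by (simp add: pred_def)
    \<comment> \<open>\<open>s u\<close> is the union bound for the \<nu>-mass of the section
      \<open>D u\<close>. It may be infinite at some u, but integrating it brings in a second factor
      1/p and with it a convergent sum.\<close>
    define s where "s u = (\<Sum>k. ennreal (1 / real (prm l (k + L))) * indicator {u. dig l u (k + L) = 1} u)" for u
    have onem: "{u. dig l u k = 1} \<in> sets borel" for k
      using measurable_sets[OF dig_measurable, of "{1}" k l] by (simp add: vimage_def)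
    have tm: "(\<lambda>u. ennreal (1 / real (prm l (k + L))) * indicator {u. dig l u (k + L) = 1} u) \<in> borel_measurable borel" for k
      by (intro borel_measurable_times_ennreal borel_measurable_const borel_measurable_indicator onem)
    have sm: "s \<in> borel_measurable borel"
      unfolding s_def by (rule borel_measurable_suminf_order[OF tm])
    have al: "emeasure (nu l) {u. dig l u (k + L) = 1} = ennreal (1 / real (prm l (k + L)))" for k
      using L L0(1) by (intro nu_alpha l) simp
    have Ds: "emeasure (nu l) (D u) \<le> s u" for u
    proof -
      let ?A = "\<lambda>k. if dig l u (k + L) = 1 then {v. dig l v (k + L) = 1} else {}"
      have "D u \<subseteq> (\<Union>k. ?A k)"
      proof
        fix v assume "v \<in> D u"
        then obtain k where "k \<ge> L" "dig l u k = 1" "dig l v k = 1" by (auto simp: D_def common_alpha_def)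
        then show "v \<in> (\<Union>k. ?A k)" by (intro UN_I[of "k - L"]) auto
      qed
      then have "emeasure (nu l) (D u) \<le> emeasure (nu l) (\<Union>k. ?A k)"
        using onem by (intro emeasure_mono) auto
      also have "\<dots> \<le> (\<Sum>k. emeasure (nu l) (?A k))"
        using onem by (intro emeasure_subadditive_countably) auto
      also have "\<dots> = s u" unfolding s_def using al by (intro suminf_cong) (simp add: indicator_def)
      finally show ?thesis .
    qed
    \<comment> \<open>Uniform absolute continuity is used twice: the points of \<open>E\<close> have
      \<mu>-mass at most e/2, and outside \<open>E\<close> each section has \<mu>-mass at most
      e/2.\<close>
    define E where "E = {u. s u \<ge> ennreal d}"
    have Em: "E \<in> sets borel" unfolding E_def using sm by measurable
    have "(\<integral>\<^sup>+u. s u \<partial>nu l) = (\<Sum>k. \<integral>\<^sup>+u. ennreal (1 / real (prm l (k + L))) * indicator {u. dig l u (k + L) = 1} u \<partial>nu l)"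
      unfolding s_def by (rule nn_integral_suminf) (simp only: mn tm)
    also have "\<dots> = (\<Sum>k. ennreal (1 / real (prm l (k + L)) ^ 2))"
    proof (intro suminf_cong)
      fix k
      have "(\<integral>\<^sup>+u. ennreal (1 / real (prm l (k + L))) * indicator {u. dig l u (k + L) = 1} u \<partial>nu l)
          = ennreal (1 / real (prm l (k + L))) * emeasure (nu l) {u. dig l u (k + L) = 1}"
        using onem by (intro nn_integral_cmult_indicator) simp
      then show "(\<integral>\<^sup>+u. ennreal (1 / real (prm l (k + L))) * indicator {u. dig l u (k + L) = 1} u \<partial>nu l)
          = ennreal (1 / real (prm l (k + L)) ^ 2)"
        unfolding al by (simp add: ennreal_mult[symmetric] power2_eq_square del: ennreal_1)
    qed
    also have "\<dots> = ennreal (\<Sum>k. 1 / real (prm l (k + L)) ^ 2)"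
      using summable_iff_shift[of "\<lambda>k. 1 / real (prm l k) ^ 2" L] summable_prm[of l]
      by (intro suminf_ennreal2) simp_all
    also have "\<dots> \<le> ennreal (d * d)" using L0(2)[OF L] by (rule ennreal_leI)
    finally have tot: "(\<integral>\<^sup>+u. s u \<partial>nu l) \<le> ennreal (d * d)" .
    have "ennreal d * emeasure (nu l) E = (\<integral>\<^sup>+u. ennreal d * indicator E u \<partial>nu l)"
      using Em by (intro nn_integral_cmult_indicator[symmetric]) simp
    also have "\<dots> \<le> (\<integral>\<^sup>+u. s u \<partial>nu l)" by (intro nn_integral_mono) (auto simp: E_def indicator_def)
    also note tot
    finally have "ennreal (d * measure (nu l) E) \<le> ennreal (d * d)"
      using d(1) by (simp add: n.emeasure_eq_measure ennreal_mult)
    then have "d * measure (nu l) E \<le> d * d" using d(1) by (subst (asm) ennreal_le_iff) auto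
    then have "measure (nu l) E \<le> d" using d(1) by (simp only: mult_le_cancel_left_pos)
    then have ME: "measure \<mu> E \<le> e / 2" using d(2)[OF mu(1) ent, of E] Em by simp
    have in1: "(\<integral>v. of_bool (common_alpha L (dig l u) (dig l v)) \<partial>\<mu>) = measure \<mu> (D u)" for u
    proof -
      have "(\<integral>v. of_bool (common_alpha L (dig l u) (dig l v)) \<partial>\<mu>) = (\<integral>v. indicator (D u) v \<partial>\<mu>)"
        by (intro Bochner_Integration.integral_cong) (auto simp: D_def indicator_def)
      also have "\<dots> = measure \<mu> (D u)" by (simp add: sp)
      finally show ?thesis .
    qed
    have bd: "measure \<mu> (D u) \<le> e / 2 + indicator E u" for u
    proof (cases "u \<in> E")
      case True
      then have i: "indicator E u = (1::real)" by simp
      show ?thesis unfolding i using m.prob_le_1[of "D u"] e by linarith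
    next
      case False
      then have "emeasure (nu l) (D u) \<le> ennreal d" using Ds[of u] by (auto simp: E_def not_le)
      then have "measure (nu l) (D u) \<le> d" using d(1) by (simp add: n.emeasure_eq_measure)
      then have "measure \<mu> (D u) \<le> e / 2" using d(2)[OF mu(1) ent, of "D u"] Dm by simp
      then show ?thesis by (simp add: indicator_def)
    qed
    have mm: "(\<lambda>u. \<integral>v. (of_bool (common_alpha L (dig l u) (dig l v)) :: real) \<partial>\<mu>) \<in> borel_measurable \<mu>"
    proof (rule m.borel_measurable_lebesgue_integral)
      have "sets (\<mu> \<Otimes>\<^sub>M \<mu>) = sets (borel \<Otimes>\<^sub>M borel)" using mu(2) by (intro sets_pair_measure_cong)
      then show "(\<lambda>(u, v). of_bool (common_alpha L (dig l u) (dig l v)) :: real) \<in> borel_measurable (\<mu> \<Otimes>\<^sub>M \<mu>)"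
        using common_alpha_measurable(2)[of L l] by (simp add: split_beta' cong: measurable_cong_sets)
    qed
    have Emu: "E \<in> sets \<mu>" using Em mu(2) by simp
    have "(\<integral>u. measure \<mu> (D u) \<partial>\<mu>) \<le> (\<integral>u. e / 2 + indicator E u \<partial>\<mu>)"
    proof (rule integral_mono)
      show "integrable \<mu> (\<lambda>u. measure \<mu> (D u))"
        using mm unfolding in1 by (intro m.integrable_const_bound[where B=1]) auto
      show "integrable \<mu> (\<lambda>u. e / 2 + indicator E u)" using Emu by (auto simp: m.emeasure_eq_measure)
    qed (rule bd)
    also have "\<dots> = e / 2 + measure \<mu> E"
      using Emu m.prob_space unfolding sp by (simp add: sp m.emeasure_eq_measure)
    also have "\<dots> \<le> e" using ME by simp
    finally show "(\<integral>u. (\<integral>v. of_bool (common_alpha L (dig l u) (dig l v)) \<partial>\<mu>) \<partial>\<mu>) \<le> e"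
      unfolding in1 .
  qed
qed

section \<open>Truncation to finitely many digits\<close>

text \<open>All conditions at the q_i are kept and those at the p_j only below position L, so that
  for L \<ge> \<open>nq l\<close> the first L digits decide it.\<close>

definition compatible_upto :: "nat \<Rightarrow> nat \<Rightarrow> (nat \<Rightarrow> nat) \<Rightarrow> (nat \<Rightarrow> nat) \<Rightarrow> bool" where
  "compatible_upto l L w w' \<longleftrightarrow> (\<forall>k<nq l. w k \<noteq> 0 \<and> w' k \<noteq> 0 \<and> \<not> (w k = 2 \<and> w' k = 2))
     \<and> (\<forall>k<L. nq l \<le> k \<longrightarrow> \<not> (w k = 1 \<and> w' k = 1))"

definition cells :: "nat \<Rightarrow> nat \<Rightarrow> (nat \<Rightarrow> nat) set" where
  "cells l L = PiE {..<L} (digit_values l)"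

definition int_cell :: "nat \<Rightarrow> nat \<Rightarrow> nat \<Rightarrow> nat \<Rightarrow> nat" where
  "int_cell l L x = restrict (int_digit l x) {..<L}"

definition real_cell :: "nat \<Rightarrow> nat \<Rightarrow> real \<Rightarrow> nat \<Rightarrow> nat" where
  "real_cell l L u = restrict (dig l u) {..<L}"

definition cell_weight :: "nat \<Rightarrow> nat \<Rightarrow> (nat \<Rightarrow> nat) \<Rightarrow> real" where
  "cell_weight l L s = (\<Prod>k<L. pmf (digit_pmf l k) (s k))"

text \<open>The truncated functional as a polynomial in class probabilities; both empirical laws and
  the class laws of measures are inserted into it.\<close>

definition quad :: "nat \<Rightarrow> nat \<Rightarrow> ((nat \<Rightarrow> nat) \<Rightarrow> real) \<Rightarrow> real" where
  "quad l L p = (\<Sum>s\<in>cells l L. \<Sum>t\<in>cells l L. of_bool (compatible_upto l L s t) * (p s * p t))"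

lemma compatible_upto_approx:
  "\<bar>of_bool (compatible_upto l L w w') - of_bool (compatible l w w')\<bar> \<le> (of_bool (common_alpha L w w') :: real)"
proof -
  have "compatible l w w' \<Longrightarrow> compatible_upto l L w w'"
    by (simp add: compatible_def compatible_upto_def)
  moreover have "compatible_upto l L w w' \<Longrightarrow> \<not> common_alpha L w w' \<Longrightarrow> compatible l w w'"
    unfolding compatible_def compatible_upto_def common_alpha_def by (meson not_le)
  ultimately show ?thesis by auto
qed

lemma compatible_upto_restrict:
  assumes "L \<ge> nq l"
  shows "compatible_upto l L (restrict w {..<L}) (restrict w' {..<L}) \<longleftrightarrow> compatible_upto l L w w'"
  using assms unfolding compatible_upto_def by (simp cong: imp_cong)

lemma finite_cells [simp]: "finite (cells l L)"
  unfolding cells_def by (intro finite_PiE) (auto simp: digit_values_def)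

lemma restrict_eq_cell:
  assumes "s \<in> cells l L"
  shows "restrict w {..<L} = s \<longleftrightarrow> (\<forall>k<L. w k = s k)"
proof
  assume "\<forall>k<L. w k = s k"
  then show "restrict w {..<L} = s"
    using assms unfolding cells_def by (intro extensionalityI[of _ "{..<L}"]) (auto simp: PiE_def)
qed auto

lemma real_cell_in [simp]: "real_cell l L u \<in> cells l L"
  unfolding real_cell_def cells_def using dig_values by (intro restrict_PiE_iff[THEN iffD2]) auto

lemma real_cell_sets: "s \<in> cells l L \<Longrightarrow> {u. real_cell l L u = s} \<in> sets borel"
  unfolding real_cell_def using digit_event_measurable(1)[of L l s] by (simp add: restrict_eq_cell)

lemma nu_cell:
  assumes "l > 1" "s \<in> cells l L"
  shows "measure (nu l) {u. real_cell l L u = s} = cell_weight l L s"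
  using nu_pattern[OF assms(1), of L s] assms(2) by (simp add: real_cell_def restrict_eq_cell cell_weight_def)

text \<open>Makes the Sanov bounds available at every truncation level. The weights sum to 1 because
  their sum factorises over the positions.\<close>

lemma cell_density_digits:
  assumes "l > 1"
  shows "cell_density (cells l L) (int_cell l L) (cell_weight l L)"
proof
  show "finite (cells l L)" by simp
  show "int_cell l L x \<in> cells l L" for x
    unfolding int_cell_def cells_def using int_digit_values by (intro restrict_PiE_iff[THEN iffD2]) auto
  show "0 < cell_weight l L s" if "s \<in> cells l L" for s
    unfolding cell_weight_def using that assms
    by (intro prod_pos ballI digit_pmf_pos) (auto simp: cells_def dest: PiE_mem)
  have "(\<Sum>s\<in>cells l L. cell_weight l L s) = (\<Prod>k<L. \<Sum>v\<in>digit_values l k. pmf (digit_pmf l k) v)"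
    unfolding cell_weight_def cells_def by (rule prod_sum_PiE[symmetric]) (auto simp: digit_values_def)
  then show "(\<Sum>s\<in>cells l L. cell_weight l L s) = 1" using digit_pmf_sum[OF assms] by simp
  show "(\<lambda>n. (\<Sum>x\<in>{1..n}. of_bool (int_cell l L x = s)) / real n) \<longlonglongrightarrow> cell_weight l L s"
    if s: "s \<in> cells l L" for s
  proof -
    have "s k \<in> digit_values l k" if "k < L" for k using s that by (auto simp: cells_def dest: PiE_mem)
    from density_digit_pattern[OF assms this]
    show ?thesis unfolding int_cell_def restrict_eq_cell[OF s] cell_weight_def by simp
  qed
qed

section \<open>The statistic and its truncations\<close>

definition stat :: "nat \<Rightarrow> nat \<Rightarrow> (nat \<Rightarrow> nat) \<Rightarrow> real" where
  "stat l n X = (\<Sum>i<n. \<Sum>j<n. of_bool (compatible l (int_digit l (X i)) (int_digit l (X j)))) / real n ^ 2"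

definition stat_upto :: "nat \<Rightarrow> nat \<Rightarrow> nat \<Rightarrow> (nat \<Rightarrow> nat) \<Rightarrow> real" where
  "stat_upto l L n X = (\<Sum>i<n. \<Sum>j<n. of_bool (compatible_upto l L (int_digit l (X i)) (int_digit l (X j)))) / real n ^ 2"

text \<open>The passage from the \<open>pmf\<close> and the gcd to finite sums of digit conditions;
  all estimates are made on the latter.\<close>

lemma gcd_stat_law_sprob:
  assumes "l > 1" "n \<ge> 1"
  shows "measure (measure_pmf (gcd_stat_law l n)) A = sprob n (\<lambda>X. stat l n X \<in> A)"
proof -
  let ?T = "\<lambda>X. (1 / real n ^ 2) * (\<Sum>i<n. \<Sum>j<n. if gcd (X i) (X j) = l then 1 else 0)"
  have "measure (measure_pmf (gcd_stat_law l n)) A = measure (measure_pmf (pmf_of_set (samples n))) (?T -` A)"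
    unfolding gcd_stat_law_def samples_def by (rule measure_map_pmf)
  also have "?T -` A = {X. ?T X \<in> A}" by (simp only: vimage_def)
  also have "measure (measure_pmf (pmf_of_set (samples n))) {X. ?T X \<in> A} = sprob n (\<lambda>X. ?T X \<in> A)"
    by (rule sprob_conv_pmf[OF assms(2)])
  also have "\<dots> = sprob n (\<lambda>X. stat l n X \<in> A)"
  proof -
    have T: "?T X = stat l n X" if X: "X \<in> samples n" for X
    proof -
      have "(if gcd (X i) (X j) = l then 1 else 0) = (of_bool (compatible l (int_digit l (X i)) (int_digit l (X j))) :: real)"
        if "i < n" "j < n" for i j
      proof -
        have "1 \<le> X i" "1 \<le> X j" using samplesD[OF X] that by auto
        from gcd_eq_iff_compatible[OF assms(1) this] show ?thesis by (simp only: of_bool_def)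
      qed
      then have "(\<Sum>i<n. \<Sum>j<n. if gcd (X i) (X j) = l then 1 else 0)
          = (\<Sum>i<n. \<Sum>j<n. of_bool (compatible l (int_digit l (X i)) (int_digit l (X j))) :: real)"
        by (intro sum.cong refl) auto
      then show ?thesis by (simp only: stat_def times_divide_eq_left mult_1)
    qed
    show ?thesis by (rule antisym; rule sprob_mono) (simp_all only: T)
  qed
  finally show ?thesis .
qed

text \<open>Exponential equivalence. The error is at most the share of pairs with a common prime at
  position L or later; \<theta> is determined by \<epsilon> and M, and L0 is then taken so large
  that this relation has density at most \<theta>.\<close>

lemma stat_approximation:
  assumes "l > 1" "\<epsilon> > 0" "M > 0"
  obtains L0 where "L0 \<ge> nq l" "\<And>L. L \<ge> L0 \<Longrightarrow>
    \<forall>\<^sub>F n in sequentially. sprob n (\<lambda>X. \<epsilon> \<le> \<bar>stat_upto l L n X - stat l n X\<bar>) \<le> exp (- M * real n)"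
proof -
  show ?thesis
  proof (rule sparse_pairs_exponentially_unlikely[OF assms(2,3)])
    fix \<theta> :: real assume \<theta>: "\<theta> > 0"
      "\<And>g. (\<And>n. (\<Sum>x\<in>{1..n}. \<Sum>y\<in>{1..n}. of_bool (g x y)) \<le> \<theta> * real n ^ 2) \<Longrightarrow>
        (\<forall>\<^sub>F n in sequentially.
          sprob n (\<lambda>X. \<epsilon> * real n ^ 2 \<le> (\<Sum>i<n. \<Sum>j<n. of_bool (g (X i) (X j)))) \<le> exp (- M * real n))"
    obtain L0 where L0: "L0 \<ge> nq l" "\<And>L. L \<ge> L0 \<Longrightarrow> (\<Sum>k. 1 / real (prm l (k + L)) ^ 2) \<le> \<theta>"
      using prm_tail[OF \<theta>(1), of l] by blast
    show ?thesis
    proof (rule that[OF L0(1)])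
      fix L assume L: "L \<ge> L0"
      define g where "g x y \<longleftrightarrow> common_alpha L (int_digit l x) (int_digit l y)" for x y
      have "(\<Sum>x\<in>{1..n}. \<Sum>y\<in>{1..n}. of_bool (g x y)) \<le> \<theta> * real n ^ 2" for n
      proof -
        have "(\<Sum>x\<in>{1..n}. \<Sum>y\<in>{1..n}. of_bool (g x y)) \<le> (\<Sum>k. 1 / real (prm l (k + L)) ^ 2) * real n ^ 2"
          unfolding g_def common_alpha_def using L L0(1) by (intro sum_common_digit_le) simp
        also have "\<dots> \<le> \<theta> * real n ^ 2" using L0(2)[OF L] by (intro mult_right_mono) auto
        finally show ?thesis .
      qed
      from \<theta>(2)[OF this] eventually_ge_at_top[of 1]
      show "\<forall>\<^sub>F n in sequentially. sprob n (\<lambda>X. \<epsilon> \<le> \<bar>stat_upto l L n X - stat l n X\<bar>) \<le> exp (- M * real n)"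
      proof eventually_elim
        case (elim n)
        have "sprob n (\<lambda>X. \<epsilon> \<le> \<bar>stat_upto l L n X - stat l n X\<bar>)
            \<le> sprob n (\<lambda>X. \<epsilon> * real n ^ 2 \<le> (\<Sum>i<n. \<Sum>j<n. of_bool (g (X i) (X j))))"
        proof (rule sprob_mono)
          fix X assume *: "\<epsilon> \<le> \<bar>stat_upto l L n X - stat l n X\<bar>"
          have n: "real n ^ 2 > 0" using elim(2) by simp
          have "\<bar>stat_upto l L n X - stat l n X\<bar> * real n ^ 2 =
            \<bar>\<Sum>i<n. \<Sum>j<n. of_bool (compatible_upto l L (int_digit l (X i)) (int_digit l (X j)))
              - of_bool (compatible l (int_digit l (X i)) (int_digit l (X j)))\<bar>"
            unfolding stat_upto_def stat_def diff_divide_distrib[symmetric] abs_divide sum_subtractf using n by simp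
          also have "\<dots> \<le> (\<Sum>i<n. \<Sum>j<n. of_bool (g (X i) (X j)))"
            unfolding g_def by (intro order_trans[OF sum_abs] sum_mono compatible_upto_approx)
          finally have "\<bar>stat_upto l L n X - stat l n X\<bar> * real n ^ 2 \<le> (\<Sum>i<n. \<Sum>j<n. of_bool (g (X i) (X j)))" .
          moreover have "\<epsilon> * real n ^ 2 \<le> \<bar>stat_upto l L n X - stat l n X\<bar> * real n ^ 2"
            using * by (intro mult_right_mono) auto
          ultimately show "\<epsilon> * real n ^ 2 \<le> (\<Sum>i<n. \<Sum>j<n. of_bool (g (X i) (X j)))" by linarith
        qed
        then show ?case using elim(1) by linarith
      qed
    qed
  qed
qed

lemma stat_upto_quad:
  assumes "l > 1" "L \<ge> nq l" "X \<in> samples n" "n \<ge> 1"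
  shows "stat_upto l L n X = quad l L (cell_density.emp (int_cell l L) n X)"
proof -
  interpret cell_density "cells l L" "int_cell l L" "cell_weight l L" by (rule cell_density_digits[OF assms(1)])
  have "(\<Sum>i<n. \<Sum>j<n. of_bool (compatible_upto l L (int_digit l (X i)) (int_digit l (X j))))
      = (\<Sum>i<n. \<Sum>j<n. of_bool (compatible_upto l L (int_cell l L (X i)) (int_cell l L (X j))))"
    unfolding int_cell_def compatible_upto_restrict[OF assms(2)] by (rule refl)
  also have "\<dots> = (\<Sum>i<n. real n * (\<Sum>t\<in>cells l L. of_bool (compatible_upto l L (int_cell l L (X i)) t) * emp n X t))"
  proof (rule sum.cong[OF refl])
    fix i
    show "(\<Sum>j<n. of_bool (compatible_upto l L (int_cell l L (X i)) (int_cell l L (X j))))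
        = real n * (\<Sum>t\<in>cells l L. of_bool (compatible_upto l L (int_cell l L (X i)) t) * emp n X t)"
      by (rule sum_emp[OF assms(3), where f="\<lambda>t. of_bool (compatible_upto l L (int_cell l L (X i)) t)"])
  qed
  also have "\<dots> = real n * (\<Sum>s\<in>cells l L. (real n * (\<Sum>t\<in>cells l L. of_bool (compatible_upto l L s t) * emp n X t)) * emp n X s)"
    by (rule sum_emp[OF assms(3), where f="\<lambda>s. real n * (\<Sum>t\<in>cells l L. of_bool (compatible_upto l L s t) * emp n X t)"])
  also have "\<dots> = real n ^ 2 * quad l L (emp n X)"
    unfolding quad_def sum_distrib_left sum_distrib_right by (intro sum.cong refl) (simp add: power2_eq_square mult_ac)
  finally show ?thesis using assms(4) by (simp add: stat_upto_def)
qed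

section \<open>The quadratic functional on measures\<close>

definition pair_integral :: "nat \<Rightarrow> real measure \<Rightarrow> real" where
  "pair_integral l \<mu> = (\<integral>u. (\<integral>v. fker l u v \<partial>\<mu>) \<partial>\<mu>)"

definition cell_law :: "nat \<Rightarrow> nat \<Rightarrow> real measure \<Rightarrow> (nat \<Rightarrow> nat) \<Rightarrow> real" where
  "cell_law l L \<mu> s = measure \<mu> {u. real_cell l L u = s}"

definition admissible :: "real measure \<Rightarrow> bool" where
  "admissible \<mu> \<longleftrightarrow> prob_space \<mu> \<and> sets \<mu> = sets borel \<and> emeasure \<mu> (- {0..1}) = 0"

lemma rate_admissible:
  "rate l x = (INF \<mu> \<in> {\<mu>. admissible \<mu> \<and> pair_integral l \<mu> = x}. rel_entropy \<mu> (nu l))"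
  by (simp add: rate_def admissible_def pair_integral_def conj_assoc)

lemma compatible_pairs_sets:
  "{(u, v). compatible l (dig l u) (dig l v)} \<in> sets (borel \<Otimes>\<^sub>M borel)"
proof -
  have "{p \<in> space (borel \<Otimes>\<^sub>M borel). compatible l (dig l (fst p)) (dig l (snd p))} \<in> sets (borel \<Otimes>\<^sub>M borel)"
    unfolding compatible_def by measurable
  then show ?thesis by (simp add: space_pair_measure split_beta')
qed

lemma compatible_upto_pairs_sets:
  "{(u, v). compatible_upto l L (dig l u) (dig l v)} \<in> sets (borel \<Otimes>\<^sub>M borel)"
proof -
  have "{p \<in> space (borel \<Otimes>\<^sub>M borel). compatible_upto l L (dig l (fst p)) (dig l (snd p))} \<in> sets (borel \<Otimes>\<^sub>M borel)"
    unfolding compatible_upto_def by measurable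
  then show ?thesis by (simp add: space_pair_measure split_beta')
qed

lemma common_alpha_pairs_sets:
  "{(u, v). common_alpha L (dig l u) (dig l v)} \<in> sets (borel \<Otimes>\<^sub>M borel)"
  using common_alpha_measurable(2)[of L l] by (simp add: pred_def space_pair_measure)

lemma section_integrable:
  fixes \<mu> :: "real measure"
  assumes "prob_space \<mu>" "sets \<mu> = sets borel" and P: "{(u, v). P u v} \<in> sets (borel \<Otimes>\<^sub>M borel)"
  shows "integrable \<mu> (\<lambda>v. of_bool (P u v) :: real)" "integrable \<mu> (\<lambda>u. \<integral>v. of_bool (P u v) \<partial>\<mu> :: real)"
proof -
  interpret prob_space \<mu> by fact
  have s2: "sets (\<mu> \<Otimes>\<^sub>M \<mu>) = sets (borel \<Otimes>\<^sub>M borel)" using assms(2) by (intro sets_pair_measure_cong)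
  have P': "{(u, v). P u v} \<in> sets (\<mu> \<Otimes>\<^sub>M \<mu>)" using P s2 by simp
  have m: "(\<lambda>(u, v). of_bool (P u v) :: real) \<in> borel_measurable (\<mu> \<Otimes>\<^sub>M \<mu>)"
  proof (subst measurable_cong)
    show "(indicator {(u, v). P u v} :: _ \<Rightarrow> real) \<in> borel_measurable (\<mu> \<Otimes>\<^sub>M \<mu>)"
      by (rule borel_measurable_indicator[OF P'])
  qed (auto simp: indicator_def)
  have sp: "space \<mu> = UNIV" using sets_eq_imp_space_eq[OF assms(2)] by simp
  have "(\<lambda>v. (\<lambda>(u, v). of_bool (P u v) :: real) (u, v)) \<in> borel_measurable \<mu>"
    by (rule measurable_Pair2[OF m]) (simp add: sp)
  then have mu: "(\<lambda>v. of_bool (P u v) :: real) \<in> borel_measurable \<mu>" for u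
    using measurable_Pair2[OF m, of u] by (simp add: sp)
  have b1: "norm (of_bool Q :: real) \<le> 1" for Q by simp
  show i1: "integrable \<mu> (\<lambda>v. of_bool (P u v) :: real)" for u
    by (rule integrable_const_bound[where B=1, OF _ mu]) (simp add: b1)
  have mm: "(\<lambda>u. \<integral>v. of_bool (P u v) \<partial>\<mu> :: real) \<in> borel_measurable \<mu>"
    by (rule borel_measurable_lebesgue_integral[OF m])
  have "norm (\<integral>v. of_bool (P u v) \<partial>\<mu> :: real) \<le> 1" for u
  proof -
    have "norm (\<integral>v. of_bool (P u v) \<partial>\<mu> :: real) \<le> (\<integral>v. norm (of_bool (P u v) :: real) \<partial>\<mu>)"
      by (rule integral_norm_bound)
    also have "\<dots> \<le> (\<integral>v. 1 \<partial>\<mu>)"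
      by (rule integral_mono) (use i1[of u] in auto)
    finally show ?thesis using prob_space by simp
  qed
  then show "integrable \<mu> (\<lambda>u. \<integral>v. of_bool (P u v) \<partial>\<mu> :: real)"
    by (intro integrable_const_bound[where B=1, OF _ mm]) simp
qed

lemma cell_integral:
  fixes \<mu> :: "real measure" and f :: "(nat \<Rightarrow> nat) \<Rightarrow> real"
  assumes "prob_space \<mu>" "sets \<mu> = sets borel"
  shows "(\<integral>u. f (real_cell l L u) \<partial>\<mu>) = (\<Sum>s\<in>cells l L. f s * cell_law l L \<mu> s)"
proof -
  interpret prob_space \<mu> by fact
  have sp: "space \<mu> = UNIV" using sets_eq_imp_space_eq[OF assms(2)] by simp
  show ?thesis
    using finite_range_integral(2)[OF finite_measure_axioms finite_cells, of l L "real_cell l L" f]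
      real_cell_sets assms(2) by (simp add: cell_law_def sp)
qed

lemma quad_cell_law:
  assumes "prob_space \<mu>" "sets \<mu> = sets borel" "L \<ge> nq l"
  shows "(\<integral>u. (\<integral>v. of_bool (compatible_upto l L (dig l u) (dig l v)) \<partial>\<mu>) \<partial>\<mu>) = quad l L (cell_law l L \<mu>)"
proof -
  have "(\<integral>u. (\<integral>v. of_bool (compatible_upto l L (dig l u) (dig l v)) \<partial>\<mu>) \<partial>\<mu>)
      = (\<integral>u. (\<integral>v. of_bool (compatible_upto l L (real_cell l L u) (real_cell l L v)) \<partial>\<mu>) \<partial>\<mu>)"
    unfolding real_cell_def compatible_upto_restrict[OF assms(3)] by (rule refl)
  also have "\<dots> = (\<integral>u. (\<Sum>t\<in>cells l L. of_bool (compatible_upto l L (real_cell l L u) t) * cell_law l L \<mu> t) \<partial>\<mu>)"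
  proof (rule Bochner_Integration.integral_cong[OF refl])
    fix u
    show "(\<integral>v. of_bool (compatible_upto l L (real_cell l L u) (real_cell l L v)) \<partial>\<mu>)
        = (\<Sum>t\<in>cells l L. of_bool (compatible_upto l L (real_cell l L u) t) * cell_law l L \<mu> t)"
      by (rule cell_integral[OF assms(1,2), where f="\<lambda>t. of_bool (compatible_upto l L (real_cell l L u) t)"])
  qed
  also have "\<dots> = (\<Sum>s\<in>cells l L. (\<Sum>t\<in>cells l L. of_bool (compatible_upto l L s t) * cell_law l L \<mu> t) * cell_law l L \<mu> s)"
    by (rule cell_integral[OF assms(1,2), where f="\<lambda>s. \<Sum>t\<in>cells l L. of_bool (compatible_upto l L s t) * cell_law l L \<mu> t"])
  also have "\<dots> = quad l L (cell_law l L \<mu>)"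
    unfolding quad_def sum_distrib_right by (intro sum.cong refl) (simp add: mult_ac)
  finally show ?thesis .
qed

lemma pair_integral_approx:
  assumes "prob_space \<mu>" "sets \<mu> = sets borel" "L \<ge> nq l"
  shows "\<bar>quad l L (cell_law l L \<mu>) - pair_integral l \<mu>\<bar>
    \<le> (\<integral>u. (\<integral>v. of_bool (common_alpha L (dig l u) (dig l v)) \<partial>\<mu>) \<partial>\<mu>)"
proof -
  define f g h :: "real \<Rightarrow> real \<Rightarrow> real" where fgh:
    "f u v = of_bool (compatible_upto l L (dig l u) (dig l v))"
    "g u v = of_bool (compatible l (dig l u) (dig l v))"
    "h u v = of_bool (common_alpha L (dig l u) (dig l v))" for u v
  note i1 = section_integrable[OF assms(1,2) compatible_pairs_sets[of l], folded fgh]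
  note i2 = section_integrable[OF assms(1,2) compatible_upto_pairs_sets[of l L], folded fgh]
  note i3 = section_integrable[OF assms(1,2) common_alpha_pairs_sets[of L l], folded fgh]
  have in1: "\<bar>(\<integral>v. f u v \<partial>\<mu>) - (\<integral>v. g u v \<partial>\<mu>)\<bar>
      \<le> (\<integral>v. h u v \<partial>\<mu> :: real)" for u
  proof -
    have "(\<integral>v. f u v \<partial>\<mu>) - (\<integral>v. g u v \<partial>\<mu>)
      = (\<integral>v. f u v - g u v \<partial>\<mu> :: real)"
      by (rule Bochner_Integration.integral_diff[symmetric, OF i2(1) i1(1)])
    moreover have "\<bar>\<integral>v. f u v - g u v \<partial>\<mu> :: real\<bar>
      \<le> (\<integral>v. \<bar>f u v - g u v\<bar> \<partial>\<mu>)"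
      by (rule integral_abs_bound)
    moreover have "(\<integral>v. \<bar>f u v - g u v\<bar> \<partial>\<mu>)
      \<le> (\<integral>v. h u v \<partial>\<mu> :: real)"
      by (rule integral_mono[OF integrable_abs[OF Bochner_Integration.integrable_diff[OF i2(1) i1(1)]] i3(1)])
        (unfold fgh, rule compatible_upto_approx)
    ultimately show ?thesis by linarith
  qed
  let ?A = "\<lambda>u. \<integral>v. f u v \<partial>\<mu> :: real"
  let ?B = "\<lambda>u. \<integral>v. g u v \<partial>\<mu> :: real"
  have "quad l L (cell_law l L \<mu>) - pair_integral l \<mu> = (\<integral>u. ?A u \<partial>\<mu>) - (\<integral>u. ?B u \<partial>\<mu>)"
    unfolding quad_cell_law[OF assms, symmetric] pair_integral_def fker_compatible fgh by (rule refl)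
  also have "\<dots> = (\<integral>u. ?A u - ?B u \<partial>\<mu>)"
    by (rule Bochner_Integration.integral_diff[symmetric, OF i2(2) i1(2)])
  finally have "\<bar>quad l L (cell_law l L \<mu>) - pair_integral l \<mu>\<bar> \<le> (\<integral>u. \<bar>?A u - ?B u\<bar> \<partial>\<mu>)"
    using integral_abs_bound[of \<mu> "\<lambda>u. ?A u - ?B u"] by (simp only:)
  also have "\<dots> \<le> (\<integral>u. (\<integral>v. h u v \<partial>\<mu>) \<partial>\<mu>)"
    by (rule integral_mono[OF integrable_abs[OF Bochner_Integration.integrable_diff[OF i2(2) i1(2)]] i3(2)]) (rule in1)
  finally show ?thesis unfolding fgh .
qed

text \<open>Uniformity over an entropy sublevel set lets a single L serve a whole sequence of
  measures together with its limit.\<close>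

lemma pair_integral_uniform_approx:
  assumes "l > 1" "e > 0"
  obtains L0 where "L0 \<ge> nq l" "\<And>L \<mu>. L \<ge> L0 \<Longrightarrow> prob_space \<mu> \<Longrightarrow> sets \<mu> = sets borel \<Longrightarrow>
    rel_entropy \<mu> (nu l) \<le> ereal a \<Longrightarrow> \<bar>quad l L (cell_law l L \<mu>) - pair_integral l \<mu>\<bar> \<le> e"
proof -
  obtain L0 where L0: "L0 \<ge> nq l" "\<And>L \<mu>. L \<ge> L0 \<Longrightarrow> prob_space \<mu> \<Longrightarrow> sets \<mu> = sets borel \<Longrightarrow>
    rel_entropy \<mu> (nu l) \<le> ereal a \<Longrightarrow>
    (\<integral>u. (\<integral>v. of_bool (common_alpha L (dig l u) (dig l v)) \<partial>\<mu>) \<partial>\<mu>) \<le> e"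
    using entropy_common_alpha[OF assms, of a] by blast
  show ?thesis
  proof (rule that[OF L0(1)])
    fix L \<mu> assume *: "L0 \<le> L" "prob_space \<mu>" "sets \<mu> = sets borel" "rel_entropy \<mu> (nu l) \<le> ereal a"
    show "\<bar>quad l L (cell_law l L \<mu>) - pair_integral l \<mu>\<bar> \<le> e"
      using pair_integral_approx[OF *(2,3), of l L] L0(2)[OF *] L0(1) *(1) by linarith
  qed
qed

text \<open>Each truncated functional is a polynomial in finitely many class probabilities and hence
  continuous for setwise convergence; on an entropy sublevel set \<open>pair_integral\<close> is
  their uniform limit.\<close>

lemma admissible_compactness:
  assumes l: "l > 1" and mu: "\<And>k. admissible (\<mu> k)" "\<And>k. rel_entropy (\<mu> k) (nu l) \<le> ereal (a k)" "a \<longlonglongrightarrow> b"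
  obtains r M where "strict_mono (r :: nat \<Rightarrow> nat)" "admissible M" "rel_entropy M (nu l) \<le> ereal b"
    "(\<lambda>k. pair_integral l (\<mu> (r k))) \<longlonglongrightarrow> pair_integral l M"
proof -
  have mu': "prob_space (\<mu> k)" "sets (\<mu> k) = sets borel" "emeasure (\<mu> k) (- {0..1}) = 0" for k
    using mu(1)[of k] by (auto simp: admissible_def)
  obtain r M where r: "strict_mono (r :: nat \<Rightarrow> nat)" and M: "prob_space M" "sets M = sets borel"
    "emeasure M (- {0..1}) = 0" "rel_entropy M (nu l) \<le> ereal b"
    and conv: "\<And>A. A \<in> sets borel \<Longrightarrow> (\<lambda>k. measure (\<mu> (r k)) A) \<longlonglongrightarrow> measure M A"
    using entropy_compactness[OF prob_nu sets_nu mu' mu(2,3)] by metis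
  obtain B where B: "\<And>k. \<bar>a k\<bar> \<le> B" using convergent_imp_Bseq[of a] mu(3) by (auto simp: convergent_def Bseq_def)
  \<comment> \<open>One entropy level that covers all the \<mu> k and the limit.\<close>
  define C where "C = max B b"
  have entC: "rel_entropy (\<mu> k) (nu l) \<le> ereal C" for k
  proof -
    have "a k \<le> C" using B[of k] unfolding C_def by linarith
    then have "ereal (a k) \<le> ereal C" by simp
    then show ?thesis using mu(2)[of k] by (rule order_trans[rotated])
  qed
  have "ereal b \<le> ereal C" by (simp add: C_def)
  with M(4) have entM: "rel_entropy M (nu l) \<le> ereal C" by (rule order_trans)
  have "(\<lambda>k. pair_integral l (\<mu> (r k))) \<longlonglongrightarrow> pair_integral l M"
  proof (rule LIMSEQ_I)
    fix e :: real assume e: "e > 0"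
    obtain L where L: "L \<ge> nq l" "\<And>\<mu>. prob_space \<mu> \<Longrightarrow> sets \<mu> = sets borel \<Longrightarrow>
      rel_entropy \<mu> (nu l) \<le> ereal C \<Longrightarrow> \<bar>quad l L (cell_law l L \<mu>) - pair_integral l \<mu>\<bar> \<le> e / 3"
      using pair_integral_uniform_approx[OF l, of "e/3" C] e by (metis order_refl zero_less_divide_iff zero_less_numeral)
    have "(\<lambda>k. quad l L (cell_law l L (\<mu> (r k)))) \<longlonglongrightarrow> quad l L (cell_law l L M)"
      unfolding quad_def cell_law_def by (intro tendsto_sum tendsto_mult tendsto_const conv real_cell_sets)
    from LIMSEQ_D[OF this, of "e/3"] e obtain N where
      N: "\<And>k. k \<ge> N \<Longrightarrow> \<bar>quad l L (cell_law l L (\<mu> (r k))) - quad l L (cell_law l L M)\<bar> < e / 3" by auto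
    have "\<bar>pair_integral l (\<mu> (r k)) - pair_integral l M\<bar> < e" if "k \<ge> N" for k
      using N[OF that] L(2)[OF mu'(1,2) entC, of "r k"] L(2)[OF M(1,2) entM] by linarith
    then show "\<exists>no. \<forall>n\<ge>no. norm (pair_integral l (\<mu> (r n)) - pair_integral l M) < e" by auto
  qed
  then show ?thesis using that[OF r _ M(4)] M by (simp add: admissible_def)
qed

section \<open>The rate function\<close>

lemma rate_le: "admissible \<mu> \<Longrightarrow> pair_integral l \<mu> = x \<Longrightarrow> rel_entropy \<mu> (nu l) \<le> a \<Longrightarrow> rate l x \<le> a"
  unfolding rate_admissible by (rule INF_lower2) auto

lemma rate_lessE:
  assumes "rate l x < a"
  obtains \<mu> where "admissible \<mu>" "pair_integral l \<mu> = x" "rel_entropy \<mu> (nu l) < a"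
  using assms unfolding rate_admissible by (auto simp: INF_less_iff)

lemma rate_nonneg: "0 \<le> rate l x"
  unfolding rate_admissible by (intro INF_greatest rel_entropy_nonneg prob_nu) (simp add: admissible_def)

text \<open>Measures with pair integral x_k and entropy at most t + 1/(k+1) have a limit point with
  pair integral y and entropy at most t. The vanishing slack stands in for exact minimisers.\<close>

lemma lower_semicont_rate:
  assumes "l > 1"
  shows "lower_semicont (rate l)"
  unfolding lower_semicont_def
proof
  fix t :: ereal
  show "closed {x. rate l x \<le> t}"
  proof (cases t)
    case (real t')
    show ?thesis unfolding closed_sequential_limits
    proof (intro allI impI, elim conjE)
      fix x :: "nat \<Rightarrow> real" and y assume x: "\<forall>n. x n \<in> {x. rate l x \<le> t}" "x \<longlonglongrightarrow> y"
      have "\<exists>\<mu>. admissible \<mu> \<and> pair_integral l \<mu> = x k \<and> rel_entropy \<mu> (nu l) \<le> ereal (t' + 1 / real (Suc k))" for k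
      proof -
        have "rate l (x k) \<le> ereal t'" using x(1) real by auto
        also have "\<dots> < ereal (t' + 1 / real (Suc k))" by simp
        finally obtain \<mu> where "admissible \<mu>" "pair_integral l \<mu> = x k" "rel_entropy \<mu> (nu l) < ereal (t' + 1 / real (Suc k))"
          by (rule rate_lessE)
        then show ?thesis by (meson less_imp_le)
      qed
      then obtain \<mu> where \<mu>: "\<And>k. admissible (\<mu> k)" "\<And>k. pair_integral l (\<mu> k) = x k"
        "\<And>k. rel_entropy (\<mu> k) (nu l) \<le> ereal (t' + 1 / real (Suc k))" by metis
      have "(\<lambda>k. t' + 1 / real (Suc k)) \<longlonglongrightarrow> t'" by real_asymp
      from admissible_compactness[OF assms \<mu>(1,3) this] obtain r M where
        r: "strict_mono (r :: nat \<Rightarrow> nat)" "admissible M" "rel_entropy M (nu l) \<le> ereal t'"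
          "(\<lambda>k. pair_integral l (\<mu> (r k))) \<longlonglongrightarrow> pair_integral l M" by metis
      have "(\<lambda>k. x (r k)) \<longlonglongrightarrow> y" using LIMSEQ_subseq_LIMSEQ[OF x(2) r(1)] by (simp add: comp_def)
      then have "pair_integral l M = y" using r(4) LIMSEQ_unique unfolding \<mu>(2) by blast
      then show "y \<in> {x. rate l x \<le> t}" using rate_le[OF r(2) _ r(3)] real by simp
    qed
  next
    case MInf
    have "\<not> rate l x \<le> t" for x using rate_nonneg[of l x] MInf by auto
    then show ?thesis by simp
  qed simp
qed

text \<open>The lift has the density p / \<open>cell_weight\<close>, constant on each cell. It
  carries the entropy of a class law over to a measure on [0, 1], where compactness is
  available.\<close>

lemma cell_law_lift:
  assumes l: "l > 1" and p: "cell_density.distribution (cells l L) p"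
  obtains \<mu> where "admissible \<mu>" "\<And>s. s \<in> cells l L \<Longrightarrow> cell_law l L \<mu> s = p s"
    "rel_entropy \<mu> (nu l) = ereal (cell_density.Ent (cells l L) (cell_weight l L) p)"
proof -
  interpret cell_density "cells l L" "int_cell l L" "cell_weight l L" by (rule cell_density_digits[OF l])
  define \<phi> where "\<phi> s = p s / cell_weight l L s" for s
  define \<mu> where "\<mu> = density (nu l) (\<lambda>x. ennreal (\<phi> (real_cell l L x)))"
  have w: "measure (nu l) {x \<in> space (nu l). real_cell l L x = s} = cell_weight l L s" if "s \<in> cells l L" for s
    using nu_cell[OF l that] by simp
  have pw: "\<phi> s * cell_weight l L s = p s" if "s \<in> cells l L" for s using \<nu>_pos[OF that] by (simp add: \<phi>_def)
  have A1: "{x \<in> space (nu l). real_cell l L x = s} \<in> sets (nu l)" if "s \<in> cells l L" for s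
    using real_cell_sets[OF that] by simp
  have A2: "0 \<le> \<phi> s" if "s \<in> cells l L" for s
    using p \<nu>_pos[OF that] that by (auto simp: \<phi>_def distribution_def)
  have A3: "(\<Sum>s\<in>cells l L. \<phi> s * measure (nu l) {x \<in> space (nu l). real_cell l L x = s}) = 1"
  proof -
    have "(\<Sum>s\<in>cells l L. \<phi> s * measure (nu l) {x \<in> space (nu l). real_cell l L x = s}) = (\<Sum>s\<in>cells l L. p s)"
      by (intro sum.cong refl) (simp only: w pw)
    then show ?thesis using p by (simp add: distribution_def)
  qed
  note R0 = rel_entropy_density_finite_range[where c="real_cell l L" and \<phi>=\<phi> and S="cells l L" and \<nu>="nu l", folded \<mu>_def]
  have R: "prob_space \<mu>"
    "\<And>s. s \<in> cells l L \<Longrightarrow> measure \<mu> {x \<in> space (nu l). real_cell l L x = s} = \<phi> s * measure (nu l) {x \<in> space (nu l). real_cell l L x = s}"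
    "rel_entropy \<mu> (nu l) = ereal (\<Sum>s\<in>cells l L. \<phi> s * measure (nu l) {x \<in> space (nu l). real_cell l L x = s} * ln (\<phi> s))"
    using R0[OF prob_nu finite_cells A1 real_cell_in A2 A3] by blast+
  show ?thesis
  proof (rule that[of \<mu>])
    have "(\<Sum>s\<in>cells l L. \<phi> s * measure (nu l) {x \<in> space (nu l). real_cell l L x = s} * ln (\<phi> s)) = Ent p"
      unfolding Ent_def by (intro sum.cong refl) (simp only: w pw, simp only: \<phi>_def)
    then show ent: "rel_entropy \<mu> (nu l) = ereal (Ent p)" using R(3) by simp
    show "cell_law l L \<mu> s = p s" if "s \<in> cells l L" for s
      unfolding cell_law_def using R(2)[OF that] unfolding w[OF that] pw[OF that] by simp
    have "rel_entropy \<mu> (nu l) \<le> ereal (Ent p)" using ent by simp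
    then have "absolutely_continuous (nu l) \<mu>"
      by (rule rel_entropy_densityE[OF prob_nu R(1)])
    moreover have "- {0..1} \<in> null_sets (nu l)" using nu_unit_interval[OF l] by (intro null_setsI) auto
    ultimately have "emeasure \<mu> (- {0..1}) = 0" by (auto simp: absolutely_continuous_def)
    then show "admissible \<mu>" using R(1) by (simp add: admissible_def \<mu>_def)
  qed
qed

text \<open>The data-processing inequality, from Donsker--Varadhan with the test function ln (p /
  \<open>cell_weight\<close>) of the cell.\<close>

lemma cell_law_entropy:
  assumes l: "l > 1" and mu: "prob_space \<mu>" "sets \<mu> = sets borel" and ent: "rel_entropy \<mu> (nu l) \<le> ereal a"
  shows "cell_density.distribution (cells l L) (cell_law l L \<mu>)"
    "cell_density.Ent (cells l L) (cell_weight l L) (cell_law l L \<mu>) \<le> a"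
proof -
  interpret cell_density "cells l L" "int_cell l L" "cell_weight l L" by (rule cell_density_digits[OF l])
  interpret m: prob_space \<mu> by fact
  define p where "p = cell_law l L \<mu>"
  have p0: "0 \<le> p s" for s by (simp add: p_def cell_law_def)
  have "(\<integral>u. 1 \<partial>\<mu>) = (\<Sum>s\<in>cells l L. 1 * p s)"
    unfolding p_def by (rule cell_integral[OF mu, where f="\<lambda>_. 1"])
  then have p1: "(\<Sum>s\<in>cells l L. p s) = 1" using m.prob_space by simp
  show "distribution (cell_law l L \<mu>)" using p0 p1 by (simp add: distribution_def p_def)
  have "Ent p \<le> a + exp (- real N)" for N :: nat
  proof -
    \<comment> \<open>Where p vanishes the ideal value would be -\<infinity>; the bounded substitute
      -N adds at most e^{-N} to the exponential integral and nothing to the left-hand side.\<close>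
    define \<psi> where "\<psi> s = (if p s = 0 then - real N else ln (p s / cell_weight l L s))" for s
    have wp: "0 < cell_weight l L s" if "s \<in> cells l L" for s using \<nu>_pos[OF that] .
    have meas: "(\<lambda>u. \<psi> (real_cell l L u)) \<in> borel_measurable (nu l)"
      by (rule borel_measurable_integrable, rule finite_range_integral(1)[OF _ finite_cells])
        (use real_cell_sets prob_nu[of l] in \<open>auto simp: prob_space_def\<close>)
    have bd: "\<bar>\<psi> (real_cell l L u)\<bar> \<le> (\<Sum>s\<in>cells l L. \<bar>\<psi> s\<bar>)" for u
      by (rule member_le_sum[of "real_cell l L u" "cells l L" "\<lambda>s. \<bar>\<psi> s\<bar>"]) auto
    have "(\<integral>u. \<psi> (real_cell l L u) \<partial>\<mu>) \<le> a + ln (\<integral>u. exp (\<psi> (real_cell l L u)) \<partial>(nu l))"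
      by (rule Donsker_Varadhan_le[OF prob_nu mu(1) ent meas bd])
    also have "(\<integral>u. \<psi> (real_cell l L u) \<partial>\<mu>) = (\<Sum>s\<in>cells l L. \<psi> s * p s)"
      unfolding p_def by (rule cell_integral[OF mu])
    also have "\<dots> = Ent p" unfolding Ent_def by (intro sum.cong refl) (simp add: \<psi>_def)
    also have "(\<integral>u. exp (\<psi> (real_cell l L u)) \<partial>(nu l)) = (\<Sum>s\<in>cells l L. exp (\<psi> s) * cell_law l L (nu l) s)"
      by (rule cell_integral[OF prob_nu sets_nu, where f="\<lambda>s. exp (\<psi> s)"])
    also have "\<dots> = (\<Sum>s\<in>cells l L. exp (\<psi> s) * cell_weight l L s)"
      unfolding cell_law_def by (intro sum.cong refl) (simp only: nu_cell[OF l])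
    also have "ln \<dots> \<le> exp (- real N)"
    proof -
      have "(\<Sum>s\<in>cells l L. exp (\<psi> s) * cell_weight l L s) \<le> (\<Sum>s\<in>cells l L. p s + exp (- real N) * cell_weight l L s)"
      proof (rule sum_mono)
        fix s assume s: "s \<in> cells l L"
        show "exp (\<psi> s) * cell_weight l L s \<le> p s + exp (- real N) * cell_weight l L s"
        proof (cases "p s = 0")
          case False
          then have "exp (\<psi> s) = p s / cell_weight l L s" using p0[of s] wp[OF s] by (simp add: \<psi>_def less_le)
          then have "exp (\<psi> s) * cell_weight l L s = p s" using wp[OF s] by simp
          moreover have "0 \<le> exp (- real N) * cell_weight l L s" using wp[OF s] by simp
          ultimately show ?thesis by linarith
        qed (simp add: \<psi>_def)
      qed
      also have "\<dots> = 1 + exp (- real N)" unfolding sum.distrib sum_distrib_left[symmetric] p1 \<nu>_sum by simp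
      finally have le: "(\<Sum>s\<in>cells l L. exp (\<psi> s) * cell_weight l L s) \<le> 1 + exp (- real N)" .
      have "cells l L \<noteq> {}" using real_cell_in by blast
      then have "0 < (\<Sum>s\<in>cells l L. exp (\<psi> s) * cell_weight l L s)" using wp by (intro sum_pos) auto
      then have "ln (\<Sum>s\<in>cells l L. exp (\<psi> s) * cell_weight l L s) \<le> ln (1 + exp (- real N))"
        using le by (subst ln_le_cancel_iff) (auto intro: add_pos_pos)
      also have "\<dots> \<le> exp (- real N)" by (rule ln_add_one_self_le_self) simp
      finally show ?thesis .
    qed
    finally show ?thesis by simp
  qed
  moreover have "(\<lambda>N. a + exp (- real N)) \<longlonglongrightarrow> a" by real_asymp
  ultimately have "Ent p \<le> a" by (intro LIMSEQ_le_const[where X="\<lambda>N. a + exp (- real N)"]) auto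
  then show "Ent (cell_law l L \<mu>) \<le> a" by (simp add: p_def)
qed

section \<open>The large deviation bounds\<close>

text \<open>At a suitable truncation level every class law whose functional is near F has entropy at
  least a, and Sanov's upper bound applies. If every level failed, lifting the offending laws and
  extracting a limit would give a measure with pair integral in F and entropy at most a.\<close>

lemma stat_upper_bound:
  assumes l: "l > 1" and F: "closed F" and a: "\<And>x. x \<in> F \<Longrightarrow> ereal a < rate l x" and \<eta>: "\<eta> > 0"
  shows "\<forall>\<^sub>F n in sequentially. sprob n (\<lambda>X. stat l n X \<in> F) \<le> exp (- real n * (a - \<eta>))"
proof -
  define \<epsilon> :: "nat \<Rightarrow> real" where "\<epsilon> k = 1 / real (Suc k)" for k
  have \<epsilon>: "\<epsilon> k > 0" for k by (simp add: \<epsilon>_def)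
  \<comment> \<open>Since M \<ge> a, the truncation error is no larger than the Sanov term; the
    resulting factor 2 is absorbed by half of \<eta>.\<close>
  define M where "M = \<bar>a\<bar> + 1"
  have M: "M > 0" "a \<le> M" by (auto simp: M_def)
  define good where "good k L \<longleftrightarrow> L \<ge> nq l \<and>
      (\<forall>\<^sub>F n in sequentially. sprob n (\<lambda>X. \<epsilon> k \<le> \<bar>stat_upto l L n X - stat l n X\<bar>) \<le> exp (- M * real n)) \<and>
      (\<forall>\<mu>. prob_space \<mu> \<longrightarrow> sets \<mu> = sets borel \<longrightarrow> rel_entropy \<mu> (nu l) \<le> ereal a \<longrightarrow>
        \<bar>quad l L (cell_law l L \<mu>) - pair_integral l \<mu>\<bar> \<le> \<epsilon> k)" for k L
  have "\<exists>L. good k L" for k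
  proof -
    obtain L1 where L1: "L1 \<ge> nq l" "\<And>L. L \<ge> L1 \<Longrightarrow>
      \<forall>\<^sub>F n in sequentially. sprob n (\<lambda>X. \<epsilon> k \<le> \<bar>stat_upto l L n X - stat l n X\<bar>) \<le> exp (- M * real n)"
      using stat_approximation[OF l \<epsilon>[of k] M(1)] by blast
    obtain L2 where L2: "L2 \<ge> nq l" "\<And>L \<mu>. L \<ge> L2 \<Longrightarrow> prob_space \<mu> \<Longrightarrow> sets \<mu> = sets borel \<Longrightarrow>
      rel_entropy \<mu> (nu l) \<le> ereal a \<Longrightarrow> \<bar>quad l L (cell_law l L \<mu>) - pair_integral l \<mu>\<bar> \<le> \<epsilon> k"
      using pair_integral_uniform_approx[OF l \<epsilon>[of k], of a] by blast
    show ?thesis unfolding good_def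
      by (rule exI[of _ "max L1 L2"], intro conjI allI impI L1(2) L2(2)) (use L1(1) in auto)
  qed
  then obtain L where "\<And>k. good k (L k)" by metis
  then have L: "\<And>k. L k \<ge> nq l"
      "\<And>k. \<forall>\<^sub>F n in sequentially. sprob n (\<lambda>X. \<epsilon> k \<le> \<bar>stat_upto l (L k) n X - stat l n X\<bar>) \<le> exp (- M * real n)"
      "\<And>k \<mu>. prob_space \<mu> \<Longrightarrow> sets \<mu> = sets borel \<Longrightarrow> rel_entropy \<mu> (nu l) \<le> ereal a \<Longrightarrow>
        \<bar>quad l (L k) (cell_law l (L k) \<mu>) - pair_integral l \<mu>\<bar> \<le> \<epsilon> k"
    unfolding good_def by blast+
  \<comment> \<open>The enlargement of F by \<epsilon> k, read on the truncated functional: it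
    contains the empirical law whenever the statistic lies in F and the truncation error is at most
    \<epsilon> k.\<close>
  define near where "near k p \<longleftrightarrow> (\<exists>y\<in>F. \<bar>quad l (L k) p - y\<bar> \<le> \<epsilon> k)" for k p
  have "\<exists>k. \<forall>p. cell_density.distribution (cells l (L k)) p \<longrightarrow> near k p \<longrightarrow>
      a \<le> cell_density.Ent (cells l (L k)) (cell_weight l (L k)) p"
  proof (rule ccontr)
    assume "\<not> ?thesis"
    then have "\<exists>p. cell_density.distribution (cells l (L k)) p \<and> near k p \<and>
        cell_density.Ent (cells l (L k)) (cell_weight l (L k)) p < a" for k
      by (meson not_le)
    then have "\<forall>k. \<exists>p. cell_density.distribution (cells l (L k)) p \<and> near k p \<and>
        cell_density.Ent (cells l (L k)) (cell_weight l (L k)) p < a" by (rule allI)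
    from choice[OF this] obtain p where p: "\<And>k. cell_density.distribution (cells l (L k)) (p k)" "\<And>k. near k (p k)"
      "\<And>k. cell_density.Ent (cells l (L k)) (cell_weight l (L k)) (p k) < a"
      by blast
    obtain y where y: "\<And>k. y k \<in> F" "\<And>k. \<bar>quad l (L k) (p k) - y k\<bar> \<le> \<epsilon> k"
      using p(2) unfolding near_def by metis
    have "\<exists>\<mu>. admissible \<mu> \<and> (\<forall>s\<in>cells l (L k). cell_law l (L k) \<mu> s = p k s) \<and> rel_entropy \<mu> (nu l) \<le> ereal a" for k
    proof -
      obtain \<mu> where \<mu>: "admissible \<mu>" "\<And>s. s \<in> cells l (L k) \<Longrightarrow> cell_law l (L k) \<mu> s = p k s"
        "rel_entropy \<mu> (nu l) = ereal (cell_density.Ent (cells l (L k)) (cell_weight l (L k)) (p k))"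
        using cell_law_lift[OF l p(1)[of k]] by blast
      have "rel_entropy \<mu> (nu l) \<le> ereal a" unfolding \<mu>(3) using p(3)[of k] by simp
      then show ?thesis using \<mu>(1,2) by blast
    qed
    then have "\<forall>k. \<exists>\<mu>. admissible \<mu> \<and> (\<forall>s\<in>cells l (L k). cell_law l (L k) \<mu> s = p k s) \<and> rel_entropy \<mu> (nu l) \<le> ereal a"
      by (rule allI)
    from choice[OF this] obtain \<mu> where \<mu>: "\<And>k. admissible (\<mu> k)" "\<And>k s. s \<in> cells l (L k) \<Longrightarrow> cell_law l (L k) (\<mu> k) s = p k s"
      "\<And>k. rel_entropy (\<mu> k) (nu l) \<le> ereal a" by blast
    have close: "\<bar>y k - pair_integral l (\<mu> k)\<bar> \<le> 2 * \<epsilon> k" for k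
    proof -
      have "quad l (L k) (cell_law l (L k) (\<mu> k)) = quad l (L k) (p k)"
        unfolding quad_def using \<mu>(2)[of _ k] by (intro sum.cong refl) simp
      moreover have "\<bar>quad l (L k) (cell_law l (L k) (\<mu> k)) - pair_integral l (\<mu> k)\<bar> \<le> \<epsilon> k"
        using \<mu>(1)[of k] \<mu>(3)[of k] by (intro L(3)) (auto simp: admissible_def)
      ultimately show ?thesis using y(2)[of k] by linarith
    qed
    obtain r N where r: "strict_mono (r :: nat \<Rightarrow> nat)" "admissible N" "rel_entropy N (nu l) \<le> ereal a"
      "(\<lambda>k. pair_integral l (\<mu> (r k))) \<longlonglongrightarrow> pair_integral l N"
      \<comment> \<open>The levels L k vary along the sequence, but the entropy bound a is constant,
        so compactness applies to the lifted measures.\<close>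
      by (rule admissible_compactness[OF l \<mu>(1), where a="\<lambda>_. a" and b=a]) (rule \<mu>(3), rule tendsto_const, rule that)
    have "(\<lambda>k. 2 * \<epsilon> k) \<longlonglongrightarrow> 0" unfolding \<epsilon>_def by real_asymp
    then have "(\<lambda>k. y k - pair_integral l (\<mu> k)) \<longlonglongrightarrow> 0"
      by (rule Lim_null_comparison[rotated]) (use close in simp)
    from LIMSEQ_subseq_LIMSEQ[OF this r(1)]
    have "(\<lambda>k. y (r k) - pair_integral l (\<mu> (r k))) \<longlonglongrightarrow> 0" by (simp add: comp_def)
    from tendsto_add[OF this r(4)] have "(\<lambda>k. y (r k)) \<longlonglongrightarrow> pair_integral l N" by simp
    then have "pair_integral l N \<in> F" by (rule closed_sequentially[OF F y(1)])
    then have "ereal a < rate l (pair_integral l N)" by (rule a)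
    moreover have "rate l (pair_integral l N) \<le> ereal a" by (rule rate_le[OF r(2) refl r(3)])
    ultimately show False by simp
  qed
  then obtain k where k: "\<And>p. cell_density.distribution (cells l (L k)) p \<Longrightarrow> near k p \<Longrightarrow>
      a \<le> cell_density.Ent (cells l (L k)) (cell_weight l (L k)) p" by blast
  interpret cell_density "cells l (L k)" "int_cell l (L k)" "cell_weight l (L k)" by (rule cell_density_digits[OF l])
  have "\<forall>\<^sub>F n in sequentially. sprob n (\<lambda>X. near k (emp n X)) \<le> exp (- real n * (a - \<eta> / 2))"
    by (rule Sanov_upper[OF k]) (use \<eta> in auto)
  moreover have "\<forall>\<^sub>F n in sequentially. exp (- real n * (\<eta> / 2)) < 1 / 2"
  proof -
    have "(\<lambda>n. exp (- real n * (\<eta> / 2))) \<longlonglongrightarrow> 0" using \<eta> by real_asymp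
    then show ?thesis by (rule order_tendstoD) simp
  qed
  ultimately show ?thesis using L(2)[of k] eventually_ge_at_top[of 1]
  proof eventually_elim
    case (elim n)
    have "sprob n (\<lambda>X. stat l n X \<in> F) \<le> sprob n (\<lambda>X. near k (emp n X) \<or> \<epsilon> k \<le> \<bar>stat_upto l (L k) n X - stat l n X\<bar>)"
    proof (rule sprob_mono)
      fix X assume X: "X \<in> samples n" "stat l n X \<in> F"
      have "stat_upto l (L k) n X = quad l (L k) (emp n X)"
        by (rule stat_upto_quad[OF l L(1) X(1) elim(4)])
      then have "near k (emp n X)" if "\<bar>stat_upto l (L k) n X - stat l n X\<bar> \<le> \<epsilon> k"
        unfolding near_def using X(2) that by (intro bexI[of _ "stat l n X"]) simp_all
      then show "near k (emp n X) \<or> \<epsilon> k \<le> \<bar>stat_upto l (L k) n X - stat l n X\<bar>"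
        by linarith
    qed
    also have "\<dots> \<le> exp (- real n * (a - \<eta> / 2)) + exp (- M * real n)"
      using sprob_disj elim(1,3) by (rule order_trans[OF _ add_mono])
    also have "exp (- M * real n) \<le> exp (- real n * (a - \<eta> / 2))"
    proof -
      have "real n * (a - \<eta> / 2) \<le> real n * M" using M(2) \<eta> by (intro mult_left_mono) auto
      then show ?thesis by (simp add: mult.commute)
    qed
    also have "exp (- real n * (a - \<eta> / 2)) + exp (- real n * (a - \<eta> / 2))
        = 2 * exp (- real n * (\<eta> / 2)) * exp (- real n * (a - \<eta>))"
      by (simp add: exp_add[symmetric] algebra_simps)
    also have "\<dots> \<le> 1 * exp (- real n * (a - \<eta>))"
      using elim(2) by (intro mult_right_mono) auto
    finally show ?case by simp
  qed
qed

text \<open>A nearly optimal \<mu> for x has a class law of entropy at most b. Samples with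
  empirical law close to it have probability at least about e^{-n b}, and outside the rare
  truncation errors their statistic lies in G.\<close>

lemma stat_lower_bound:
  assumes l: "l > 1" and G: "open G" "x \<in> G" and b: "rate l x < ereal b" and \<eta>: "\<eta> > 0"
  shows "\<forall>\<^sub>F n in sequentially. exp (- real n * (b + \<eta>)) \<le> sprob n (\<lambda>X. stat l n X \<in> G)"
proof -
  obtain \<mu> where \<mu>: "admissible \<mu>" "pair_integral l \<mu> = x" "rel_entropy \<mu> (nu l) < ereal b"
    using rate_lessE[OF b] by blast
  then have mu: "prob_space \<mu>" "sets \<mu> = sets borel" "rel_entropy \<mu> (nu l) \<le> ereal b"
    by (auto simp: admissible_def)
  obtain e where e: "e > 0" "ball x e \<subseteq> G" using G openE by blast
  \<comment> \<open>A third each for truncating the integral of \<mu>, for the distance of the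
    empirical law from the class law, and for truncating the statistic.\<close>
  define \<epsilon> where "\<epsilon> = e / 3"
  have \<epsilon>: "\<epsilon> > 0" using e by (simp add: \<epsilon>_def)
  \<comment> \<open>Large enough that the truncation error is at most e^{-n} times the Sanov lower
    bound e^{-n (b + \<eta>/2)}.\<close>
  define M where "M = \<bar>b\<bar> + \<eta> + 1"
  have M: "M > 0" using \<eta> by (simp add: M_def)
  obtain L1 where L1: "L1 \<ge> nq l" "\<And>L. L \<ge> L1 \<Longrightarrow>
    \<forall>\<^sub>F n in sequentially. sprob n (\<lambda>X. \<epsilon> \<le> \<bar>stat_upto l L n X - stat l n X\<bar>) \<le> exp (- M * real n)"
    using stat_approximation[OF l \<epsilon> M] by blast
  obtain L2 where L2: "L2 \<ge> nq l" "\<And>L \<mu>. L \<ge> L2 \<Longrightarrow> prob_space \<mu> \<Longrightarrow> sets \<mu> = sets borel \<Longrightarrow>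
    rel_entropy \<mu> (nu l) \<le> ereal b \<Longrightarrow> \<bar>quad l L (cell_law l L \<mu>) - pair_integral l \<mu>\<bar> \<le> \<epsilon>"
    using pair_integral_uniform_approx[OF l \<epsilon>, of b] by blast
  define L where "L = max L1 L2"
  have L: "L \<ge> nq l" using L1(1) by (simp add: L_def)
  have ap: "\<forall>\<^sub>F n in sequentially. sprob n (\<lambda>X. \<epsilon> \<le> \<bar>stat_upto l L n X - stat l n X\<bar>) \<le> exp (- M * real n)"
    by (rule L1(2)) (simp add: L_def)
  define p where "p = cell_law l L \<mu>"
  have qp: "\<bar>quad l L p - x\<bar> \<le> \<epsilon>"
    unfolding p_def \<mu>(2)[symmetric] by (rule L2(2)[OF _ mu]) (simp add: L_def)
  interpret cell_density "cells l L" "int_cell l L" "cell_weight l L" by (rule cell_density_digits[OF l])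
  have pd: "distribution p" and pe: "Ent p \<le> b"
    unfolding p_def by (rule cell_law_entropy[OF l mu])+
  define K where "K = real (card (cells l L))"
  \<comment> \<open>On distributions \<open>quad\<close> is Lipschitz in the maximum distance with
    constant 2 K^2; the added 1 makes the final inequality strict.\<close>
  define \<delta> where "\<delta> = \<epsilon> / (2 * K * K + 1)"
  have K: "2 * K * K + 1 > 0" by (intro add_nonneg_pos) (auto simp: K_def)
  have \<delta>: "\<delta> > 0" using \<epsilon> K by (simp add: \<delta>_def)
  have small: "K * (K * (2 * \<delta>)) < \<epsilon>"
  proof -
    have "K * (K * (2 * \<delta>)) = \<epsilon> * (2 * K * K / (2 * K * K + 1))" by (simp add: \<delta>_def)
    also have "\<dots> < \<epsilon> * 1"
      using \<epsilon> K by (intro mult_strict_left_mono) (simp_all add: pos_divide_less_eq)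
    finally show ?thesis by simp
  qed
  have le1: "q s \<le> 1" if "distribution q" "s \<in> cells l L" for q s
    using that member_le_sum[of s "cells l L" q] by (auto simp: distribution_def)
  have lip: "\<bar>quad l L q - quad l L p\<bar> < \<epsilon>"
    if q: "distribution q" and d: "\<And>s. s \<in> cells l L \<Longrightarrow> \<bar>q s - p s\<bar> < \<delta>" for q
  proof -
    have tm: "\<bar>of_bool P * (q s * q t) - of_bool P * (p s * p t)\<bar> \<le> 2 * \<delta>"
      if s: "s \<in> cells l L" and t: "t \<in> cells l L" for s t P
    proof -
      have "\<bar>q s * q t - p s * p t\<bar> = \<bar>(q s - p s) * q t + p s * (q t - p t)\<bar>" by (simp add: algebra_simps)
      also have "\<dots> \<le> \<bar>(q s - p s) * q t\<bar> + \<bar>p s * (q t - p t)\<bar>" by (rule abs_triangle_ineq)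
      also have "\<dots> \<le> \<delta> * 1 + 1 * \<delta>"
        unfolding abs_mult using d[OF s] d[OF t] le1[OF q t] le1[OF pd s] q pd s t \<delta>
        by (intro add_mono mult_mono) (auto simp: distribution_def)
      finally show ?thesis using \<delta> by (cases P) auto
    qed
    have "\<bar>quad l L q - quad l L p\<bar> = \<bar>\<Sum>s\<in>cells l L. \<Sum>t\<in>cells l L.
        of_bool (compatible_upto l L s t) * (q s * q t) - of_bool (compatible_upto l L s t) * (p s * p t)\<bar>"
      unfolding quad_def sum_subtractf by (rule refl)
    also have "\<dots> \<le> (\<Sum>s\<in>cells l L. \<Sum>t\<in>cells l L. 2 * \<delta>)"
      by (intro order_trans[OF sum_abs] sum_mono tm)
    also have "\<dots> = K * (K * (2 * \<delta>))" by (simp add: K_def)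
    finally show ?thesis using small by linarith
  qed
  have "\<forall>\<^sub>F n in sequentially. exp (- real n * (Ent p + \<eta> / 2)) \<le> sprob n (\<lambda>X. \<forall>s\<in>cells l L. \<bar>emp n X s - p s\<bar> < \<delta>)"
    by (rule Sanov_lower[OF pd \<delta>]) (use \<eta> in simp)
  moreover have "\<forall>\<^sub>F n in sequentially. exp (- real n) + exp (- real n * (\<eta> / 2)) < 1"
  proof -
    have "(\<lambda>n. exp (- real n)) \<longlonglongrightarrow> 0" by real_asymp
    moreover have "(\<lambda>n. exp (- real n * (\<eta> / 2))) \<longlonglongrightarrow> 0" using \<eta> by real_asymp
    ultimately have "(\<lambda>n. exp (- real n) + exp (- real n * (\<eta> / 2))) \<longlonglongrightarrow> 0" by (rule tendsto_add_zero)
    then show ?thesis by (rule order_tendstoD) simp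
  qed
  ultimately show ?thesis using ap eventually_ge_at_top[of 1]
  proof eventually_elim
    case (elim n)
    have "sprob n (\<lambda>X. \<forall>s\<in>cells l L. \<bar>emp n X s - p s\<bar> < \<delta>)
        \<le> sprob n (\<lambda>X. stat l n X \<in> G \<or> \<epsilon> \<le> \<bar>stat_upto l L n X - stat l n X\<bar>)"
    proof (rule sprob_mono)
      fix X assume X: "X \<in> samples n" "\<forall>s\<in>cells l L. \<bar>emp n X s - p s\<bar> < \<delta>"
      have "stat_upto l L n X = quad l L (emp n X)" by (rule stat_upto_quad[OF l L X(1) elim(4)])
      then have "\<bar>stat_upto l L n X - quad l L p\<bar> < \<epsilon>"
        using lip[OF distribution_emp[OF X(1) elim(4)]] X(2) by simp
      then have "\<bar>stat_upto l L n X - stat l n X\<bar> < \<epsilon> \<Longrightarrow> \<bar>x - stat l n X\<bar> < e"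
        using qp unfolding \<epsilon>_def by linarith
      then show "stat l n X \<in> G \<or> \<epsilon> \<le> \<bar>stat_upto l L n X - stat l n X\<bar>"
        using e(2) by (auto simp: dist_real_def subset_iff)
    qed
    also have "\<dots> \<le> sprob n (\<lambda>X. stat l n X \<in> G) + exp (- M * real n)"
      using sprob_disj elim(3) by (rule order_trans[OF _ add_left_mono])
    finally have "exp (- real n * (Ent p + \<eta> / 2)) \<le> sprob n (\<lambda>X. stat l n X \<in> G) + exp (- M * real n)"
      using elim(1) by linarith
    moreover have "exp (- real n * (b + \<eta> / 2)) \<le> exp (- real n * (Ent p + \<eta> / 2))"
      using mult_left_mono[OF pe, of "real n"] by (simp add: algebra_simps)
    moreover have "exp (- M * real n) \<le> exp (- real n * (b + \<eta> / 2)) * exp (- real n)"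
    proof -
      have "real n * (b + \<eta> / 2 + 1) \<le> real n * M" using \<eta> by (intro mult_left_mono) (auto simp: M_def)
      then show ?thesis by (simp add: exp_add[symmetric] algebra_simps)
    qed
    moreover have "exp (- real n * (b + \<eta>)) = exp (- real n * (b + \<eta> / 2)) * exp (- real n * (\<eta> / 2))"
      by (simp add: exp_add[symmetric] algebra_simps)
    moreover have "exp (- real n * (b + \<eta> / 2)) * exp (- real n) + exp (- real n * (b + \<eta> / 2)) * exp (- real n * (\<eta> / 2))
        \<le> exp (- real n * (b + \<eta> / 2))"
      unfolding distrib_left[symmetric] using elim(2) by (intro mult_left_le) auto
    ultimately show ?case by linarith
  qed
qed

section \<open>From exponential bounds to the large deviation principle\<close>

lemma eln_divide_le:
  assumes "0 \<le> p" "p \<le> exp (- real n * c)" "n \<ge> 1"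
  shows "eln p / ereal (real n) \<le> ereal (- c)"
proof (cases "p = 0")
  case False
  then have "ln p \<le> ln (exp (- real n * c))" using assms by (subst ln_le_cancel_iff) auto
  then have "ln p / real n \<le> - c" using assms(3) by (simp add: field_simps)
  then show ?thesis using False assms(3) by (simp add: eln_def)
qed (use assms(3) in \<open>simp add: eln_def\<close>)

lemma eln_divide_ge:
  assumes "exp (- real n * c) \<le> p" "n \<ge> 1"
  shows "ereal (- c) \<le> eln p / ereal (real n)"
proof -
  have p: "p > 0" using assms(1) by (meson exp_gt_zero less_le_trans)
  then have "ln (exp (- real n * c)) \<le> ln p" using assms by (subst ln_le_cancel_iff) auto
  then have "- c \<le> ln p / real n" using assms(2) by (simp add: field_simps)
  then show ?thesis using p assms(2) by (simp add: eln_def)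
qed

theorem theorem2p3:
  fixes l :: nat
  assumes "l > 1"
  shows "LDP (\<lambda>n. measure_pmf (gcd_stat_law l n)) (rate l)"
  unfolding LDP_def
proof (intro conjI allI ballI)
  show "rate l x \<ge> 0" for x by (rule rate_nonneg)
  show "lower_semicont (rate l)" by (rule lower_semicont_rate[OF assms])
  fix A :: "real set"
  let ?P = "\<lambda>n. eln (measure (measure_pmf (gcd_stat_law l n)) A) / ereal (real n)"
  have lim: "ereal (- c) \<le> liminf ?P" if x: "x \<in> interior A" and c: "rate l x < ereal c" for x c
  proof -
    \<comment> \<open>The gap between b and c pays for the loss \<eta> in the lower bound, so that
      the level c itself is reached.\<close>
    obtain b where b: "rate l x < ereal b" "b < c" using ereal_dense2[OF c] by auto
    have "\<forall>\<^sub>F n in sequentially. exp (- real n * (b + (c - b))) \<le> sprob n (\<lambda>X. stat l n X \<in> interior A)"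
      by (rule stat_lower_bound[OF assms open_interior x b(1)]) (use b in simp)
    then have "\<forall>\<^sub>F n in sequentially. ereal (- c) \<le> ?P n"
      using eventually_ge_at_top[of 1]
    proof eventually_elim
      case (elim n)
      have "sprob n (\<lambda>X. stat l n X \<in> interior A) \<le> measure (measure_pmf (gcd_stat_law l n)) A"
        unfolding gcd_stat_law_sprob[OF assms elim(2)] using interior_subset by (intro sprob_mono) auto
      then show ?case using elim by (intro eln_divide_ge) auto
    qed
    then show ?thesis by (rule Liminf_bounded)
  qed
  show "- (INF x\<in>interior A. rate l x) \<le> liminf ?P"
  proof -
    \<comment> \<open>Comparing with real levels c above \<open>rate l x\<close> also covers the
      value \<infinity>, above which no level exists.\<close>
    have "- liminf ?P \<le> rate l x" if x: "x \<in> interior A" for x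
    proof (rule dense_ge)
      fix y assume y: "rate l x < y"
      then obtain c where c: "rate l x < ereal c" "ereal c < y" using ereal_dense2 by blast
      have "- liminf ?P \<le> ereal c" using lim[OF x c(1)] by (simp add: ereal_uminus_le_reorder)
      then show "- liminf ?P \<le> y" using c(2) by (meson less_imp_le order_trans)
    qed
    then have "- liminf ?P \<le> (INF x\<in>interior A. rate l x)" by (rule INF_greatest)
    then show ?thesis by (simp add: ereal_uminus_le_reorder)
  qed
  have lis: "limsup ?P \<le> ereal (- c)" if c: "ereal c < (INF x\<in>closure A. rate l x)" for c
  proof -
    \<comment> \<open>Here the gap between c and a is the loss \<eta>. Working with real levels
      below the infimum includes the case where it is \<infinity>, for instance for empty A.\<close>
    obtain a where a: "c < a" "ereal a < (INF x\<in>closure A. rate l x)" using ereal_dense2[OF c] by auto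
    have "\<forall>\<^sub>F n in sequentially. sprob n (\<lambda>X. stat l n X \<in> closure A) \<le> exp (- real n * (a - (a - c)))"
      by (rule stat_upper_bound[OF assms closed_closure]) (use a in \<open>auto intro: less_INF_D\<close>)
    then have "\<forall>\<^sub>F n in sequentially. ?P n \<le> ereal (- c)"
      using eventually_ge_at_top[of 1]
    proof eventually_elim
      case (elim n)
      have "measure (measure_pmf (gcd_stat_law l n)) A \<le> sprob n (\<lambda>X. stat l n X \<in> closure A)"
        unfolding gcd_stat_law_sprob[OF assms elim(2)] using closure_subset by (intro sprob_mono) auto
      then show ?case using elim by (intro eln_divide_le) auto
    qed
    then show ?thesis by (rule Limsup_bounded)
  qed
  show "limsup ?P \<le> - (INF x\<in>closure A. rate l x)"
  proof -
    have "(INF x\<in>closure A. rate l x) \<le> - limsup ?P"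
    proof (rule dense_le)
      fix y assume y: "y < (INF x\<in>closure A. rate l x)"
      then obtain c where c: "y < ereal c" "ereal c < (INF x\<in>closure A. rate l x)" using ereal_dense2 by blast
      have "ereal c \<le> - limsup ?P" using lis[OF c(2)] ereal_minus_le_minus[of "- limsup ?P" "ereal c"] by simp
      then show "y \<le> - limsup ?P" using c(1) by (meson less_imp_le order_trans)
    qed
    then show ?thesis using ereal_minus_le_minus[of "- limsup ?P" "INF x\<in>closure A. rate l x"] by simp
  qed
qed

end
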